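(* Let $\mathfrak N=\mathrm{NAlt}^{(2)}$ be the variety of alternative metabelian nilalgebras of index at most $3$ over a field $F$ of characteristic $0$, i.e. the variety defined by the identities $(x,x,y)=0$, $(x,y,y)=0$, $(xy)(zt)=0$, $x^3=0$. Then the basic spectrum of $\mathfrak N$ is $$\mathrm{sp}_b(\mathfrak N)=\{(0,1)\},$$ and all inclusions $\mathfrak N_n\subset\mathfrak N_{n+1}$, $n\geqslant 1$, are strict.
   Context: All algebras are over a field $F$ of characteristic $0$ and are not assumed associative or unital. $(x,y,z)=(xy)z-x(yz)$ is the associator. For a variety $\mathcal V$, $\mathcal V_n$ denotes the subvariety generated by the free $\mathcal V$-algebra of rank $n$. A superalgebra is a $\mathbb Z_2$-graded algebra $\mathcal A=\mathcal A_0+\mathcal A_1$, $\mathcal A_i\mathcal A_j\subseteq\mathcal A_{i+j \bmod 2}$. $\mathrm G=\mathrm G_0+\mathrm G_1$ is the Grassmann algebra on countably many anticommuting generators $e_1,e_2,\dots$ ($\mathrm G_0$, $\mathrm G_1$ spanned by words of even, resp. odd, length). The Grassmann envelope of $\mathcal A$ is $\mathrm G(\mathcal A)=\mathrm G_0\otimes\mathcal A_0+\mathrm G_1\otimes\mathcal A_1\subseteq \mathrm G\otimes\mathcal A$. For a multilinear polynomial $f$, its superization $\tilde f$ is obtained by the Koszul sign rule (a sign $(-1)^{ij}$ whenever a variable of parity $i$ passes through one of parity $j$); $\mathcal A$ satisfies the superidentity $\tilde f=0$ if and only if $\mathrm G(\mathcal A)$ satisfies $f=0$. For a variety $\mathcal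 V$, a $\mathcal V$-superalgebra is a superalgebra $\mathcal A$ with $\mathrm G(\mathcal A)\in\mathcal V$; $\tilde{\mathcal V}$ is the class of all $\mathcal V$-superalgebras. The supervariety generated by a superalgebra $\mathcal B$ is the class of all superalgebras satisfying every superidentity $\tilde f=0$ ($f$ multilinear) satisfied by $\mathcal B$. For nonnegative integers $(r,s)\ne(0,0)$, $\mathcal V_{r,s}$ is the supervariety generated by the free $\mathcal V$-superalgebra on $r$ even and $s$ odd generators; $\mathcal V_{0,0}=\{\{0\}\}$. A pair $(r,s)$ is a basic superrank of $\mathcal V$ if $\mathcal V_{r,s}=\tilde{\mathcal V}$ and $(r,s)$ is minimal with this property, i.e. $\mathcal V_{r',s'}\ne\tilde{\mathcal V}$ for every $(r',s')\neq(r,s)$ with $r'\leqslant r$, $s'\leqslant s$. The basic spectrum $\mathrm{sp}_b(\mathcal V)$ is the set of all (finite) basic superranks of $\mathcal V$. *)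

theory Defs
  imports
    "HOL-Algebra.Module"
    "HOL-Algebra.QuotRing"
    "HOL-Library.Poly_Mapping"
    "HOL-Library.Z2"
begin

section \<open>Nonassociative algebras and superalgebras over a field\<close>

text \<open>
  The base field is a type \<open>'a\<close> of class \<^class>\<open>field_char_0\<close>; \<open>base_ring\<close> is that field as a ring
  record.  Algebras are records of type \<^typ>\<open>('a, 'v) module\<close> (with explicit carriers, so that a
  class of algebras is a set of records).  That record type has a component \<^const>\<open>one\<close>; nothing
  is ever required of it, since algebras are not assumed unital.
\<close>

definition base_ring :: "'a::field ring" where
  "base_ring = \<lparr>carrier = UNIV, mult = (*), one = 1, zero = 0, add = (+)\<rparr>"

locale nonassoc_algebra = module base_ring A
  for A :: "('a::field, 'v, 'm) module_scheme" (structure) +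
  assumes mult_closed: "\<lbrakk>x \<in> carrier A; y \<in> carrier A\<rbrakk> \<Longrightarrow> x \<otimes> y \<in> carrier A"
    and mult_add_left: "\<lbrakk>x \<in> carrier A; y \<in> carrier A; z \<in> carrier A\<rbrakk>
          \<Longrightarrow> (x \<oplus> y) \<otimes> z = x \<otimes> z \<oplus> y \<otimes> z"
    and mult_add_right: "\<lbrakk>x \<in> carrier A; y \<in> carrier A; z \<in> carrier A\<rbrakk>
          \<Longrightarrow> x \<otimes> (y \<oplus> z) = x \<otimes> y \<oplus> x \<otimes> z"
    and mult_smult_left: "\<lbrakk>x \<in> carrier A; y \<in> carrier A\<rbrakk> \<Longrightarrow> (c \<odot> x) \<otimes> y = c \<odot> (x \<otimes> y)"
    and mult_smult_right: "\<lbrakk>x \<in> carrier A; y \<in> carrier A\<rbrakk> \<Longrightarrow> x \<otimes> (c \<odot> y) = c \<odot> (x \<otimes> y)"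

text \<open>The grading group is \<^typ>\<open>bit\<close>, the integers modulo 2.\<close>

record ('a, 'v) superalg = "('a, 'v) module" +
  part :: "bit \<Rightarrow> 'v set"

locale superalgebra = nonassoc_algebra A
  for A :: "('a::field, 'v, 'm) superalg_scheme" (structure) +
  assumes part_submodule: "submodule (part A i) base_ring A"
    and part_decomp: "x \<in> carrier A \<Longrightarrow> \<exists>y\<in>part A 0. \<exists>z\<in>part A 1. x = y \<oplus> z"
    and part_direct: "part A 0 \<inter> part A 1 = {\<zero>}"
    and part_mult: "\<lbrakk>x \<in> part A i; y \<in> part A j\<rbrakk> \<Longrightarrow> x \<otimes> y \<in> part A (i + j)"

definition alg_ideal :: "'v set \<Rightarrow> ('a::field, 'v, 'm) module_scheme \<Rightarrow> bool" where
  "alg_ideal I A \<longleftrightarrow> submodule I base_ring A \<and>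
     (\<forall>a\<in>carrier A. \<forall>x\<in>I. a \<otimes>\<^bsub>A\<^esub> x \<in> I \<and> x \<otimes>\<^bsub>A\<^esub> a \<in> I)"

definition graded_ideal :: "'v set \<Rightarrow> ('a::field, 'v, 'm) superalg_scheme \<Rightarrow> bool" where
  "graded_ideal I A \<longleftrightarrow> alg_ideal I A \<and>
     (\<forall>x\<in>I. \<exists>y\<in>I \<inter> part A 0. \<exists>z\<in>I \<inter> part A 1. x = y \<oplus>\<^bsub>A\<^esub> z)"

definition quot_smult :: "('a::field, 'v, 'm) module_scheme \<Rightarrow> 'v set \<Rightarrow> 'a \<Rightarrow> 'v set \<Rightarrow> 'v set" where
  "quot_smult A I c X = (\<Union>x\<in>X. I +>\<^bsub>A\<^esub> (c \<odot>\<^bsub>A\<^esub> x))"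

definition quot_alg :: "('a::field, 'v, 'm) module_scheme \<Rightarrow> 'v set \<Rightarrow> ('a, 'v set) module" where
  "quot_alg A I = \<lparr>carrier = a_rcosets\<^bsub>A\<^esub> I, mult = rcoset_mult A I, one = I +>\<^bsub>A\<^esub> \<one>\<^bsub>A\<^esub>,
     zero = I, add = set_add A, smult = quot_smult A I\<rparr>"

definition quot_superalg ::
  "('a::field, 'v, 'm) superalg_scheme \<Rightarrow> 'v set \<Rightarrow> ('a, 'v set) superalg" where
  "quot_superalg A I = \<lparr>carrier = a_rcosets\<^bsub>A\<^esub> I, mult = rcoset_mult A I, one = I +>\<^bsub>A\<^esub> \<one>\<^bsub>A\<^esub>,
     zero = I, add = set_add A, smult = quot_smult A I,
     part = (\<lambda>i. (\<lambda>x. I +>\<^bsub>A\<^esub> x) ` part A i)\<rparr>"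


section \<open>Nonassociative polynomials\<close>

text \<open>Nonassociative monomials in the variables \<open>Var 0, Var 1, \<dots>\<close>, without the empty word.\<close>

datatype nmonom = Var nat | Mul nmonom nmonom

fun letters :: "nmonom \<Rightarrow> nat list" where
  "letters (Var x) = [x]"
| "letters (Mul u v) = letters u @ letters v"

type_synonym 'a npoly = "nmonom \<Rightarrow>\<^sub>0 'a"

definition nvar :: "nat \<Rightarrow> 'a::field npoly" where
  "nvar x = Poly_Mapping.single (Var x) 1"

definition nmult :: "'a::field npoly \<Rightarrow> 'a npoly \<Rightarrow> 'a npoly" where
  "nmult f g = (\<Sum>u\<in>Poly_Mapping.keys f. \<Sum>v\<in>Poly_Mapping.keys g.
     Poly_Mapping.single (Mul u v) (Poly_Mapping.lookup f u * Poly_Mapping.lookup g v))"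

definition nsmult :: "'a::field \<Rightarrow> 'a npoly \<Rightarrow> 'a npoly" where
  "nsmult c f = Poly_Mapping.map ((*) c) f"

definition nassociator :: "'a::field npoly \<Rightarrow> 'a npoly \<Rightarrow> 'a npoly \<Rightarrow> 'a npoly" where
  "nassociator f g h = nmult (nmult f g) h - nmult f (nmult g h)"

fun eval_monom :: "('a, 'v, 'm) module_scheme \<Rightarrow> (nat \<Rightarrow> 'v) \<Rightarrow> nmonom \<Rightarrow> 'v" where
  "eval_monom A a (Var x) = a x"
| "eval_monom A a (Mul u v) = eval_monom A a u \<otimes>\<^bsub>A\<^esub> eval_monom A a v"

definition eval_poly ::
  "('a::field, 'v, 'm) module_scheme \<Rightarrow> (nat \<Rightarrow> 'v) \<Rightarrow> 'a npoly \<Rightarrow> 'v" where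
  "eval_poly A a f =
     (\<Oplus>\<^bsub>A\<^esub>m\<in>Poly_Mapping.keys f. Poly_Mapping.lookup f m \<odot>\<^bsub>A\<^esub> eval_monom A a m)"

definition satisfies :: "('a::field, 'v, 'm) module_scheme \<Rightarrow> 'a npoly \<Rightarrow> bool" where
  "satisfies A f \<longleftrightarrow> (\<forall>a. (\<forall>x. a x \<in> carrier A) \<longrightarrow> eval_poly A a f = \<zero>\<^bsub>A\<^esub>)"


section \<open>Varieties\<close>

text \<open>
  A variety is given by a set \<open>E\<close> of defining identities.  Its members are collected for each
  carrier type \<open>'v\<close>.  Equalities and strict inclusions between such classes are only meaningful
  if \<open>'v\<close> is large enough to carry the countably generated free algebras; an injection from
  \<^typ>\<open>'a npoly\<close> into \<open>'v\<close> suffices.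
\<close>

definition variety :: "'a::field npoly set \<Rightarrow> ('a, 'v) module set" where
  "variety E = {A. nonassoc_algebra A \<and> (\<forall>f\<in>E. satisfies A f)}"

definition generated_variety :: "('a::field, 'w) module \<Rightarrow> ('a, 'v) module set" where
  "generated_variety B = {A. nonassoc_algebra A \<and> (\<forall>f. satisfies B f \<longrightarrow> satisfies A f)}"

text \<open>The absolutely free algebra on the variables in \<open>X\<close>.\<close>

definition free_alg :: "nat set \<Rightarrow> ('a::field, 'a npoly) module" where
  "free_alg X = \<lparr>carrier = {f. \<forall>m\<in>Poly_Mapping.keys f. set (letters m) \<subseteq> X},
     mult = nmult, one = 0, zero = 0, add = (+), smult = nsmult\<rparr>"

text \<open>
  The free algebra of rank \<open>n\<close> of the variety defined by \<open>E\<close>: the largest quotient of the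
  absolutely free algebra that lies in the variety.
\<close>

definition rel_ideal :: "'a::field npoly set \<Rightarrow> nat \<Rightarrow> 'a npoly set" where
  "rel_ideal E n =
     \<Inter>{I. alg_ideal I (free_alg {..<n}) \<and> quot_alg (free_alg {..<n}) I \<in> variety E}"

definition var_free_alg :: "'a::field npoly set \<Rightarrow> nat \<Rightarrow> ('a, 'a npoly set) module" where
  "var_free_alg E n = quot_alg (free_alg {..<n}) (rel_ideal E n)"

definition rank_variety :: "'a::field npoly set \<Rightarrow> nat \<Rightarrow> ('a, 'v) module set" where
  "rank_variety E n = generated_variety (var_free_alg E n)"


section \<open>Grassmann envelopes\<close>

text \<open>
  For a finite set \<open>S\<close> of naturals let \<open>e\<^sub>S\<close> be the product of the generators \<open>e\<^sub>i\<close>, \<open>i \<in> S\<close>, in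
  increasing order of \<open>i\<close>.  These words form a basis of the Grassmann algebra, and
  \<open>e\<^sub>S e\<^sub>T = grass_sign S T e\<^bsub>S \<union> T\<^esub>\<close> if \<open>S\<close> and \<open>T\<close> are disjoint, \<open>e\<^sub>S e\<^sub>T = 0\<close> otherwise.  The
  element \<open>\<Sum>\<^sub>S e\<^sub>S \<otimes> h S\<close> of the tensor product of the Grassmann algebra and \<open>A\<close> is represented by
  the function \<open>h\<close>, which is zero outside a finite set of finite sets \<open>S\<close>.
\<close>

definition grass_sign :: "nat set \<Rightarrow> nat set \<Rightarrow> 'a::field" where
  "grass_sign S T = (-1) ^ card {(s, t). s \<in> S \<and> t \<in> T \<and> t < s}"

definition grassmann_envelope ::
  "('a::field, 'v, 'm) superalg_scheme \<Rightarrow> ('a, nat set \<Rightarrow> 'v) module" where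
  "grassmann_envelope A = \<lparr>
     carrier = {h. (\<forall>S. h S \<in> part A (of_nat (card S))) \<and>
                   (\<forall>S. infinite S \<longrightarrow> h S = \<zero>\<^bsub>A\<^esub>) \<and> finite {S. h S \<noteq> \<zero>\<^bsub>A\<^esub>}},
     mult = (\<lambda>h k U. if finite U
               then \<Oplus>\<^bsub>A\<^esub>S\<in>Pow U. grass_sign S (U - S) \<odot>\<^bsub>A\<^esub> (h S \<otimes>\<^bsub>A\<^esub> k (U - S))
               else \<zero>\<^bsub>A\<^esub>),
     one = (\<lambda>S. \<zero>\<^bsub>A\<^esub>),
     zero = (\<lambda>S. \<zero>\<^bsub>A\<^esub>),
     add = (\<lambda>h k S. h S \<oplus>\<^bsub>A\<^esub> k S),
     smult = (\<lambda>c h S. c \<odot>\<^bsub>A\<^esub> h S)\<rparr>"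

definition var_superalgs :: "'a::field npoly set \<Rightarrow> ('a, 'v) superalg set" where
  "var_superalgs E = {A. superalgebra A \<and> grassmann_envelope A \<in> variety E}"


section \<open>Superidentities\<close>

definition multilinear :: "'a::field npoly \<Rightarrow> bool" where
  "multilinear f \<longleftrightarrow>
     (\<exists>X. \<forall>m\<in>Poly_Mapping.keys f. distinct (letters m) \<and> set (letters m) = X)"

definition parity_sign :: "bit \<Rightarrow> bit \<Rightarrow> 'a::field" where
  "parity_sign i j = (if i = 1 \<and> j = 1 then -1 else 1)"

text \<open>
  The sign picked up when the letters of the word \<open>w\<close>, where \<open>x\<close> has parity \<open>p x\<close>, are permuted
  from increasing order into the order in which they occur in \<open>w\<close>.
\<close>

definition koszul_sign :: "(nat \<Rightarrow> bit) \<Rightarrow> nat list \<Rightarrow> 'a::field" where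
  "koszul_sign p w =
     (\<Prod>(i, j)\<in>{(i, j). i < j \<and> j < length w \<and> w ! j < w ! i}.
        parity_sign (p (w ! i)) (p (w ! j)))"

definition superization :: "(nat \<Rightarrow> bit) \<Rightarrow> 'a::field npoly \<Rightarrow> 'a npoly" where
  "superization p f = Poly_Mapping.mapp (\<lambda>m c. koszul_sign p (letters m) * c) f"

definition super_satisfies :: "('a::field, 'v, 'm) superalg_scheme \<Rightarrow> 'a npoly \<Rightarrow> bool" where
  "super_satisfies A f \<longleftrightarrow>
     (\<forall>p a. (\<forall>x. a x \<in> part A (p x)) \<longrightarrow> eval_poly A a (superization p f) = \<zero>\<^bsub>A\<^esub>)"

definition generated_supervariety :: "('a::field, 'w) superalg \<Rightarrow> ('a, 'v) superalg set" where
  "generated_supervariety B =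
     {A. superalgebra A \<and> (\<forall>f. multilinear f \<longrightarrow> super_satisfies B f \<longrightarrow> super_satisfies A f)}"


section \<open>Basic superranks\<close>

fun monom_parity :: "(nat \<Rightarrow> bit) \<Rightarrow> nmonom \<Rightarrow> bit" where
  "monom_parity p (Var x) = p x"
| "monom_parity p (Mul u v) = monom_parity p u + monom_parity p v"

definition free_superalg :: "nat set \<Rightarrow> (nat \<Rightarrow> bit) \<Rightarrow> ('a::field, 'a npoly) superalg" where
  "free_superalg X p = \<lparr>carrier = {f. \<forall>m\<in>Poly_Mapping.keys f. set (letters m) \<subseteq> X},
     mult = nmult, one = 0, zero = 0, add = (+), smult = nsmult,
     part = (\<lambda>i. {f. \<forall>m\<in>Poly_Mapping.keys f. set (letters m) \<subseteq> X \<and> monom_parity p m = i})\<rparr>"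

text \<open>Generators \<open>Var x\<close> with \<open>x < r\<close> are even, those with \<open>r \<le> x < r + s\<close> are odd.\<close>

definition free_superalg_rs :: "nat \<Rightarrow> nat \<Rightarrow> ('a::field, 'a npoly) superalg" where
  "free_superalg_rs r s = free_superalg {..<r + s} (\<lambda>x. if x < r then 0 else 1)"

definition super_rel_ideal :: "'a::field npoly set \<Rightarrow> nat \<Rightarrow> nat \<Rightarrow> 'a npoly set" where
  "super_rel_ideal E r s =
     \<Inter>{I. graded_ideal I (free_superalg_rs r s) \<and>
         quot_superalg (free_superalg_rs r s) I \<in> var_superalgs E}"

definition var_free_superalg ::
  "'a::field npoly set \<Rightarrow> nat \<Rightarrow> nat \<Rightarrow> ('a, 'a npoly set) superalg" where
  "var_free_superalg E r s = quot_superalg (free_superalg_rs r s) (super_rel_ideal E r s)"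

definition rank_supervariety ::
  "'a::field npoly set \<Rightarrow> nat \<Rightarrow> nat \<Rightarrow> ('a, 'v) superalg set" where
  "rank_supervariety E r s =
     (if r = 0 \<and> s = 0 then {A. superalgebra A \<and> carrier A = {\<zero>\<^bsub>A\<^esub>}}
      else generated_supervariety (var_free_superalg E r s))"

text \<open>The argument of type \<^typ>\<open>'v itself\<close> fixes the carrier type of the superalgebras considered.\<close>

definition basic_superrank ::
  "'v itself \<Rightarrow> 'a::field npoly set \<Rightarrow> nat \<Rightarrow> nat \<Rightarrow> bool" where
  "basic_superrank _ E r s \<longleftrightarrow>
     (rank_supervariety E r s :: ('a, 'v) superalg set) = var_superalgs E \<and>
     (\<forall>r' s'. (r', s') \<noteq> (r, s) \<and> r' \<le> r \<and> s' \<le> s \<longrightarrow>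
        (rank_supervariety E r' s' :: ('a, 'v) superalg set) \<noteq> var_superalgs E)"

definition basic_spectrum :: "'v itself \<Rightarrow> 'a::field npoly set \<Rightarrow> (nat \<times> nat) set" where
  "basic_spectrum V E = {(r, s). basic_superrank V E r s}"


section \<open>Alternative metabelian nilalgebras of index at most 3\<close>

definition nalt2_identities :: "'a::field npoly set" where
  "nalt2_identities =
     (let x = nvar 0; y = nvar 1; z = nvar 2; t = nvar 3
      in {nassociator x x y, nassociator x y y, nmult (nmult x y) (nmult z t), nmult (nmult x x) x})"

end

theory Submission
  imports Defs
begin

text \<open>
  In an algebra \<open>A\<close> of the variety the square \<open>A\<^sup>2\<close> annihilates itself, and the operators \<open>R\<^sub>x\<close>, \<open>L\<^sub>x\<close> on \<open>A\<^sup>2\<close>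
  satisfy: \<open>R\<^sub>x R\<^sub>y = L\<^sub>x L\<^sub>y\<close> and \<open>L\<^sub>x R\<^sub>y\<close> are skew-symmetric, and \<open>R\<^sub>y L\<^sub>x = L\<^sub>x R\<^sub>y + R\<^sub>x R\<^sub>y\<close>.  Hence replacing
  one variable of a multilinear monomial of degree \<open>n\<close> by a square leaves a combination of just two
  skew-symmetric words, \<open>R\<dots>R\<close> and \<open>L R\<dots>R\<close>.  For \<open>n \<ge> 3\<close> the \<open>2 n\<close> coefficients obtained in this way
  determine the monomial modulo the identities, since it can be rebuilt from them.  They
  are read off in a superalgebra \<open>x F + M\<close> generated by one odd element \<open>x\<close>, by substituting \<open>x\<^sup>2\<close> for one
  variable and \<open>x\<close> for the others; so the free superalgebra on one odd generator satisfies no extra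
  superidentities.  Because the words are skew-symmetric in \<open>n - 1\<close> variables, an algebra on \<open>n\<close> generators is
  nilpotent of index \<open>n + 2\<close>, whereas in the Grassmann envelope of the superalgebra the product
  \<open>(\<dots>((y\<^sub>0 y\<^sub>0) y\<^sub>1) \<dots>) y\<^sub>n\<close> with \<open>y\<^sub>0 = x\<^sup>2 + e\<^sub>0 \<otimes> x\<close> and \<open>y\<^sub>i = e\<^sub>i \<otimes> x\<close> does not vanish.
\<close>

section \<open>Arithmetic of nonassociative polynomials\<close>

text \<open>A multilinear polynomial contains no square on which operators could act. The obstacle
  is met by trilinear stand-ins: \<open>pform\<close> and \<open>qform\<close> obey, modulo the
  identities, the same skew symmetry and the same rule for left multiplication as
  \<open>3 w R R\<close> and \<open>3 w L R\<close>, with a variable \<open>i\<close> in the place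
  of \<open>w\<close>. A monomial is then rebuilt as
  \<open>3 m = sum over i of (\<alpha>_i P_i + \<beta>_i Q_i)\<close>, where \<open>P_i\<close> and
  \<open>Q_i\<close> are the words grown from these forms. Characteristic 0 is used to divide by 3
  and to replace the defining identities by multilinear ones, which alone pass between a
  superalgebra and its envelope.

  The count behind \<open>n + 2\<close>: one letter is spent on the place of the square, and
  \<open>n + 1\<close> skew letters taking \<open>n\<close> values must repeat. A generator may
  however occupy the place of the square and a skew place at once, which is why \<open>y_0\<close>
  mixes an even and an odd summand.

  The same count settles the spectrum. A free superalgebra on even generators is an ordinary
  finitely generated algebra, hence nilpotent, while one odd generator keeps left-normed words of
  every degree alive. So no pair \<open>(r, 0)\<close> generates, and all other pairs lie above
  \<open>(0, 1)\<close>.\<close>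

text \<open>Sums over a common finite superset of the keys make additivity visible, since
  \<open>f + g\<close> may have fewer keys than \<open>f\<close> and \<open>g\<close>
  together.\<close>

lemma nmult_eq_sum:
  assumes "finite U" "finite V" "Poly_Mapping.keys f \<subseteq> U" "Poly_Mapping.keys g \<subseteq> V"
  shows "nmult f g = (\<Sum>u\<in>U. \<Sum>v\<in>V.
    Poly_Mapping.single (Mul u v) (Poly_Mapping.lookup f u * Poly_Mapping.lookup g v))"
proof -
  have "nmult f g = (\<Sum>u\<in>U. \<Sum>v\<in>Poly_Mapping.keys g.
    Poly_Mapping.single (Mul u v) (Poly_Mapping.lookup f u * Poly_Mapping.lookup g v))"
    unfolding nmult_def using assms(1,3)
    by (intro sum.mono_neutral_left) (auto simp: in_keys_iff)
  also have "\<dots> = (\<Sum>u\<in>U. \<Sum>v\<in>V.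
    Poly_Mapping.single (Mul u v) (Poly_Mapping.lookup f u * Poly_Mapping.lookup g v))"
    using assms(2,4)
    by (intro sum.cong refl sum.mono_neutral_left) (auto simp: in_keys_iff)
  finally show ?thesis .
qed

lemma nmult_add_left: "nmult (f + g) h = nmult f h + nmult g h"
proof -
  let ?U = "Poly_Mapping.keys f \<union> Poly_Mapping.keys g" and ?V = "Poly_Mapping.keys h"
  have "Poly_Mapping.keys (f + g) \<subseteq> ?U" by (rule Poly_Mapping.keys_add)
  then have "nmult (f + g) h = (\<Sum>u\<in>?U. \<Sum>v\<in>?V. Poly_Mapping.single (Mul u v)
      (Poly_Mapping.lookup (f + g) u * Poly_Mapping.lookup h v))"
    by (intro nmult_eq_sum) auto
  also have "\<dots> = nmult f h + nmult g h"
    by (subst (1 2) nmult_eq_sum[of ?U ?V])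
       (auto simp: lookup_add distrib_right single_add sum.distrib)
  finally show ?thesis .
qed

lemma nmult_add_right: "nmult h (f + g) = nmult h f + nmult h g"
proof -
  let ?U = "Poly_Mapping.keys f \<union> Poly_Mapping.keys g" and ?V = "Poly_Mapping.keys h"
  have "Poly_Mapping.keys (f + g) \<subseteq> ?U" by (rule Poly_Mapping.keys_add)
  then have "nmult h (f + g) = (\<Sum>v\<in>?V. \<Sum>u\<in>?U. Poly_Mapping.single (Mul v u)
      (Poly_Mapping.lookup h v * Poly_Mapping.lookup (f + g) u))"
    by (intro nmult_eq_sum) auto
  also have "\<dots> = nmult h f + nmult h g"
    by (subst (1 2) nmult_eq_sum[of ?V ?U])
       (auto simp: lookup_add distrib_left single_add sum.distrib)
  finally show ?thesis .
qed

lemma nmult_zero [simp]: "nmult 0 f = 0" "nmult f 0 = 0"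
  by (simp_all add: nmult_def)

lemma nmult_minus_left: "nmult (- f) g = - nmult f g"
  using nmult_add_left[of f "- f" g] by (simp add: eq_neg_iff_add_eq_0 add.commute)

lemma nmult_minus_right: "nmult f (- g) = - nmult f g"
  using nmult_add_right[of f g "- g"] by (simp add: eq_neg_iff_add_eq_0 add.commute)

lemma nmult_diff_left: "nmult (f - g) h = nmult f h - nmult g h"
  using nmult_add_left[of f "- g" h] by (simp add: nmult_minus_left)

lemma nmult_diff_right: "nmult h (f - g) = nmult h f - nmult h g"
  using nmult_add_right[of h f "- g"] by (simp add: nmult_minus_right)

lemmas nmult_distribs = nmult_add_left nmult_add_right nmult_minus_left nmult_minus_right
  nmult_diff_left nmult_diff_right

lemma nmult_single [simp]:
  "nmult (Poly_Mapping.single u c) (Poly_Mapping.single v d) = Poly_Mapping.single (Mul u v) (c * d)"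
  by (subst nmult_eq_sum[of "{u}" "{v}"]) auto

lemma lookup_nsmult [simp]: "Poly_Mapping.lookup (nsmult c f) m = c * Poly_Mapping.lookup f m"
  by (simp add: nsmult_def Poly_Mapping.map.rep_eq when_def)

lemma nsmult_add_right: "nsmult c (f + g) = nsmult c f + nsmult c g"
  by (intro poly_mapping_eqI) (simp add: lookup_add distrib_left)

lemma nsmult_add_left: "nsmult (c + d) f = nsmult c f + nsmult d f"
  by (intro poly_mapping_eqI) (simp add: lookup_add distrib_right)

lemma nsmult_nsmult [simp]: "nsmult c (nsmult d f) = nsmult (c * d) f"
  by (intro poly_mapping_eqI) simp

lemma nsmult_simps [simp]: "nsmult 1 f = f" "nsmult 0 f = 0" "nsmult c 0 = 0" "nsmult (- 1) f = - f"
  by (intro poly_mapping_eqI; simp)+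

lemma nsmult_diff_right: "nsmult c (f - g) = nsmult c f - nsmult c g"
  by (intro poly_mapping_eqI) (simp add: lookup_minus right_diff_distrib)

lemma nsmult_sum: "nsmult c (sum f S) = (\<Sum>x\<in>S. nsmult c (f x))"
  by (induction S rule: infinite_finite_induct) (auto simp: nsmult_add_right)

lemma nsmult_single [simp]: "nsmult c (Poly_Mapping.single m d) = Poly_Mapping.single m (c * d)"
  by (intro poly_mapping_eqI) (simp add: lookup_single when_def)

lemma npoly_eq_sum_single:
  fixes f :: "'a::field npoly"
  shows "f = (\<Sum>m\<in>Poly_Mapping.keys f. Poly_Mapping.single m (Poly_Mapping.lookup f m))"
  by (intro poly_mapping_eqI)
     (auto simp: lookup_sum lookup_single when_def in_keys_iff sum.delta[OF finite_keys])

lemma npoly_induct [case_names single add]: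
  fixes f :: "'a::field npoly"
  assumes "\<And>m c. P (Poly_Mapping.single m c)"
    and "\<And>f g. P f \<Longrightarrow> P g \<Longrightarrow> P (f + g)"
  shows "P f"
proof -
  have "P (\<Sum>m\<in>S. Poly_Mapping.single m (Poly_Mapping.lookup f m))" if "finite S" for S
    using that
  proof (induction S)
    case empty
    then show ?case using assms(1)[of undefined 0] by simp
  qed (simp add: assms)
  from this[OF finite_keys] show ?thesis by (subst npoly_eq_sum_single)
qed

lemma nmult_nsmult_left: "nmult (nsmult c f) g = nsmult c (nmult f g)"
proof (induction f rule: npoly_induct)
  case (single m d)
  show ?case
    by (induction g rule: npoly_induct) (simp_all add: nmult_add_right nsmult_add_right mult.assoc)
qed (simp add: nmult_add_left nsmult_add_right)

lemma nmult_nsmult_right: "nmult f (nsmult c g) = nsmult c (nmult f g)"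
proof (induction f rule: npoly_induct)
  case (single m d)
  show ?case
    by (induction g rule: npoly_induct)
       (simp_all add: nmult_add_right nsmult_add_right mult.left_commute)
qed (simp add: nmult_add_left nsmult_add_right)

lemma keys_nsmult_subset: "Poly_Mapping.keys (nsmult c f) \<subseteq> Poly_Mapping.keys f"
  by (auto simp: in_keys_iff)

lemma keys_nmult_subset:
  "Poly_Mapping.keys (nmult f g) \<subseteq> (\<lambda>(u, v). Mul u v) ` (Poly_Mapping.keys f \<times> Poly_Mapping.keys g)"
proof
  fix m assume m: "m \<in> Poly_Mapping.keys (nmult f g)"
  show "m \<in> (\<lambda>(u, v). Mul u v) ` (Poly_Mapping.keys f \<times> Poly_Mapping.keys g)"
  proof (rule ccontr)
    assume "m \<notin> (\<lambda>(u, v). Mul u v) ` (Poly_Mapping.keys f \<times> Poly_Mapping.keys g)"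
    then have "Poly_Mapping.lookup (nmult f g) m = 0"
      unfolding nmult_def lookup_sum by (intro sum.neutral ballI) (auto simp: lookup_single when_def)
    with m show False by (simp add: in_keys_iff)
  qed
qed

definition nmon :: "nmonom \<Rightarrow> 'a::field npoly" where
  "nmon m = Poly_Mapping.single m 1"

lemma nmon_Var [simp]: "nmon (Var x) = nvar x"
  by (simp add: nmon_def nvar_def)

lemma nmon_Mul [simp]: "nmon (Mul u v) = nmult (nmon u) (nmon v)"
  by (simp add: nmon_def)

lemma npoly_eq_sum_nmon:
  "f = (\<Sum>m\<in>Poly_Mapping.keys f. nsmult (Poly_Mapping.lookup f m) (nmon m))"
  using npoly_eq_sum_single[of f] by (simp add: nmon_def)

section \<open>Evaluation homomorphisms\<close>

lemma cring_base_ring: "cring (base_ring :: 'a::field ring)"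
proof (rule cringI)
  show "abelian_group (base_ring :: 'a ring)"
    by (rule abelian_groupI) (auto simp: base_ring_def add.assoc add.commute intro: exI[of _ "- _"] ab_left_minus)
  show "comm_monoid (base_ring :: 'a ring)"
    by (rule comm_monoidI) (auto simp: base_ring_def mult.assoc mult.commute)
qed (auto simp: base_ring_def distrib_right)

lemma base_ring_simps [simp]:
  "carrier (base_ring :: 'a::field ring) = UNIV" "x \<oplus>\<^bsub>base_ring\<^esub> y = (x + y :: 'a)"
  "x \<otimes>\<^bsub>base_ring\<^esub> y = (x * y :: 'a)" "\<one>\<^bsub>base_ring\<^esub> = (1 :: 'a)" "\<zero>\<^bsub>base_ring\<^esub> = (0 :: 'a)"
  by (auto simp: base_ring_def)

lemma base_ring_minus [simp]: "\<ominus>\<^bsub>base_ring\<^esub> x = (- x :: 'a::field)"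
proof -
  interpret R: cring "base_ring :: 'a ring" by (rule cring_base_ring)
  show ?thesis by (rule R.minus_equality) auto
qed

text \<open>Additive inverses come from the scalar \<open>- 1\<close>, so no inverse axiom has to be
  verified for concrete algebras.\<close>

lemma nonassoc_algebraI:
  fixes A :: "('a::field, 'v, 'm) module_scheme" (structure)
  assumes "\<And>x y. x \<in> carrier A \<Longrightarrow> y \<in> carrier A \<Longrightarrow> x \<oplus> y \<in> carrier A"
    and "\<zero> \<in> carrier A"
    and "\<And>x y z. x \<in> carrier A \<Longrightarrow> y \<in> carrier A \<Longrightarrow> z \<in> carrier A \<Longrightarrow> (x \<oplus> y) \<oplus> z = x \<oplus> (y \<oplus> z)"
    and "\<And>x y. x \<in> carrier A \<Longrightarrow> y \<in> carrier A \<Longrightarrow> x \<oplus> y = y \<oplus> x"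
    and "\<And>x. x \<in> carrier A \<Longrightarrow> \<zero> \<oplus> x = x"
    and "\<And>c x. x \<in> carrier A \<Longrightarrow> c \<odot> x \<in> carrier A"
    and "\<And>x. x \<in> carrier A \<Longrightarrow> 0 \<odot> x = \<zero>"
    and "\<And>c d x. x \<in> carrier A \<Longrightarrow> (c + d) \<odot> x = c \<odot> x \<oplus> d \<odot> x"
    and "\<And>c x y. x \<in> carrier A \<Longrightarrow> y \<in> carrier A \<Longrightarrow> c \<odot> (x \<oplus> y) = c \<odot> x \<oplus> c \<odot> y"
    and "\<And>c d x. x \<in> carrier A \<Longrightarrow> (c * d) \<odot> x = c \<odot> (d \<odot> x)"
    and "\<And>x. x \<in> carrier A \<Longrightarrow> 1 \<odot> x = x"
    and "\<And>x y. x \<in> carrier A \<Longrightarrow> y \<in> carrier A \<Longrightarrow> x \<otimes> y \<in> carrier A"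
    and "\<And>x y z. x \<in> carrier A \<Longrightarrow> y \<in> carrier A \<Longrightarrow> z \<in> carrier A \<Longrightarrow>
        (x \<oplus> y) \<otimes> z = x \<otimes> z \<oplus> y \<otimes> z"
    and "\<And>x y z. x \<in> carrier A \<Longrightarrow> y \<in> carrier A \<Longrightarrow> z \<in> carrier A \<Longrightarrow>
        x \<otimes> (y \<oplus> z) = x \<otimes> y \<oplus> x \<otimes> z"
    and "\<And>c x y. x \<in> carrier A \<Longrightarrow> y \<in> carrier A \<Longrightarrow> (c \<odot> x) \<otimes> y = c \<odot> (x \<otimes> y)"
    and "\<And>c x y. x \<in> carrier A \<Longrightarrow> y \<in> carrier A \<Longrightarrow> x \<otimes> (c \<odot> y) = c \<odot> (x \<otimes> y)"
  shows "nonassoc_algebra A"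
proof -
  have inv: "\<exists>y\<in>carrier A. y \<oplus> x = \<zero>" if x: "x \<in> carrier A" for x
  proof
    have "(- 1) \<odot> x \<oplus> x = (- 1 + 1) \<odot> x" using x assms(8)[of x "- 1" 1] assms(11) by simp
    then show "(- 1) \<odot> x \<oplus> x = \<zero>" using x assms(7) by simp
  qed (use x assms(6) in simp)
  have "abelian_group A"
    by (rule abelian_groupI) (use assms inv in auto)
  then have "module base_ring A"
    by (intro moduleI cring_base_ring) (use assms in auto)
  then show ?thesis
    unfolding nonassoc_algebra_def nonassoc_algebra_axioms_def using assms by auto
qed

lemma nonassoc_algebra_free_alg: "nonassoc_algebra (free_alg X :: ('a::field, 'a npoly) module)"
proof (rule nonassoc_algebraI)
  fix f g :: "'a npoly"
  assume "f \<in> carrier (free_alg X)" "g \<in> carrier (free_alg X)"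
  then show "f \<oplus>\<^bsub>free_alg X\<^esub> g \<in> carrier (free_alg X)" "f \<otimes>\<^bsub>free_alg X\<^esub> g \<in> carrier (free_alg X)"
    using keys_nmult_subset[of f g] Poly_Mapping.keys_add[of f g]
    by (fastforce simp: free_alg_def)+
next
  fix c and f :: "'a npoly"
  assume "f \<in> carrier (free_alg X)"
  then show "c \<odot>\<^bsub>free_alg X\<^esub> f \<in> carrier (free_alg X)"
    using keys_nsmult_subset[of c f] by (auto simp: free_alg_def)
qed (auto simp: free_alg_def add.assoc add.commute nsmult_add_left nsmult_add_right
      nmult_distribs nmult_nsmult_left nmult_nsmult_right)

definition alg_hom ::
  "('a::field, 'v, 'm) module_scheme \<Rightarrow> ('a, 'w, 'n) module_scheme \<Rightarrow> ('v \<Rightarrow> 'w) \<Rightarrow> bool" where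
  "alg_hom A B h \<longleftrightarrow> h ` carrier A \<subseteq> carrier B \<and>
     (\<forall>x\<in>carrier A. \<forall>y\<in>carrier A. h (x \<oplus>\<^bsub>A\<^esub> y) = h x \<oplus>\<^bsub>B\<^esub> h y \<and> h (x \<otimes>\<^bsub>A\<^esub> y) = h x \<otimes>\<^bsub>B\<^esub> h y) \<and>
     (\<forall>c. \<forall>x\<in>carrier A. h (c \<odot>\<^bsub>A\<^esub> x) = c \<odot>\<^bsub>B\<^esub> h x)"

context nonassoc_algebra
begin

lemma smult_zero_left [simp]: "x \<in> carrier A \<Longrightarrow> 0 \<odot> x = \<zero>"
  using smult_l_null[of x] by simp

lemma smult_zero_right [simp]: "c \<odot> \<zero> = \<zero>"
  using smult_r_null[of c] by simp

lemma smult_carrier [simp]: "x \<in> carrier A \<Longrightarrow> c \<odot> x \<in> carrier A"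
  by (rule smult_closed) auto

lemma smult_add_left: "x \<in> carrier A \<Longrightarrow> (c + d) \<odot> x = c \<odot> x \<oplus> d \<odot> x"
  using smult_l_distr[of c d x] by simp

lemma smult_add_right:
  "x \<in> carrier A \<Longrightarrow> y \<in> carrier A \<Longrightarrow> c \<odot> (x \<oplus> y) = c \<odot> x \<oplus> c \<odot> y"
  using smult_r_distr[of c x y] by simp

lemma smult_smult: "x \<in> carrier A \<Longrightarrow> c \<odot> (d \<odot> x) = (c * d) \<odot> x"
  using smult_assoc1[of c d x] by simp

lemma smult_one_left [simp]: "x \<in> carrier A \<Longrightarrow> 1 \<odot> x = x"
  using smult_one[of x] by simp

lemma smult_minus_one: "x \<in> carrier A \<Longrightarrow> (- 1) \<odot> x = \<ominus> x"
  using smult_l_minus[of 1 x] by simp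

lemma mult_zero_left [simp]: "x \<in> carrier A \<Longrightarrow> \<zero> \<otimes> x = \<zero>"
  using mult_smult_left[of \<zero> x 0] mult_closed by simp

lemma mult_zero_right [simp]: "x \<in> carrier A \<Longrightarrow> x \<otimes> \<zero> = \<zero>"
  using mult_smult_right[of x \<zero> 0] mult_closed by simp

lemma eval_monom_closed [simp]: "(\<And>x. a x \<in> carrier A) \<Longrightarrow> eval_monom A a m \<in> carrier A"
  by (induction m) (auto intro: mult_closed)

lemma eval_poly_eq_finsum:
  assumes "\<And>x. a x \<in> carrier A" "finite U" "Poly_Mapping.keys f \<subseteq> U"
  shows "eval_poly A a f = (\<Oplus>m\<in>U. Poly_Mapping.lookup f m \<odot> eval_monom A a m)"
  unfolding eval_poly_def using assms
  by (intro add.finprod_mono_neutral_cong_left) (auto simp: in_keys_iff)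

lemma eval_poly_closed [simp]:
  assumes "\<And>x. a x \<in> carrier A"
  shows "eval_poly A a f \<in> carrier A"
  unfolding eval_poly_def using assms by (intro finsum_closed) auto

lemma eval_poly_add:
  assumes "\<And>x. a x \<in> carrier A"
  shows "eval_poly A a (f + g) = eval_poly A a f \<oplus> eval_poly A a g"
proof -
  let ?U = "Poly_Mapping.keys f \<union> Poly_Mapping.keys g"
  have "Poly_Mapping.keys (f + g) \<subseteq> ?U" by (rule Poly_Mapping.keys_add)
  then have "eval_poly A a (f + g) = (\<Oplus>m\<in>?U. Poly_Mapping.lookup (f + g) m \<odot> eval_monom A a m)"
    using assms by (intro eval_poly_eq_finsum) auto
  also have "\<dots> = eval_poly A a f \<oplus> eval_poly A a g"
    using assms
    by (subst (1 2) eval_poly_eq_finsum[of _ ?U])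
       (auto simp: lookup_add smult_add_left finsum_addf intro!: finsum_addf)
  finally show ?thesis .
qed

lemma eval_poly_single [simp]:
  assumes "\<And>x. a x \<in> carrier A"
  shows "eval_poly A a (Poly_Mapping.single m c) = c \<odot> eval_monom A a m"
proof -
  have "eval_poly A a (Poly_Mapping.single m c) =
      (\<Oplus>m'\<in>{m}. Poly_Mapping.lookup (Poly_Mapping.single m c) m' \<odot> eval_monom A a m')"
    using assms by (intro eval_poly_eq_finsum) auto
  also have "\<dots> = c \<odot> eval_monom A a m"
    using assms by (subst finsum_insert) auto
  finally show ?thesis .
qed

lemma eval_poly_zero [simp]: "eval_poly A a 0 = \<zero>"
  by (simp add: eval_poly_def)

lemma eval_poly_nsmult:
  assumes "\<And>x. a x \<in> carrier A"
  shows "eval_poly A a (nsmult c f) = c \<odot> eval_poly A a f"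
  using assms by (induction f rule: npoly_induct)
    (simp_all add: smult_smult nsmult_add_right eval_poly_add smult_add_right)

lemma eval_poly_minus:
  assumes "\<And>x. a x \<in> carrier A"
  shows "eval_poly A a (- f) = \<ominus> eval_poly A a f"
  using eval_poly_nsmult[where a = a and c = "- 1" and f = f] assms by (simp add: smult_minus_one)

lemma eval_poly_nmult:
  assumes a: "\<And>x. a x \<in> carrier A"
  shows "eval_poly A a (nmult f g) = eval_poly A a f \<otimes> eval_poly A a g"
proof (induction f rule: npoly_induct)
  case (single m c)
  show ?case
  proof (induction g rule: npoly_induct)
    case (single n d)
    then show ?case using a
      by (simp add: mult_smult_left mult_smult_right smult_smult mult.commute mult_closed)
  next
    case (add g h)
    then show ?case using a by (simp add: nmult_add_right eval_poly_add mult_add_right)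
  qed
next
  case (add f h)
  then show ?case using a by (simp add: nmult_add_left eval_poly_add mult_add_left)
qed

lemma eval_poly_nvar [simp]:
  assumes "\<And>x. a x \<in> carrier A"
  shows "eval_poly A a (nvar x) = a x"
  using assms by (simp add: nvar_def)

lemma eval_poly_nmon [simp]:
  assumes "\<And>x. a x \<in> carrier A"
  shows "eval_poly A a (nmon m) = eval_monom A a m"
  using assms by (simp add: nmon_def)

lemma eval_poly_diff:
  assumes "\<And>x. a x \<in> carrier A"
  shows "eval_poly A a (f - g) = eval_poly A a f \<ominus> eval_poly A a g"
  using eval_poly_add[where a = a and f = f and g = "- g"] eval_poly_minus[where a = a] assms by (simp add: a_minus_def)

lemma alg_hom_eval:
  assumes "\<And>x. a x \<in> carrier A"
  shows "alg_hom (free_alg X) A (eval_poly A a)"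
  using assms by (auto simp: alg_hom_def free_alg_def eval_poly_add eval_poly_nmult eval_poly_nsmult)

lemma eval_poly_cong:
  assumes "\<And>m x. m \<in> Poly_Mapping.keys f \<Longrightarrow> x \<in> set (letters m) \<Longrightarrow> a x = b x"
    and a: "\<And>x. a x \<in> carrier A" and b: "\<And>x. b x \<in> carrier A"
  shows "eval_poly A a f = eval_poly A b f"
proof -
  have *: "eval_monom A a m = eval_monom A b m" if "\<And>x. x \<in> set (letters m) \<Longrightarrow> a x = b x" for m
    using that by (induction m) auto
  show ?thesis
    unfolding eval_poly_def using * assms by (intro finsum_cong') auto
qed

end

lemma alg_hom_zero:
  assumes "nonassoc_algebra A" "nonassoc_algebra B" "alg_hom A B h"
  shows "h \<zero>\<^bsub>A\<^esub> = \<zero>\<^bsub>B\<^esub>"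
proof -
  interpret A: nonassoc_algebra A by fact
  interpret B: nonassoc_algebra B by fact
  have "h (0 \<odot>\<^bsub>A\<^esub> \<zero>\<^bsub>A\<^esub>) = 0 \<odot>\<^bsub>B\<^esub> h \<zero>\<^bsub>A\<^esub>" "h \<zero>\<^bsub>A\<^esub> \<in> carrier B"
    using assms(3) A.zero_closed unfolding alg_hom_def by blast+
  then show ?thesis by simp
qed

lemma alg_hom_eval_poly:
  assumes "nonassoc_algebra A" "nonassoc_algebra B" "alg_hom A B h" and a: "\<And>x. a x \<in> carrier A"
  shows "h (eval_poly A a f) = eval_poly B (\<lambda>x. h (a x)) f"
proof -
  interpret A: nonassoc_algebra A by fact
  interpret B: nonassoc_algebra B by fact
  have b: "\<And>x. h (a x) \<in> carrier B" using a assms(3) by (auto simp: alg_hom_def)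
  have m: "h (eval_monom A a m) = eval_monom B (\<lambda>x. h (a x)) m" for m
    using assms(3) a by (induction m) (auto simp: alg_hom_def)
  show ?thesis
  proof (induction f rule: npoly_induct)
    case (single m c)
    have "h (c \<odot>\<^bsub>A\<^esub> eval_monom A a m) = c \<odot>\<^bsub>B\<^esub> h (eval_monom A a m)"
      using assms(3) a by (auto simp: alg_hom_def)
    then show ?case using a b m by simp
  next
    case (add f g)
    have "h (eval_poly A a f \<oplus>\<^bsub>A\<^esub> eval_poly A a g) = h (eval_poly A a f) \<oplus>\<^bsub>B\<^esub> h (eval_poly A a g)"
      using assms(3) a by (auto simp: alg_hom_def)
    then show ?case using a b add by (simp add: A.eval_poly_add B.eval_poly_add)
  qed
qed

lemma satisfies_image_iff:
  assumes A: "nonassoc_algebra A" and B: "nonassoc_algebra B" and h: "alg_hom A B h"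
    and carrier: "carrier B = h ` carrier A"
  shows "satisfies B f \<longleftrightarrow> (\<forall>a. (\<forall>x. a x \<in> carrier A) \<longrightarrow> h (eval_poly A a f) = \<zero>\<^bsub>B\<^esub>)"
proof (intro iffI allI impI)
  fix a :: "nat \<Rightarrow> _" assume L: "satisfies B f" and a: "\<forall>x. a x \<in> carrier A"
  then have "eval_poly B (\<lambda>x. h (a x)) f = \<zero>\<^bsub>B\<^esub>" by (simp add: satisfies_def carrier)
  then show "h (eval_poly A a f) = \<zero>\<^bsub>B\<^esub>" using alg_hom_eval_poly[OF A B h, of a f] a by simp
next
  assume R: "\<forall>a. (\<forall>x. a x \<in> carrier A) \<longrightarrow> h (eval_poly A a f) = \<zero>\<^bsub>B\<^esub>"
  show "satisfies B f" unfolding satisfies_def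
  proof (intro allI impI)
    fix b :: "nat \<Rightarrow> _" assume "\<forall>x. b x \<in> carrier B"
    then have "\<forall>x. \<exists>y. y \<in> carrier A \<and> b x = h y" by (auto simp: carrier)
    then obtain a where a: "\<And>x. a x \<in> carrier A" "b = (\<lambda>x. h (a x))" by metis
    then show "eval_poly B b f = \<zero>\<^bsub>B\<^esub>" using alg_hom_eval_poly[OF A B h, of a f] R by simp
  qed
qed

lemma nonassoc_algebra_image:
  assumes "nonassoc_algebra A" "alg_hom A B h" "carrier B = h ` carrier A" "\<zero>\<^bsub>B\<^esub> = h \<zero>\<^bsub>A\<^esub>"
  shows "nonassoc_algebra B"
proof -
  interpret A: nonassoc_algebra A by fact
  have add: "h x \<oplus>\<^bsub>B\<^esub> h y = h (x \<oplus>\<^bsub>A\<^esub> y)" and mult: "h x \<otimes>\<^bsub>B\<^esub> h y = h (x \<otimes>\<^bsub>A\<^esub> y)"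
    if "x \<in> carrier A" "y \<in> carrier A" for x y
    using that assms(2) by (auto simp: alg_hom_def)
  have smult: "c \<odot>\<^bsub>B\<^esub> h x = h (c \<odot>\<^bsub>A\<^esub> x)" if "x \<in> carrier A" for c x
    using that assms(2) by (auto simp: alg_hom_def)
  show ?thesis
    by (rule nonassoc_algebraI)
       (use A.a_assoc A.a_comm in \<open>auto simp: assms(3,4) add mult smult A.smult_smult A.smult_add_left
          A.smult_add_right A.mult_closed A.mult_add_left A.mult_add_right
          A.mult_smult_left A.mult_smult_right\<close>)
qed

lemma eval_poly_free_alg:
  fixes f :: "'a::field npoly"
  assumes f: "f \<in> carrier (free_alg X)" and a: "\<And>x. a x \<in> carrier (free_alg X)"
    and ax: "\<And>x. x \<in> X \<Longrightarrow> a x = nvar x"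
  shows "eval_poly (free_alg X) a f = f"
proof -
  interpret nonassoc_algebra "free_alg X :: ('a, 'a npoly) module" by (rule nonassoc_algebra_free_alg)
  have m: "eval_monom (free_alg X) a m = nmon m" if "set (letters m) \<subseteq> X" for m
    using that ax by (induction m) (auto simp: free_alg_def)
  have fs: "(\<Oplus>\<^bsub>free_alg X\<^esub>m\<in>S. F m) = (\<Sum>m\<in>S. F m)"
    if "finite S" "\<And>m. m \<in> S \<Longrightarrow> F m \<in> carrier (free_alg X)" for S and F :: "nmonom \<Rightarrow> 'a npoly"
    using that
  proof (induction S)
    case (insert m S)
    then show ?case by (subst finsum_insert) (auto simp: free_alg_def)
  qed (simp, simp add: free_alg_def)
  have keys: "set (letters m) \<subseteq> X" if "m \<in> Poly_Mapping.keys f" for m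
    using f that by (auto simp: free_alg_def)
  have "eval_poly (free_alg X) a f =
      (\<Oplus>\<^bsub>free_alg X\<^esub>m\<in>Poly_Mapping.keys f. nsmult (Poly_Mapping.lookup f m) (nmon m))"
    unfolding eval_poly_def using keys m a
    by (intro finsum_cong') (auto simp: free_alg_def nmon_def)
  also have "\<dots> = (\<Sum>m\<in>Poly_Mapping.keys f. nsmult (Poly_Mapping.lookup f m) (nmon m))"
    using keys by (intro fs) (auto simp: free_alg_def nmon_def split: if_splits)
  finally show ?thesis using npoly_eq_sum_nmon[of f] by simp
qed

section \<open>Quotients and relatively free algebras\<close>

context nonassoc_algebra
begin

lemma alg_ideal_subset: "alg_ideal I A \<Longrightarrow> I \<subseteq> carrier A"
  using submoduleE(1) by (auto simp: alg_ideal_def)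

lemma alg_ideal_abelian_subgroup: "alg_ideal I A \<Longrightarrow> abelian_subgroup I A"
  using submodule.axioms(1)[of I base_ring A] a_comm_group
  by (auto simp: alg_ideal_def intro: abelian_subgroupI2)

lemma alg_idealD:
  assumes "alg_ideal I A"
  shows "\<zero> \<in> I" "x \<in> I \<Longrightarrow> y \<in> I \<Longrightarrow> x \<oplus> y \<in> I" "x \<in> I \<Longrightarrow> c \<odot> x \<in> I" "x \<in> I \<Longrightarrow> \<ominus> x \<in> I"
    "x \<in> I \<Longrightarrow> y \<in> carrier A \<Longrightarrow> x \<otimes> y \<in> I" "x \<in> I \<Longrightarrow> y \<in> carrier A \<Longrightarrow> y \<otimes> x \<in> I"
proof -
  interpret I: abelian_subgroup I A using assms by (rule alg_ideal_abelian_subgroup)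
  show "\<zero> \<in> I" by (rule I.zero_closed)
qed (use assms submoduleE[of I] in \<open>auto simp: alg_ideal_def\<close>)

lemma alg_idealI:
  assumes "I \<subseteq> carrier A" "\<zero> \<in> I" "\<And>x y. x \<in> I \<Longrightarrow> y \<in> I \<Longrightarrow> x \<oplus> y \<in> I"
    "\<And>c x. x \<in> I \<Longrightarrow> c \<odot> x \<in> I"
    "\<And>x y. x \<in> I \<Longrightarrow> y \<in> carrier A \<Longrightarrow> x \<otimes> y \<in> I"
    "\<And>x y. x \<in> I \<Longrightarrow> y \<in> carrier A \<Longrightarrow> y \<otimes> x \<in> I"
  shows "alg_ideal I A"
  unfolding alg_ideal_def
proof
  have "\<ominus> x \<in> I" if "x \<in> I" for x
    using assms(1) assms(4)[OF that, of "- 1"] that by (auto simp: smult_minus_one)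
  then show "submodule I base_ring A"
    by (intro submoduleI) (use assms in auto)
qed (use assms in auto)

lemma coset_eq_iff:
  assumes "alg_ideal I A" "x \<in> carrier A" "y \<in> carrier A"
  shows "I +> x = I +> y \<longleftrightarrow> x \<ominus> y \<in> I"
proof -
  interpret I: abelian_subgroup I A using assms(1) by (rule alg_ideal_abelian_subgroup)
  have I: "I \<subseteq> carrier A" using assms(1) by (rule alg_ideal_subset)
  show ?thesis
  proof
    assume "I +> x = I +> y"
    then have "I +> (x \<oplus> \<ominus> y) = I" using assms I by (intro a_coset_add_inv2)
    then show "x \<ominus> y \<in> I"
      using a_coset_join1[OF _ _ I.a_subgroup, of "x \<ominus> y"] assms by (simp add: a_minus_def)
  next
    assume "x \<ominus> y \<in> I"
    then have "I +> (x \<oplus> \<ominus> y) = I"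
      using a_coset_join2[OF _ I.a_subgroup, of "x \<ominus> y"] assms by (simp add: a_minus_def)
    then show "I +> x = I +> y" using assms I by (intro a_coset_add_inv1)
  qed
qed

lemma coset_eq_ideal_iff:
  assumes "alg_ideal I A" "x \<in> carrier A"
  shows "I +> x = I \<longleftrightarrow> x \<in> I"
proof -
  have [simp]: "\<ominus> \<zero> = \<zero>" using r_neg[of \<zero>] by (simp add: l_zero)
  then show ?thesis
    using coset_eq_iff[OF assms, of \<zero>] assms alg_ideal_subset[OF assms(1)]
    by (simp add: a_minus_def r_zero)
qed

lemma coset_self: "alg_ideal I A \<Longrightarrow> x \<in> carrier A \<Longrightarrow> x \<in> I +> x"
  using abelian_subgroup.a_rcos_self[OF alg_ideal_abelian_subgroup] by auto

lemma coset_memD: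
  assumes "alg_ideal I A" "x \<in> carrier A" "y \<in> I +> x"
  shows "y \<in> carrier A" "I +> y = I +> x" "y \<ominus> x \<in> I"
proof -
  interpret I: abelian_subgroup I A using assms(1) by (rule alg_ideal_abelian_subgroup)
  show 1: "y \<in> carrier A"
    using a_r_coset_subset_G[OF alg_ideal_subset[OF assms(1)] assms(2)] assms(3) by auto
  show 2: "I +> y = I +> x"
    using a_repr_independence[OF assms(3,2) I.a_subgroup] by simp
  show "y \<ominus> x \<in> I" using coset_eq_iff[OF assms(1) 1 assms(2)] 2 by simp
qed

text \<open>\<open>rcoset_mult\<close> is a union over all representatives; its members coincide
  because \<open>I\<close> is a two-sided ideal.\<close>

lemma rcoset_mult_coset:
  assumes "alg_ideal I A" "x \<in> carrier A" "y \<in> carrier A"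
  shows "rcoset_mult A I (I +> x) (I +> y) = I +> (x \<otimes> y)"
proof -
  have "I +> (a \<otimes> b) = I +> (x \<otimes> y)" if a: "a \<in> I +> x" and b: "b \<in> I +> y" for a b
  proof -
    note a = coset_memD[OF assms(1,2) a] and b = coset_memD[OF assms(1,3) b]
    have "a \<otimes> b = (x \<oplus> (a \<ominus> x)) \<otimes> b" "x \<otimes> b = x \<otimes> (y \<oplus> (b \<ominus> y))"
      using a b assms by (simp_all add: a_minus_def a_lcomm r_neg)
    then have "a \<otimes> b = x \<otimes> y \<oplus> (x \<otimes> (b \<ominus> y) \<oplus> (a \<ominus> x) \<otimes> b)"
      using a(1) b(1) assms by (simp add: mult_add_left mult_add_right mult_closed a_assoc)
    then have "a \<otimes> b \<ominus> x \<otimes> y = x \<otimes> (b \<ominus> y) \<oplus> (a \<ominus> x) \<otimes> b"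
      using a(1) b(1) assms mult_closed by (simp add: a_minus_def a_ac r_neg1 r_neg2)
    also have "\<dots> \<in> I"
      using a b assms by (intro alg_idealD[OF assms(1)]) auto
    finally show ?thesis using a b assms mult_closed by (subst coset_eq_iff) auto
  qed
  then show ?thesis
    using coset_self assms unfolding rcoset_mult_def by blast
qed

lemma quot_smult_coset:
  assumes "alg_ideal I A" "x \<in> carrier A"
  shows "quot_smult A I c (I +> x) = I +> (c \<odot> x)"
proof -
  have "I +> (c \<odot> a) = I +> (c \<odot> x)" if a: "a \<in> I +> x" for a
  proof -
    note a = coset_memD[OF assms a]
    have "c \<odot> a \<ominus> c \<odot> x = c \<odot> (a \<ominus> x)"
      using a assms smult_smult[of x c "- 1"] smult_smult[of x "- 1" c]
      by (simp add: a_minus_def smult_add_right flip: smult_minus_one)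
    also have "\<dots> \<in> I" using a alg_idealD[OF assms(1)] by auto
    finally show ?thesis using a assms by (subst coset_eq_iff) auto
  qed
  then show ?thesis using coset_self assms unfolding quot_smult_def by blast
qed

lemma set_add_coset:
  assumes "alg_ideal I A" "x \<in> carrier A" "y \<in> carrier A"
  shows "set_add A (I +> x) (I +> y) = I +> (x \<oplus> y)"
  using abelian_subgroup.a_rcos_sum[OF alg_ideal_abelian_subgroup] assms by auto

lemma alg_hom_quot_alg: "alg_ideal I A \<Longrightarrow> alg_hom A (quot_alg A I) (\<lambda>x. I +> x)"
  by (auto simp: alg_hom_def quot_alg_def rcoset_mult_coset quot_smult_coset set_add_coset
      A_RCOSETS_def' )

lemma carrier_quot_alg: "carrier (quot_alg A I) = (\<lambda>x. I +> x) ` carrier A"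
  by (auto simp: quot_alg_def A_RCOSETS_def')

lemma nonassoc_algebra_quot_alg: "alg_ideal I A \<Longrightarrow> nonassoc_algebra (quot_alg A I)"
  using nonassoc_algebra_image[OF nonassoc_algebra_axioms alg_hom_quot_alg] carrier_quot_alg
  by (simp add: quot_alg_def alg_ideal_subset)

lemma satisfies_quot_alg_iff:
  assumes "alg_ideal I A"
  shows "satisfies (quot_alg A I) f \<longleftrightarrow> (\<forall>a. (\<forall>x. a x \<in> carrier A) \<longrightarrow> eval_poly A a f \<in> I)"
proof -
  have "\<zero>\<^bsub>quot_alg A I\<^esub> = I" by (simp add: quot_alg_def)
  then show ?thesis
    using satisfies_image_iff[OF nonassoc_algebra_axioms nonassoc_algebra_quot_alg[OF assms]
        alg_hom_quot_alg[OF assms] carrier_quot_alg, of f] coset_eq_ideal_iff[OF assms]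
    by simp
qed

text \<open>Turns cosets into polynomials injectively, so that an injection of the polynomials into
  a type also carries the quotient into that type.\<close>

lemma inj_on_coset_representative:
  assumes "alg_ideal I A"
  shows "inj_on (\<lambda>X. SOME x. x \<in> X) ((\<lambda>x. I +> x) ` carrier A)"
proof (rule inj_onI)
  have *: "I +> (SOME x. x \<in> X) = X" if X: "X \<in> (\<lambda>x. I +> x) ` carrier A" for X
  proof -
    obtain y where y: "y \<in> carrier A" "X = I +> y" using X by auto
    have "(SOME x. x \<in> X) \<in> I +> y"
      unfolding y(2) using coset_self[OF assms y(1)] by (rule someI)
    from coset_memD(2)[OF assms y(1) this] y(2) show ?thesis by simp
  qed
  fix X Y assume "X \<in> (\<lambda>x. I +> x) ` carrier A" "Y \<in> (\<lambda>x. I +> x) ` carrier A"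
    "(SOME x. x \<in> X) = (SOME x. x \<in> Y)"
  then show "X = Y" using * by metis
qed

end

lemma alg_ideal_kernel:
  assumes "nonassoc_algebra A" "nonassoc_algebra B" "alg_hom A B h"
  shows "alg_ideal {x \<in> carrier A. h x = \<zero>\<^bsub>B\<^esub>} A"
proof -
  interpret A: nonassoc_algebra A by fact
  interpret B: nonassoc_algebra B by fact
  have "h x \<in> carrier B" if "x \<in> carrier A" for x using that assms(3) by (auto simp: alg_hom_def)
  then show ?thesis
    using assms(3) alg_hom_zero[OF assms]
    by (intro A.alg_idealI) (auto simp: alg_hom_def A.mult_closed)
qed

lemma eval_poly_substitute:
  fixes A :: "('a::field, 'v, 'm) module_scheme"
  assumes "nonassoc_algebra A" "\<And>x. b x \<in> carrier A" "\<And>x. a x \<in> carrier (free_alg X)"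
  shows "eval_poly A b (eval_poly (free_alg X) a f) = eval_poly A (\<lambda>x. eval_poly A b (a x)) f"
  using alg_hom_eval_poly[OF nonassoc_algebra_free_alg assms(1)
      nonassoc_algebra.alg_hom_eval[OF assms(1), of b X]] assms by simp

text \<open>\<open>variety\<close> is a class over the plain record type of algebras. This predicate
  also applies to record extensions, so that superalgebras can be fed to the lemmas on algebras of
  the variety.\<close>

definition models :: "('a::field, 'v, 'm) module_scheme \<Rightarrow> 'a npoly set \<Rightarrow> bool" where
  "models A E \<longleftrightarrow> nonassoc_algebra A \<and> (\<forall>f\<in>E. satisfies A f)"

lemma variety_eq_models: "variety E = {A. models A E}"
  by (simp add: variety_def models_def)

text \<open>Substituting polynomials into an identity of \<open>E\<close> and evaluating at
  \<open>b\<close> gives a value of that identity in \<open>A\<close>, hence zero. For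
  \<open>X = {..<n}\<close> the kernel is therefore one of the ideals intersected in
  \<open>rel_ideal\<close>, which makes the free algebra universal for algebras of any carrier
  type.\<close>

lemma kernel_in_rel_family:
  fixes A :: "('a::field, 'v, 'm) module_scheme" and X :: "nat set"
  assumes "models A E" and b: "\<And>x. b x \<in> carrier A"
  defines "K \<equiv> {f \<in> carrier (free_alg X). eval_poly A b f = \<zero>\<^bsub>A\<^esub>}"
  shows "alg_ideal K (free_alg X)" "quot_alg (free_alg X) K \<in> variety E"
proof -
  have A: "nonassoc_algebra A" using assms(1) by (simp add: models_def)
  interpret F: nonassoc_algebra "free_alg X :: ('a, 'a npoly) module"
    by (rule nonassoc_algebra_free_alg)
  interpret A: nonassoc_algebra A by fact
  show K: "alg_ideal K (free_alg X)"
    unfolding K_def using F.nonassoc_algebra_axioms A A.alg_hom_eval[OF b]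
    by (rule alg_ideal_kernel)
  have "satisfies (quot_alg (free_alg X) K) f" if "f \<in> E" for f
    unfolding F.satisfies_quot_alg_iff[OF K]
  proof (intro allI impI)
    fix a :: "nat \<Rightarrow> 'a npoly" assume a: "\<forall>x. a x \<in> carrier (free_alg X)"
    have "eval_poly A b (eval_poly (free_alg X) a f) = eval_poly A (\<lambda>x. eval_poly A b (a x)) f"
      using a by (intro eval_poly_substitute A b) auto
    also have "\<dots> = \<zero>\<^bsub>A\<^esub>" using assms(1) that b by (auto simp: models_def satisfies_def)
    finally show "eval_poly (free_alg X) a f \<in> K" using a by (auto simp: K_def)
  qed
  then show "quot_alg (free_alg X) K \<in> variety E"
    using F.nonassoc_algebra_quot_alg[OF K] by (simp add: variety_def)
qed

lemma rel_ideal_evalD: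
  assumes "models A E" "\<And>x. b x \<in> carrier A" "f \<in> rel_ideal E n"
  shows "eval_poly A b f = \<zero>\<^bsub>A\<^esub>"
proof -
  have "rel_ideal E n \<subseteq> {f \<in> carrier (free_alg {..<n}). eval_poly A b f = \<zero>\<^bsub>A\<^esub>}"
    unfolding rel_ideal_def
    by (intro Inter_lower CollectI conjI kernel_in_rel_family[where A = A and E = E] assms)
  with assms(3) show ?thesis by auto
qed

text \<open>Shows, through the kernel lemma above, that the family intersected in
  \<open>rel_ideal\<close> is nonempty; an empty intersection would be the whole type instead of an
  ideal of \<open>free_alg\<close>.\<close>

lemma models_trivial: "\<exists>A :: ('a::field, unit) module. models A E"
proof
  let ?A = "\<lparr>carrier = UNIV, mult = \<lambda>_ _. (), one = (), zero = (), add = \<lambda>_ _. (),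
    smult = \<lambda>_ _. ()\<rparr> :: ('a, unit) module"
  have "nonassoc_algebra ?A" by (rule nonassoc_algebraI) auto
  then show "models ?A E" by (auto simp: models_def satisfies_def)
qed

lemma alg_ideal_rel_ideal: "alg_ideal (rel_ideal E n) (free_alg {..<n})" for E :: "'a::field npoly set"
proof -
  interpret F: nonassoc_algebra "free_alg {..<n} :: ('a, 'a npoly) module"
    by (rule nonassoc_algebra_free_alg)
  obtain A :: "('a, unit) module" where A: "models A E" using models_trivial by blast
  then have "\<zero>\<^bsub>A\<^esub> \<in> carrier A" unfolding models_def nonassoc_algebra_def module_def
    by (meson abelian_group.axioms(1) abelian_monoid.zero_closed)
  then have "rel_ideal E n \<subseteq> {f \<in> carrier (free_alg {..<n}). eval_poly A (\<lambda>_. \<zero>\<^bsub>A\<^esub>) f = \<zero>\<^bsub>A\<^esub>}"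
    unfolding rel_ideal_def
    by (intro Inter_lower CollectI conjI kernel_in_rel_family[where A = A and E = E] A)
  then show ?thesis
    by (intro F.alg_idealI) (auto simp: rel_ideal_def intro: F.alg_idealD)
qed

lemma models_var_free_alg: "models (var_free_alg E n) E" for E :: "'a::field npoly set"
proof -
  interpret F: nonassoc_algebra "free_alg {..<n} :: ('a, 'a npoly) module"
    by (rule nonassoc_algebra_free_alg)
  have "eval_poly (free_alg {..<n}) a f \<in> I"
    if "f \<in> E" "\<forall>x. a x \<in> carrier (free_alg {..<n})"
      "alg_ideal I (free_alg {..<n})" "quot_alg (free_alg {..<n}) I \<in> variety E" for f a I
    using that F.satisfies_quot_alg_iff[of I f] by (auto simp: variety_def)
  then show ?thesis
    unfolding models_def var_free_alg_def F.satisfies_quot_alg_iff[OF alg_ideal_rel_ideal]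
    using F.nonassoc_algebra_quot_alg[OF alg_ideal_rel_ideal] by (auto simp: rel_ideal_def)
qed

text \<open>Assignments are total functions, so indices from \<open>n\<close> on receive the coset
  of 0.\<close>

definition var_gen :: "'a::field npoly set \<Rightarrow> nat \<Rightarrow> nat \<Rightarrow> 'a npoly set" where
  "var_gen E n x = rel_ideal E n +>\<^bsub>free_alg {..<n}\<^esub> (if x < n then nvar x else 0)"

lemma var_gen_closed: "var_gen E n x \<in> carrier (var_free_alg E n)" for E :: "'a::field npoly set"
proof -
  interpret F: nonassoc_algebra "free_alg {..<n} :: ('a, 'a npoly) module"
    by (rule nonassoc_algebra_free_alg)
  show ?thesis
    unfolding var_free_alg_def F.carrier_quot_alg var_gen_def
    by (intro imageI) (auto simp: free_alg_def nvar_def)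
qed

lemma var_free_alg_generated:
  fixes E :: "'a::field npoly set"
  assumes "y \<in> carrier (var_free_alg E n)"
  shows "\<exists>g\<in>carrier (free_alg {..<n}). y = eval_poly (var_free_alg E n) (var_gen E n) g"
proof -
  interpret F: nonassoc_algebra "free_alg {..<n} :: ('a, 'a npoly) module"
    by (rule nonassoc_algebra_free_alg)
  obtain g where g: "g \<in> carrier (free_alg {..<n})" "y = rel_ideal E n +>\<^bsub>free_alg {..<n}\<^esub> g"
    using assms by (auto simp: var_free_alg_def F.carrier_quot_alg)
  let ?a = "\<lambda>x. if x < n then nvar x else 0 :: 'a npoly"
  have a: "?a x \<in> carrier (free_alg {..<n})" for x by (auto simp: free_alg_def nvar_def)
  have "y = rel_ideal E n +>\<^bsub>free_alg {..<n}\<^esub> eval_poly (free_alg {..<n}) ?a g"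
    using g a by (subst eval_poly_free_alg) auto
  also have "\<dots> = eval_poly (var_free_alg E n) (var_gen E n) g"
    using alg_hom_eval_poly[OF F.nonassoc_algebra_axioms
        F.nonassoc_algebra_quot_alg[OF alg_ideal_rel_ideal]
        F.alg_hom_quot_alg[OF alg_ideal_rel_ideal], of ?a E g] a
    by (simp add: var_free_alg_def var_gen_def [abs_def])
  finally show ?thesis using g by blast
qed

text \<open>The universal property: an identity of the free algebra of rank \<open>n\<close> holds
  in every algebra of the variety for arguments generated by \<open>n\<close> elements.\<close>

lemma satisfies_var_free_algD:
  fixes E :: "'a::field npoly set" and A :: "('a, 'v, 'm) module_scheme"
  assumes "satisfies (var_free_alg E n) f" "models A E"
    and "\<And>x. b x \<in> carrier A" "\<And>x. a x \<in> carrier (free_alg {..<n})"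
  shows "eval_poly A (\<lambda>x. eval_poly A b (a x)) f = \<zero>\<^bsub>A\<^esub>"
proof -
  interpret F: nonassoc_algebra "free_alg {..<n} :: ('a, 'a npoly) module"
    by (rule nonassoc_algebra_free_alg)
  have "eval_poly (free_alg {..<n}) a f \<in> rel_ideal E n"
    using assms(1,4) by (auto simp: var_free_alg_def F.satisfies_quot_alg_iff[OF alg_ideal_rel_ideal])
  with rel_ideal_evalD[OF assms(2,3)] show ?thesis
    using assms by (subst eval_poly_substitute[symmetric]) (auto simp: models_def)
qed

lemma satisfies_var_free_algI:
  fixes E :: "'a::field npoly set"
  assumes "\<And>a. (\<And>x. a x \<in> carrier (free_alg {..<n})) \<Longrightarrow>
    eval_poly (var_free_alg E n) (\<lambda>x. eval_poly (var_free_alg E n) (var_gen E n) (a x)) f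
      = \<zero>\<^bsub>var_free_alg E n\<^esub>"
  shows "satisfies (var_free_alg E n) f"
  unfolding satisfies_def
proof (intro allI impI)
  fix c :: "nat \<Rightarrow> _" assume "\<forall>x. c x \<in> carrier (var_free_alg E n)"
  then have "\<forall>x. \<exists>g. g \<in> carrier (free_alg {..<n}) \<and>
      c x = eval_poly (var_free_alg E n) (var_gen E n) g"
    using var_free_alg_generated by blast
  then obtain a where "\<And>x. a x \<in> carrier (free_alg {..<n})"
    "\<And>x. c x = eval_poly (var_free_alg E n) (var_gen E n) (a x)" by metis
  then show "eval_poly (var_free_alg E n) c f = \<zero>\<^bsub>var_free_alg E n\<^esub>"
    using assms[of a] by (simp add: fun_eq_iff[symmetric] del: fun_eq_iff) (metis ext)
qed

lemma satisfies_var_free_alg_mono: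
  assumes "satisfies (var_free_alg E k) f" "n \<le> k"
  shows "satisfies (var_free_alg E n) f"
  using assms models_var_free_alg var_gen_closed
  by (intro satisfies_var_free_algI satisfies_var_free_algD[OF assms(1)]) (force simp: free_alg_def)+

text \<open>Free algebras live on sets of polynomials, while the classes compared in the end consist
  of algebras on \<open>'v\<close>; this is the copy of an algebra along an injection.\<close>

definition alg_transfer ::
  "('v \<Rightarrow> 'w) \<Rightarrow> ('a::field, 'v, 'm) module_scheme \<Rightarrow> ('a, 'w) module" where
  "alg_transfer j A = (let g = inv_into (carrier A) j in
     \<lparr>carrier = j ` carrier A, mult = \<lambda>x y. j (g x \<otimes>\<^bsub>A\<^esub> g y), one = j \<one>\<^bsub>A\<^esub>, zero = j \<zero>\<^bsub>A\<^esub>,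
      add = \<lambda>x y. j (g x \<oplus>\<^bsub>A\<^esub> g y), smult = \<lambda>c x. j (c \<odot>\<^bsub>A\<^esub> g x)\<rparr>)"

lemma alg_transfer:
  assumes "nonassoc_algebra A" "inj_on j (carrier A)"
  shows "nonassoc_algebra (alg_transfer j A)"
    and "satisfies (alg_transfer j A) f \<longleftrightarrow> satisfies A f"
proof -
  let ?B = "alg_transfer j A"
  interpret A: nonassoc_algebra A by fact
  have hom: "alg_hom A ?B j"
    using assms(2) by (auto simp: alg_hom_def alg_transfer_def Let_def)
  show B: "nonassoc_algebra ?B"
    using assms(1) hom by (rule nonassoc_algebra_image) (auto simp: alg_transfer_def Let_def)
  have "j y = \<zero>\<^bsub>?B\<^esub> \<longleftrightarrow> y = \<zero>\<^bsub>A\<^esub>" if "y \<in> carrier A" for y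
    using inj_on_eq_iff[OF assms(2) that A.zero_closed] by (simp add: alg_transfer_def Let_def)
  moreover have "carrier ?B = j ` carrier A" by (simp add: alg_transfer_def Let_def)
  ultimately show "satisfies ?B f \<longleftrightarrow> satisfies A f"
    using satisfies_image_iff[OF assms(1) B hom, of f] by (simp add: satisfies_def)
qed

section \<open>Normal forms of multilinear monomials\<close>

notation nmult (infixl \<open>\<cdot>\<close> 70)

lemma nassociator_distribs:
  "nassociator (f + f') g h = nassociator f g h + nassociator f' g h"
  "nassociator f (g + g') h = nassociator f g h + nassociator f g' h"
  "nassociator f g (h + h') = nassociator f g h + nassociator f g h'"
  by (simp_all add: nassociator_def nmult_distribs)

text \<open>The full linearization of \<open>(x x) x\<close>; at \<open>f = g = h\<close> it is six
  times the cube.\<close>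

definition nil_form :: "'a::field npoly \<Rightarrow> 'a npoly \<Rightarrow> 'a npoly \<Rightarrow> 'a npoly" where
  "nil_form f g h = f \<cdot> g \<cdot> h + f \<cdot> h \<cdot> g + g \<cdot> f \<cdot> h + g \<cdot> h \<cdot> f + h \<cdot> f \<cdot> g + h \<cdot> g \<cdot> f"

text \<open>
  Modulo the identities, substituting a square for one of three variables kills all values of \<open>pform\<close>
  and \<open>qform\<close> except those with the square \<open>w\<close> in the first place, where they become
  \<open>3 (w g) h\<close> and \<open>3 (g w) h\<close>.
\<close>

definition pform :: "'a::field npoly \<Rightarrow> 'a npoly \<Rightarrow> 'a npoly \<Rightarrow> 'a npoly" where
  "pform f g h = nassociator f g h + f \<cdot> g \<cdot> h - g \<cdot> h \<cdot> f - f \<cdot> h \<cdot> g + h \<cdot> g \<cdot> f"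

definition qform :: "'a::field npoly \<Rightarrow> 'a npoly \<Rightarrow> 'a npoly \<Rightarrow> 'a npoly" where
  "qform f g h = nassociator f g h - f \<cdot> g \<cdot> h - h \<cdot> f \<cdot> g - h \<cdot> f \<cdot> g - h \<cdot> g \<cdot> f + g \<cdot> f \<cdot> h"

text \<open>The trilinear form takes \<open>i\<close>, which stands for the square, and the first
  two operator letters; all further letters act by right multiplication. With
  \<open>F = pform\<close> this lifts \<open>3 w R...R\<close>, with \<open>F = qform\<close> it
  lifts \<open>3 w L R...R\<close>.\<close>

fun skew_word :: "('a::field npoly \<Rightarrow> 'a npoly \<Rightarrow> 'a npoly \<Rightarrow> 'a npoly) \<Rightarrow> nat \<Rightarrow> nat list \<Rightarrow> 'a npoly"
  where
  "skew_word F i (x # y # zs) = foldl (\<lambda>w z. w \<cdot> nvar z) (F (nvar i) (nvar x) (nvar y)) zs"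
| "skew_word F i _ = 0"

lemma skew_word_snoc:
  "2 \<le> length ys \<Longrightarrow> skew_word F i (ys @ [k]) = skew_word F i ys \<cdot> nvar k"
  by (cases "(F, i, ys)" rule: skew_word.cases) auto

text \<open>
  Replacing the variable \<open>i\<close> of \<open>m\<close> by a square \<open>w\<close> yields \<open>\<alpha> w R\<dots>R + \<beta> w L R\<dots>R\<close> with \<open>(\<alpha>, \<beta>) = wcoef i m\<close>,
  the operators belonging to the other variables in their order of occurrence.  \<open>left_coef d\<close> is the
  effect on the coefficients of a left multiplication applied to a word in \<open>d\<close> operators.
\<close>

definition left_coef :: "nat \<Rightarrow> 'a::field \<times> 'a \<Rightarrow> 'a \<times> 'a" where
  "left_coef d = (\<lambda>(p, q). if even d then (- q, p - q) else (p - q, p))"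

definition is_Var :: "nmonom \<Rightarrow> bool" where
  "is_Var m \<longleftrightarrow> (\<exists>x. m = Var x)"

text \<open>If the factor without \<open>i\<close> is not a variable, both factors lie in the square
  after the substitution and the metabelian law gives \<open>(0, 0)\<close>. The argument
  \<open>length (letters v) - 1\<close> counts the operators already applied to the square.\<close>

fun wcoef :: "nat \<Rightarrow> nmonom \<Rightarrow> 'a::field \<times> 'a" where
  "wcoef i (Var x) = (if x = i then (1, 0) else (0, 0))"
| "wcoef i (Mul u v) =
    (if i \<in> set (letters u) then if is_Var v then wcoef i u else (0, 0)
     else if i \<in> set (letters v) \<and> is_Var u then left_coef (length (letters v) - 1) (wcoef i v)
     else (0, 0))"

lemma letters_nonempty [simp]: "letters m \<noteq> []"
  by (induction m) auto

lemma is_Var_iff: "is_Var m \<longleftrightarrow> length (letters m) = 1"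
proof (cases m)
  case (Mul u v)
  obtain x xs y ys where "letters u = x # xs" "letters v = y # ys"
    using letters_nonempty by (meson neq_Nil_conv)
  then show ?thesis using Mul by (auto simp: is_Var_def)
qed (simp add: is_Var_def)

lemma not_is_VarE:
  assumes "\<not> is_Var m"
  obtains u v where "m = Mul u v"
  using assms by (cases m) (auto simp: is_Var_def)

lemma length_letters_two:
  assumes "length (letters m) = 2"
  shows "\<exists>a b. m = Mul (Var a) (Var b)"
proof (cases m)
  case (Mul u v)
  obtain x xs y ys where "letters u = x # xs" "letters v = y # ys"
    using letters_nonempty by (meson neq_Nil_conv)
  with assms Mul have "is_Var u" "is_Var v" by (auto simp: is_Var_iff)
  with Mul show ?thesis by (auto simp: is_Var_def)
qed (use assms in simp)

text \<open>Congruence modulo a set of polynomials, rather than equality in a quotient, reduces the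
  computations to polynomial identities. The instances are kernels of evaluations in algebras of the
  variety.\<close>

locale nalt_ideal =
  fixes I :: "'a::field_char_0 npoly set"
  assumes add: "f \<in> I \<Longrightarrow> g \<in> I \<Longrightarrow> f + g \<in> I"
    and smult: "f \<in> I \<Longrightarrow> nsmult c f \<in> I"
    and mult_right: "f \<in> I \<Longrightarrow> f \<cdot> g \<in> I"
    and mult_left: "f \<in> I \<Longrightarrow> g \<cdot> f \<in> I"
    and alt_left: "nassociator f f g \<in> I"
    and alt_right: "nassociator f g g \<in> I"
    and metab: "(f \<cdot> g) \<cdot> (h \<cdot> k) \<in> I"
    and nil: "f \<cdot> f \<cdot> f \<in> I"
begin

lemma zero: "0 \<in> I"
  using smult[OF nil, of 0] by simp

lemma uminus: "f \<in> I \<Longrightarrow> - f \<in> I"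
  using smult[of f "- 1"] by simp

lemma diff: "f \<in> I \<Longrightarrow> g \<in> I \<Longrightarrow> f - g \<in> I"
  using add[of f "- g"] uminus by simp

lemmas closure = add diff uminus mult_right mult_left alt_left alt_right

lemma half:
  assumes "f + f \<in> I"
  shows "f \<in> I"
proof -
  have "nsmult (1 / 2) (f + f) = f"
    by (intro poly_mapping_eqI) (simp add: lookup_add)
  then show ?thesis using smult[OF assms, of "1 / 2"] by simp
qed

lemma sum: "(\<And>x. x \<in> S \<Longrightarrow> f x \<in> I) \<Longrightarrow> sum f S \<in> I"
  by (induction S rule: infinite_finite_induct) (auto intro: zero add)

lemma al: "nassociator f g h + nassociator g f h \<in> I"
proof -
  have "nassociator f g h + nassociator g f h
      = nassociator (f + g) (f + g) h - nassociator f f h - nassociator g g h"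
    by (simp add: nassociator_distribs algebra_simps)
  also have "\<dots> \<in> I" by (intro closure)
  finally show ?thesis .
qed

lemma ar: "nassociator f g h + nassociator f h g \<in> I"
proof -
  have "nassociator f g h + nassociator f h g
      = nassociator f (g + h) (g + h) - nassociator f g g - nassociator f h h"
    by (simp add: nassociator_distribs algebra_simps)
  also have "\<dots> \<in> I" by (intro closure)
  finally show ?thesis .
qed

lemma nil3: "nil_form f g h \<in> I"
proof -
  have "nil_form f g h = (f + g + h) \<cdot> (f + g + h) \<cdot> (f + g + h)
      - (f + g) \<cdot> (f + g) \<cdot> (f + g) - (g + h) \<cdot> (g + h) \<cdot> (g + h) - (f + h) \<cdot> (f + h) \<cdot> (f + h)
      + f \<cdot> f \<cdot> f + g \<cdot> g \<cdot> g + h \<cdot> h \<cdot> h"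
    by (simp add: nil_form_def nmult_distribs algebra_simps)
  also have "\<dots> \<in> I" by (intro closure nil)
  finally show ?thesis .
qed

lemma nil2: "f \<cdot> f \<cdot> g + f \<cdot> g \<cdot> f + g \<cdot> f \<cdot> f \<in> I"
proof (rule half)
  have "(f \<cdot> f \<cdot> g + f \<cdot> g \<cdot> f + g \<cdot> f \<cdot> f) + (f \<cdot> f \<cdot> g + f \<cdot> g \<cdot> f + g \<cdot> f \<cdot> f) = nil_form f f g"
    by (simp add: nil_form_def algebra_simps)
  then show "(f \<cdot> f \<cdot> g + f \<cdot> g \<cdot> f + g \<cdot> f \<cdot> f) + (f \<cdot> f \<cdot> g + f \<cdot> g \<cdot> f + g \<cdot> f \<cdot> f) \<in> I"
    by (simp add: nil3)
qed

text \<open>Captures the one property of elements of the square on which the operator identities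
  rest: they annihilate all products modulo \<open>I\<close>. In this form it passes to sums, hence
  to \<open>pform\<close>, \<open>qform\<close> and the words built from them.\<close>

definition sq :: "'a npoly \<Rightarrow> bool" where
  "sq w \<longleftrightarrow> (\<forall>f g. w \<cdot> (f \<cdot> g) \<in> I \<and> (f \<cdot> g) \<cdot> w \<in> I)"

lemma sq_nmult [simp]: "sq (f \<cdot> g)"
  by (simp add: sq_def metab)

lemma sq_add: "sq v \<Longrightarrow> sq w \<Longrightarrow> sq (v + w)"
  by (simp add: sq_def nmult_distribs add)

lemma sq_diff: "sq v \<Longrightarrow> sq w \<Longrightarrow> sq (v - w)"
  by (simp add: sq_def nmult_distribs diff)

lemma sq_pform [simp]: "sq (pform f g h)"
  unfolding pform_def nassociator_def by (intro sq_add sq_diff sq_nmult)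

lemma sq_qform [simp]: "sq (qform f g h)"
  unfolding qform_def nassociator_def by (intro sq_add sq_diff sq_nmult)

lemma sqD: "sq w \<Longrightarrow> w \<cdot> (f \<cdot> g) \<in> I" "sq w \<Longrightarrow> (f \<cdot> g) \<cdot> w \<in> I"
  by (auto simp: sq_def)

section \<open>Operator identities on the square\<close>

lemma rr0:
  assumes "sq w"
  shows "w \<cdot> x \<cdot> x \<in> I"
proof -
  have "w \<cdot> x \<cdot> x = nassociator w x x + w \<cdot> (x \<cdot> x)" by (simp add: nassociator_def)
  also have "\<dots> \<in> I" by (intro closure sqD assms)
  finally show ?thesis .
qed

lemma rr:
  assumes "sq w"
  shows "w \<cdot> x \<cdot> y + w \<cdot> y \<cdot> x \<in> I"
proof -
  have "w \<cdot> x \<cdot> y + w \<cdot> y \<cdot> x = w \<cdot> (x + y) \<cdot> (x + y) - w \<cdot> x \<cdot> x - w \<cdot> y \<cdot> y"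
    by (simp add: nmult_distribs algebra_simps)
  also have "\<dots> \<in> I" by (intro closure rr0 assms)
  finally show ?thesis .
qed

text \<open>Linearized alternativity gives \<open>(w, y, x) = - (x, y, w)\<close> modulo
  \<open>I\<close>; in each of the two associators the term containing the product of the two
  letters vanishes.\<close>

lemma ll:
  assumes "sq w"
  shows "x \<cdot> (y \<cdot> w) - w \<cdot> y \<cdot> x \<in> I"
proof -
  have "x \<cdot> (y \<cdot> w) - w \<cdot> y \<cdot> x = (nassociator y w x + nassociator y x w)
      - (nassociator w y x + nassociator y w x) - (nassociator y x w + nassociator x y w)
      + (x \<cdot> y) \<cdot> w - w \<cdot> (y \<cdot> x)"
    by (simp add: nassociator_def algebra_simps)
  also have "\<dots> \<in> I" by (intro closure sqD al ar assms)
  finally show ?thesis .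
qed

lemma rl:
  assumes "sq w"
  shows "x \<cdot> (w \<cdot> y) - x \<cdot> w \<cdot> y - w \<cdot> x \<cdot> y \<in> I"
proof -
  have "x \<cdot> (w \<cdot> y) - x \<cdot> w \<cdot> y - w \<cdot> x \<cdot> y
      = - (nassociator x w y + nassociator w x y) - w \<cdot> (x \<cdot> y)"
    by (simp add: nassociator_def algebra_simps)
  also have "\<dots> \<in> I" by (intro closure sqD al assms)
  finally show ?thesis .
qed

text \<open>The only operator identity that draws on the nil condition: of the six products in
  \<open>nil_form w x y\<close> two vanish by the metabelian law and two cancel by
  \<open>rr\<close>.\<close>

lemma lr:
  assumes "sq w"
  shows "x \<cdot> w \<cdot> y + y \<cdot> w \<cdot> x \<in> I"
proof -
  have "x \<cdot> w \<cdot> y + y \<cdot> w \<cdot> x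
      = nil_form w x y - (w \<cdot> x \<cdot> y + w \<cdot> y \<cdot> x) - (x \<cdot> y) \<cdot> w - (y \<cdot> x) \<cdot> w"
    by (simp add: nil_form_def algebra_simps)
  also have "\<dots> \<in> I" by (intro closure sqD nil3 rr assms)
  finally show ?thesis .
qed

section \<open>Skew symmetry of the trilinear forms and of their words\<close>

lemma pform_skew: "pform f g h + pform f h g \<in> I"
proof -
  have "pform f g h + pform f h g = nassociator f g h + nassociator f h g"
    by (simp add: pform_def algebra_simps)
  then show ?thesis by (simp add: ar)
qed

lemma qform_skew: "qform f g h + qform f h g \<in> I"
proof -
  have "qform f g h + qform f h g = (nassociator f g h + nassociator f h g) - nil_form f g h"
    by (simp add: qform_def nil_form_def algebra_simps)
  also have "\<dots> \<in> I" by (intro closure ar nil3)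
  finally show ?thesis .
qed

lemmas elementary = al ar nil2 nil3 alt_left alt_right rr[OF sq_nmult] lr[OF sq_nmult]
  rl[OF sq_nmult] ll[OF sq_nmult] rr0[OF sq_nmult]

text \<open>Skew symmetry across the junction between the form and the first right factor, where
  neither \<open>pform_skew\<close> nor \<open>rr\<close> applies. The right-hand side is an
  explicit certificate: each summand arises from one member of \<open>elementary\<close>, if need be
  multiplied by a letter.\<close>

lemma pform_R0: "pform a b c \<cdot> c \<in> I"
proof -
  have "pform a b c \<cdot> c = ((nassociator a b c + nassociator b a c)
        - (nassociator b a c + nassociator b c a)) \<cdot> c
      + a \<cdot> b \<cdot> c \<cdot> c - (b \<cdot> (c \<cdot> a) \<cdot> c + c \<cdot> (c \<cdot> a) \<cdot> b) - nassociator c c a \<cdot> b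
      - (a \<cdot> c \<cdot> b \<cdot> c + a \<cdot> c \<cdot> c \<cdot> b) + nassociator a c c \<cdot> b
      + (c \<cdot> b \<cdot> a \<cdot> c + c \<cdot> b \<cdot> c \<cdot> a) - (c \<cdot> c \<cdot> b + c \<cdot> b \<cdot> c + b \<cdot> c \<cdot> c) \<cdot> a
      + nassociator b c c \<cdot> a + (c \<cdot> c \<cdot> a \<cdot> b + c \<cdot> c \<cdot> b \<cdot> a) + (a \<cdot> (c \<cdot> c) \<cdot> b + b \<cdot> (c \<cdot> c) \<cdot> a)"
    by (simp add: pform_def nassociator_def nmult_distribs algebra_simps)
  also have "\<dots> \<in> I" by (rule elementary | rule add diff uminus | rule mult_right mult_left)+
  finally show ?thesis .
qed

lemma qform_R0: "qform a b c \<cdot> c \<in> I"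
proof -
  let ?N = "\<lambda>c a. c \<cdot> c \<cdot> a + c \<cdot> a \<cdot> c + a \<cdot> c \<cdot> c"
  have "qform a b c \<cdot> c = ((nassociator a b c + nassociator b a c)
        - (nassociator b a c + nassociator b c a)) \<cdot> c
      - (b \<cdot> (c \<cdot> a) \<cdot> c + c \<cdot> (c \<cdot> a) \<cdot> b) - nassociator c c a \<cdot> b
      + (b \<cdot> c \<cdot> a \<cdot> c + b \<cdot> c \<cdot> c \<cdot> a) - a \<cdot> b \<cdot> c \<cdot> c
      - (c \<cdot> a \<cdot> b \<cdot> c + c \<cdot> a \<cdot> c \<cdot> b) - (c \<cdot> a \<cdot> b \<cdot> c + c \<cdot> a \<cdot> c \<cdot> b)
      - (c \<cdot> b \<cdot> a \<cdot> c + c \<cdot> b \<cdot> c \<cdot> a) + b \<cdot> a \<cdot> c \<cdot> c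
      + ?N c a \<cdot> b + ?N c a \<cdot> b + ?N c b \<cdot> a - (c \<cdot> c \<cdot> a \<cdot> b + c \<cdot> c \<cdot> b \<cdot> a)
      - (a \<cdot> (c \<cdot> c) \<cdot> b + b \<cdot> (c \<cdot> c) \<cdot> a) - (a \<cdot> (c \<cdot> c) \<cdot> b + b \<cdot> (c \<cdot> c) \<cdot> a)
      - nassociator a c c \<cdot> b - nassociator a c c \<cdot> b - nassociator b c c \<cdot> a - nassociator b c c \<cdot> a"
    by (simp add: qform_def nassociator_def nmult_distribs algebra_simps)
  also have "\<dots> \<in> I" by (rule elementary | rule add diff uminus | rule mult_right mult_left)+
  finally show ?thesis .
qed

lemma pform_R: "pform a b c \<cdot> d + pform a b d \<cdot> c \<in> I"
proof -
  have "pform a b c \<cdot> d + pform a b d \<cdot> c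
      = pform a b (c + d) \<cdot> (c + d) - pform a b c \<cdot> c - pform a b d \<cdot> d"
    by (simp add: pform_def nassociator_distribs nmult_distribs algebra_simps)
  also have "\<dots> \<in> I" by (intro closure pform_R0)
  finally show ?thesis .
qed

lemma qform_R: "qform a b c \<cdot> d + qform a b d \<cdot> c \<in> I"
proof -
  have "qform a b c \<cdot> d + qform a b d \<cdot> c
      = qform a b (c + d) \<cdot> (c + d) - qform a b c \<cdot> c - qform a b d \<cdot> d"
    by (simp add: qform_def nassociator_distribs nmult_distribs algebra_simps)
  also have "\<dots> \<in> I" by (intro closure qform_R0)
  finally show ?thesis .
qed

text \<open>Together with \<open>qform_L\<close> this is the rule of the square for two operators:
  \<open>L\<close> after \<open>R R\<close> gives \<open>L R R\<close>, and \<open>L\<close> after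
  \<open>L R\<close> gives \<open>- R R R - L R R\<close>. It needs a certificate of its own because
  the forms contain no factor from the square in the first place.\<close>

lemma pform_L: "d \<cdot> pform a b c - qform a b c \<cdot> d \<in> I"
proof -
  let ?al = "\<lambda>x y z. nassociator x y z + nassociator y x z"
  let ?ar = "\<lambda>x y z. nassociator x y z + nassociator x z y"
  let ?ll = "\<lambda>x y w. x \<cdot> (y \<cdot> w) - w \<cdot> y \<cdot> x"
  let ?rl = "\<lambda>x w y. x \<cdot> (w \<cdot> y) - x \<cdot> w \<cdot> y - w \<cdot> x \<cdot> y"
  let ?lr = "\<lambda>x y w. x \<cdot> w \<cdot> y + y \<cdot> w \<cdot> x"
  let ?rr = "\<lambda>w x y. w \<cdot> x \<cdot> y + w \<cdot> y \<cdot> x"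
  have "d \<cdot> pform a b c - qform a b c \<cdot> d = - ?ll d a (c \<cdot> b) - d \<cdot> ?al c a b + d \<cdot> ?ar c a b
      + ?ll d c (b \<cdot> a) - ?ll d a (b \<cdot> c) - ?lr a d (b \<cdot> c) - ?rl d (b \<cdot> c) a - ?rr (b \<cdot> c) a d
      + ?rr (a \<cdot> b) c d + ?rr (a \<cdot> b) c d - ?ar a b c \<cdot> d - ?ar a b c \<cdot> d + ?al c a b \<cdot> d
      + ?al c a b \<cdot> d + ?rl d (a \<cdot> b) c + ?rl d (a \<cdot> b) c + ?lr c d (a \<cdot> b) + ?lr c d (a \<cdot> b)"
    by (simp add: pform_def qform_def nassociator_def nmult_distribs algebra_simps)
  also have "\<dots> \<in> I" by (rule elementary | rule add diff uminus | rule mult_right mult_left)+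
  finally show ?thesis .
qed

lemma qform_L: "d \<cdot> qform a b c + pform a b c \<cdot> d + qform a b c \<cdot> d \<in> I"
proof -
  let ?al = "\<lambda>x y z. nassociator x y z + nassociator y x z"
  let ?ar = "\<lambda>x y z. nassociator x y z + nassociator x z y"
  let ?ll = "\<lambda>x y w. x \<cdot> (y \<cdot> w) - w \<cdot> y \<cdot> x"
  let ?rl = "\<lambda>x w y. x \<cdot> (w \<cdot> y) - x \<cdot> w \<cdot> y - w \<cdot> x \<cdot> y"
  let ?lr = "\<lambda>x y w. x \<cdot> w \<cdot> y + y \<cdot> w \<cdot> x"
  let ?rr = "\<lambda>w x y. w \<cdot> x \<cdot> y + w \<cdot> y \<cdot> x"
  have "d \<cdot> qform a b c + pform a b c \<cdot> d + qform a b c \<cdot> d = - (d \<cdot> ?ar c a b) - d \<cdot> ?ar c a b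
      + ?ll d b (c \<cdot> a) + ?ll d b (c \<cdot> a) - ?ll d c (a \<cdot> b) - ?ll d c (a \<cdot> b) + d \<cdot> ?al b c a
      - ?ll d a (b \<cdot> c) - ?rl d (b \<cdot> c) a - ?rl d (b \<cdot> c) a - ?rr (b \<cdot> c) a d - ?rr (b \<cdot> c) a d
      - ?lr a d (b \<cdot> c) - ?lr a d (b \<cdot> c) + d \<cdot> ?ar b c a + ?ll d b (a \<cdot> c) - ?ll d c (b \<cdot> a)"
    by (simp add: pform_def qform_def nassociator_def nmult_distribs algebra_simps)
  also have "\<dots> \<in> I" by (rule elementary | rule add diff uminus | rule mult_right mult_left)+
  finally show ?thesis .
qed

text \<open>Reconstruction in degree 3, and the origin of the factor 3. A square in place of
  \<open>a\<close> yields \<open>w R_b R_c\<close>, in place of \<open>b\<close> it yields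
  \<open>w L_a R_c\<close>, in place of \<open>c\<close> zero; the forms on the right correspond to
  these values.\<close>

lemma base_right: "nsmult 3 (a \<cdot> b \<cdot> c) - (pform a b c + qform b a c) \<in> I"
proof -
  have "nsmult 3 f = f + f + f" for f :: "'a npoly"
    by (intro poly_mapping_eqI) (simp add: lookup_add)
  then have "nsmult 3 (a \<cdot> b \<cdot> c) - (pform a b c + qform b a c)
      = nil_form a b c - (nassociator a b c + nassociator b a c)"
    by (simp add: pform_def qform_def nil_form_def algebra_simps)
  also have "\<dots> \<in> I" by (intro closure al nil3)
  finally show ?thesis .
qed

text \<open>Here a square in place of \<open>a\<close> yields
  \<open>w R_b L_c = w L_c R_b + w R_c R_b\<close>, and in place of \<open>b\<close> it yields
  \<open>w L_a L_c = - w R_c R_a\<close>.\<close>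

lemma base_left: "nsmult 3 (c \<cdot> (a \<cdot> b)) - (pform a c b + qform a c b - pform b c a) \<in> I"
proof -
  have "nsmult 3 f = f + f + f" for f :: "'a npoly"
    by (intro poly_mapping_eqI) (simp add: lookup_add)
  then have "nsmult 3 (c \<cdot> (a \<cdot> b)) - (pform a c b + qform a c b - pform b c a)
      = nil_form a b c - (nassociator a c b + nassociator c a b)
        - (nassociator a c b + nassociator c a b)
        + (nassociator b c a + nassociator c b a) - (nassociator c b a + nassociator c a b)"
    by (simp add: pform_def qform_def nil_form_def nassociator_def algebra_simps)
  also have "\<dots> \<in> I" by (intro closure al ar nil3)
  finally show ?thesis .
qed

lemma sq_skew_word:
  assumes "\<And>f g h. sq (F f g h)"
  shows "sq (skew_word F i ys)"
proof (cases "(F, i, ys)" rule: skew_word.cases)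
  case (1 F' i' x y zs)
  then show ?thesis using assms
    by (cases zs rule: rev_cases) auto
qed (auto simp: sq_def zero)

text \<open>The transposed letters lie both inside the form, across its junction with the right
  factors, or both outside; letters further to the right are harmless because \<open>I\<close> is an
  ideal.\<close>

lemma skew_word_swap:
  assumes F: "F = pform \<or> F = qform"
  shows "skew_word F i (xs @ x # y # ys) + skew_word F i (xs @ y # x # ys) \<in> I"
proof (induction ys rule: rev_induct)
  case Nil
  consider "xs = []" | a where "xs = [a]" | "2 \<le> length xs"
    by (cases xs rule: remdups_adj.cases) auto
  then show ?case
  proof cases
    case 1 then show ?thesis using F pform_skew qform_skew by auto
  next
    case 2 then show ?thesis using F pform_R qform_R by auto
  next
    case 3
    have "skew_word F i (xs @ [u, v]) = skew_word F i xs \<cdot> nvar u \<cdot> nvar v" for u v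
      using 3 skew_word_snoc[of "xs @ [u]" F i v] skew_word_snoc[of xs F i u] by simp
    moreover have "sq (skew_word F i xs)" using F sq_skew_word by auto
    ultimately show ?thesis using rr by simp
  qed
next
  case (snoc z zs)
  have "skew_word F i (xs @ u # v # zs @ [z]) = skew_word F i (xs @ u # v # zs) \<cdot> nvar z" for u v
    using skew_word_snoc[of "xs @ u # v # zs" F i z] by simp
  then show ?case using mult_right[OF snoc] by (simp add: nmult_distribs)
qed

lemma skew_word_rotate:
  assumes F: "F = pform \<or> F = qform"
  shows "skew_word F i (xs @ k # ys) - nsmult ((- 1) ^ length ys) (skew_word F i (xs @ ys @ [k])) \<in> I"
proof (induction ys arbitrary: xs)
  case Nil
  then show ?case by (simp add: zero)
next
  case (Cons y ys)
  have "skew_word F i (xs @ k # y # ys)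
      - nsmult ((- 1) ^ length (y # ys)) (skew_word F i (xs @ (y # ys) @ [k]))
    = (skew_word F i (xs @ k # y # ys) + skew_word F i (xs @ y # k # ys))
      - (skew_word F i ((xs @ [y]) @ k # ys)
          - nsmult ((- 1) ^ length ys) (skew_word F i ((xs @ [y]) @ ys @ [k])))"
    by (intro poly_mapping_eqI) (simp add: lookup_add lookup_minus)
  also have "\<dots> \<in> I" by (intro closure skew_word_swap F Cons)
  finally show ?case .
qed

text \<open>By \<open>rl\<close> the left factor passes the last letter at the cost of one extra
  right operator. This term changes the rule, so two rules alternate with the parity of the length,
  starting from \<open>pform_L\<close> and \<open>qform_L\<close>.\<close>

lemma skew_word_left_snoc:
  assumes "2 \<le> length ys"
  shows "if even (length ys)
    then nvar k \<cdot> skew_word pform i ys - skew_word qform i ys \<cdot> nvar k \<in> I \<and>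
      nvar k \<cdot> skew_word qform i ys + skew_word pform i ys \<cdot> nvar k + skew_word qform i ys \<cdot> nvar k \<in> I
    else nvar k \<cdot> skew_word pform i ys + skew_word pform i ys \<cdot> nvar k + skew_word qform i ys \<cdot> nvar k \<in> I \<and>
      nvar k \<cdot> skew_word qform i ys - skew_word pform i ys \<cdot> nvar k \<in> I"
  using assms
proof (induction ys rule: rev_induct)
  case (snoc y ys)
  show ?case
  proof (cases "length ys = 1")
    case True
    then obtain x where "ys = [x]" by (auto simp: length_Suc_conv)
    then show ?thesis using pform_L qform_L by simp
  next
    case False
    then have len: "2 \<le> length ys" using snoc.prems by simp
    define p q k' y' :: "'a npoly" where "p = skew_word pform i ys" "q = skew_word qform i ys"
      "k' = (nvar k :: 'a npoly)" "y' = (nvar y :: 'a npoly)"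
    have sq: "sq p" "sq q" by (simp_all add: p_q_k'_y'_def sq_skew_word)
    have w: "skew_word pform i (ys @ [y]) = p \<cdot> y'" "skew_word qform i (ys @ [y]) = q \<cdot> y'"
      using len by (simp_all add: p_q_k'_y'_def skew_word_snoc)
    note rl = rl[OF sq(1), of k' y'] rl[OF sq(2), of k' y']
    note rr = rr[OF sq(1), of k' y'] rr[OF sq(2), of k' y']
    show ?thesis
    proof (cases "even (length ys)")
      case True
      have IH: "k' \<cdot> p - q \<cdot> k' \<in> I" "k' \<cdot> q + p \<cdot> k' + q \<cdot> k' \<in> I"
        using snoc.IH[OF len] True by (simp_all add: p_q_k'_y'_def)
      have "k' \<cdot> (p \<cdot> y') + p \<cdot> y' \<cdot> k' + q \<cdot> y' \<cdot> k'
          = (k' \<cdot> (p \<cdot> y') - k' \<cdot> p \<cdot> y' - p \<cdot> k' \<cdot> y') + (k' \<cdot> p - q \<cdot> k') \<cdot> y'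
            + (p \<cdot> k' \<cdot> y' + p \<cdot> y' \<cdot> k') + (q \<cdot> k' \<cdot> y' + q \<cdot> y' \<cdot> k')"
        by (simp add: nmult_distribs algebra_simps)
      also have "\<dots> \<in> I" by (intro closure rl rr IH)
      finally have 1: "k' \<cdot> (p \<cdot> y') + p \<cdot> y' \<cdot> k' + q \<cdot> y' \<cdot> k' \<in> I" .
      have "k' \<cdot> (q \<cdot> y') - p \<cdot> y' \<cdot> k'
          = (k' \<cdot> (q \<cdot> y') - k' \<cdot> q \<cdot> y' - q \<cdot> k' \<cdot> y') + (k' \<cdot> q + p \<cdot> k' + q \<cdot> k') \<cdot> y'
            - (p \<cdot> k' \<cdot> y' + p \<cdot> y' \<cdot> k')"
        by (simp add: nmult_distribs algebra_simps)
      also have "\<dots> \<in> I" by (intro closure rl rr IH)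
      finally show ?thesis using True 1 by (simp add: w p_q_k'_y'_def(3)[symmetric])
    next
      case False
      have IH: "k' \<cdot> p + p \<cdot> k' + q \<cdot> k' \<in> I" "k' \<cdot> q - p \<cdot> k' \<in> I"
        using snoc.IH[OF len] False by (simp_all add: p_q_k'_y'_def)
      have "k' \<cdot> (p \<cdot> y') - q \<cdot> y' \<cdot> k'
          = (k' \<cdot> (p \<cdot> y') - k' \<cdot> p \<cdot> y' - p \<cdot> k' \<cdot> y') + (k' \<cdot> p + p \<cdot> k' + q \<cdot> k') \<cdot> y'
            - (q \<cdot> k' \<cdot> y' + q \<cdot> y' \<cdot> k')"
        by (simp add: nmult_distribs algebra_simps)
      also have "\<dots> \<in> I" by (intro closure rl rr IH)
      finally have 1: "k' \<cdot> (p \<cdot> y') - q \<cdot> y' \<cdot> k' \<in> I" .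
      have "k' \<cdot> (q \<cdot> y') + p \<cdot> y' \<cdot> k' + q \<cdot> y' \<cdot> k'
          = (k' \<cdot> (q \<cdot> y') - k' \<cdot> q \<cdot> y' - q \<cdot> k' \<cdot> y') + (k' \<cdot> q - p \<cdot> k') \<cdot> y'
            + (p \<cdot> k' \<cdot> y' + p \<cdot> y' \<cdot> k') + (q \<cdot> k' \<cdot> y' + q \<cdot> y' \<cdot> k')"
        by (simp add: nmult_distribs algebra_simps)
      also have "\<dots> \<in> I" by (intro closure rl rr IH)
      finally show ?thesis using False 1 by (simp add: w p_q_k'_y'_def(3)[symmetric])
    qed
  qed
qed simp

section \<open>Reconstruction of monomials from their coefficients\<close>

definition wterm :: "'a \<times> 'a \<Rightarrow> nat \<Rightarrow> nat list \<Rightarrow> 'a npoly" where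
  "wterm pq i ys = nsmult (fst pq) (skew_word pform i ys) + nsmult (snd pq) (skew_word qform i ys)"

text \<open>Moving the new letter from the end of the word to its front costs
  \<open>(- 1) ^ length ys\<close>. This sign turns the rules of \<open>skew_word_left_snoc\<close>
  into the two matrices of \<open>left_coef\<close>, and the letters stay in their order of
  occurrence.\<close>

lemma wterm_left:
  assumes "2 \<le> length ys"
  shows "nvar k \<cdot> wterm pq i ys - wterm (left_coef (length ys) pq) i (k # ys) \<in> I"
proof -
  define P Q p q k' :: "'a npoly" where "P = skew_word pform i (k # ys)" "Q = skew_word qform i (k # ys)"
    "p = skew_word pform i ys" "q = skew_word qform i ys" "k' = (nvar k :: 'a npoly)"
  note defs = P_Q_p_q_k'_def
  obtain s t where pq: "pq = (s, t)" by (cases pq)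
  have rot: "P - nsmult ((- 1) ^ length ys) (p \<cdot> k') \<in> I" "Q - nsmult ((- 1) ^ length ys) (q \<cdot> k') \<in> I"
    using skew_word_rotate[of pform i "[]" k ys] skew_word_rotate[of qform i "[]" k ys] assms
    by (simp_all add: defs skew_word_snoc)
  note L = skew_word_left_snoc[OF assms, of k i, folded defs]
  show ?thesis
  proof (cases "even (length ys)")
    case True
    have R: "P - p \<cdot> k' \<in> I" "Q - q \<cdot> k' \<in> I"
      and L': "k' \<cdot> p - q \<cdot> k' \<in> I" "k' \<cdot> q + p \<cdot> k' + q \<cdot> k' \<in> I"
      using rot L True by auto
    have "k' \<cdot> wterm pq i ys - wterm (left_coef (length ys) pq) i (k # ys)
        = nsmult s (k' \<cdot> p - q \<cdot> k') + nsmult t (k' \<cdot> q + p \<cdot> k' + q \<cdot> k')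
          + nsmult t (P - p \<cdot> k') - nsmult (s - t) (Q - q \<cdot> k')"
      using True
      by (intro poly_mapping_eqI)
         (simp add: wterm_def left_coef_def pq defs[symmetric] nmult_distribs nmult_nsmult_right
            lookup_add lookup_minus algebra_simps)
    also have "\<dots> \<in> I"
      by (rule R L' | rule add diff | rule smult)+
    finally show ?thesis by (simp add: defs)
  next
    case False
    have R: "P + p \<cdot> k' \<in> I" "Q + q \<cdot> k' \<in> I"
      and L': "k' \<cdot> p + p \<cdot> k' + q \<cdot> k' \<in> I" "k' \<cdot> q - p \<cdot> k' \<in> I"
      using rot L False by auto
    have "k' \<cdot> wterm pq i ys - wterm (left_coef (length ys) pq) i (k # ys)
        = nsmult s (k' \<cdot> p + p \<cdot> k' + q \<cdot> k') + nsmult t (k' \<cdot> q - p \<cdot> k')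
          - nsmult (s - t) (P + p \<cdot> k') - nsmult s (Q + q \<cdot> k')"
      using False
      by (intro poly_mapping_eqI)
         (simp add: wterm_def left_coef_def pq defs[symmetric] nmult_distribs nmult_nsmult_right
            lookup_add lookup_minus algebra_simps)
    also have "\<dots> \<in> I"
      by (rule R L' | rule add diff | rule smult)+
    finally show ?thesis by (simp add: defs)
  qed
qed

lemma wterm_snoc: "2 \<le> length ys \<Longrightarrow> wterm pq i (ys @ [k]) = wterm pq i ys \<cdot> nvar k"
  by (simp add: wterm_def skew_word_snoc nmult_distribs nmult_nsmult_left)

lemma wterm_zero [simp]: "wterm (0, 0) i ys = 0"
  by (simp add: wterm_def)

definition normal_form :: "nmonom \<Rightarrow> 'a npoly" where
  "normal_form m = (\<Sum>i\<in>set (letters m). wterm (wcoef i m) i (remove1 i (letters m)))"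

lemma nmult_sum_left: "sum f S \<cdot> g = (\<Sum>x\<in>S. f x \<cdot> g)" for f :: "'b \<Rightarrow> 'a npoly"
  by (induction S rule: infinite_finite_induct) (auto simp: nmult_add_left)

lemma nmult_sum_right: "g \<cdot> sum f S = (\<Sum>x\<in>S. g \<cdot> f x)" for f :: "'b \<Rightarrow> 'a npoly"
  by (induction S rule: infinite_finite_induct) (auto simp: nmult_add_right)

text \<open>The recursion of \<open>wcoef\<close> is followed through the monomial: a right factor
  appends a letter, a left factor is handled by \<open>wterm_left\<close>, and degree 3 rests on the
  two base identities.\<close>

lemma monomial_normal_form:
  assumes "distinct (letters m)" "3 \<le> length (letters m)"
  shows "nsmult 3 (nmon m) - normal_form m \<in> I"
  using assms
proof (induction m)
  case (Var x)
  then show ?case by simp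
next
  case (Mul u v)
  have dist: "distinct (letters u)" "distinct (letters v)" "set (letters u) \<inter> set (letters v) = {}"
    using Mul.prems by auto
  consider "\<not> is_Var u" "\<not> is_Var v" | "\<not> is_Var u" "is_Var v" | "is_Var u" "\<not> is_Var v"
    using Mul.prems by (auto simp: is_Var_iff)
  then show ?case
  proof cases
    case 1
    then obtain a b c d where "u = Mul a b" "v = Mul c d" by (metis not_is_VarE)
    then have "nmon (Mul u v) \<in> I" using metab by simp
    moreover have "normal_form (Mul u v) = 0"
      unfolding normal_form_def using 1 by (intro sum.neutral) auto
    ultimately show ?thesis by (simp add: smult)
  next
    case 2
    then obtain k where v: "v = Var k" by (auto simp: is_Var_def)
    show ?thesis
    proof (cases "length (letters u) = 2")
      case True
      then obtain a b where u: "u = Mul (Var a) (Var b)" using length_letters_two by blast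
      have "normal_form (Mul u v)
          = pform (nvar a) (nvar b) (nvar k) + qform (nvar b) (nvar a) (nvar k)"
        using Mul.prems by (simp add: normal_form_def u v wterm_def is_Var_def left_coef_def)
      then show ?thesis using base_right[of "nvar a" "nvar b" "nvar k"] by (simp add: u v)
    next
      case False
      then have len: "3 \<le> length (letters u)" using Mul.prems v by simp
      \<comment> \<open>The index \<open>k\<close> drops out: a square in its place would be
        multiplied by \<open>u\<close>, itself a product.\<close>
      have "normal_form (Mul u v) = (\<Sum>i\<in>set (letters u).
          wterm (wcoef i (Mul u v)) i (remove1 i (letters (Mul u v))))"
        unfolding normal_form_def using dist v 2
        by (intro sum.mono_neutral_right) (auto simp: is_Var_def)
      also have "\<dots> = (\<Sum>i\<in>set (letters u). wterm (wcoef i u) i (remove1 i (letters u)) \<cdot> nvar k)"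
      proof (intro sum.cong refl)
        fix i assume i: "i \<in> set (letters u)"
        then have "2 \<le> length (remove1 i (letters u))" using len by (simp add: length_remove1)
        then show "wterm (wcoef i (Mul u v)) i (remove1 i (letters (Mul u v)))
            = wterm (wcoef i u) i (remove1 i (letters u)) \<cdot> nvar k"
          using i by (simp add: v remove1_append is_Var_def wterm_snoc)
      qed
      finally have "nsmult 3 (nmon (Mul u v)) - normal_form (Mul u v)
          = (nsmult 3 (nmon u) - normal_form u) \<cdot> nvar k"
        by (simp add: normal_form_def nmult_sum_left nmult_distribs nmult_nsmult_left v)
      then show ?thesis using Mul.IH(1) dist len mult_right by simp
    qed
  next
    case 3
    then obtain k where u: "u = Var k" by (auto simp: is_Var_def)
    show ?thesis
    proof (cases "length (letters v) = 2")
      case True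
      then obtain a b where v: "v = Mul (Var a) (Var b)" using length_letters_two by blast
      have "normal_form (Mul u v) = pform (nvar a) (nvar k) (nvar b)
          + qform (nvar a) (nvar k) (nvar b) - pform (nvar b) (nvar k) (nvar a)"
        using Mul.prems by (simp add: normal_form_def u v wterm_def is_Var_def left_coef_def)
      then show ?thesis using base_left[of "nvar k" "nvar a" "nvar b"] by (simp add: u v)
    next
      case False
      then have len: "3 \<le> length (letters v)" using Mul.prems u by simp
      have "normal_form (Mul u v) = (\<Sum>i\<in>set (letters v).
          wterm (wcoef i (Mul u v)) i (remove1 i (letters (Mul u v))))"
        unfolding normal_form_def using dist u 3
        by (intro sum.mono_neutral_right) (auto simp: is_Var_def)
      also have "\<dots> = (\<Sum>i\<in>set (letters v).
          wterm (left_coef (length (remove1 i (letters v))) (wcoef i v)) i (k # remove1 i (letters v)))"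
        using dist u by (intro sum.cong refl) (auto simp: is_Var_def length_remove1)
      finally have *: "nsmult 3 (nmon (Mul u v)) - normal_form (Mul u v)
          = nvar k \<cdot> (nsmult 3 (nmon v) - normal_form v)
            + (\<Sum>i\<in>set (letters v). nvar k \<cdot> wterm (wcoef i v) i (remove1 i (letters v))
              - wterm (left_coef (length (remove1 i (letters v))) (wcoef i v)) i
                  (k # remove1 i (letters v)))"
        by (simp add: normal_form_def nmult_sum_right nmult_distribs nmult_nsmult_right u sum_subtractf)
      show ?thesis
        unfolding * using Mul.IH(2) dist len
        by (intro add mult_left sum wterm_left) (auto simp: length_remove1)
    qed
  qed
qed

end

section \<open>Koszul signs\<close>

definition swap_sign :: "(nat \<Rightarrow> bit) \<Rightarrow> nat \<Rightarrow> nat \<Rightarrow> 'a::field" where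
  "swap_sign p x y = (if y < x then parity_sign (p x) (p y) else 1)"

lemma koszul_sign_Nil [simp]: "koszul_sign p [] = 1"
  by (simp add: koszul_sign_def)

lemma prod_list_eq_prod_nth: "prod_list xs = (\<Prod>i<length xs. xs ! i)" for xs :: "'a::comm_monoid_mult list"
  by (induction xs) (simp_all add: prod.lessThan_Suc_shift del: prod.lessThan_Suc)

lemma koszul_sign_Cons:
  "koszul_sign p (x # xs) = (\<Prod>y\<leftarrow>xs. swap_sign p x y) * koszul_sign p xs"
proof -
  let ?w = "x # xs"
  let ?g = "\<lambda>(i, j). parity_sign (p (?w ! i)) (p (?w ! j))"
  let ?A = "{(i, j). i < j \<and> j < length ?w \<and> ?w ! j < ?w ! i}"
  let ?B = "{j. j < length xs \<and> xs ! j < x}"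
  let ?C = "{(i, j). i < j \<and> j < length xs \<and> xs ! j < xs ! i}"
  \<comment> \<open>Inversions with the first letter, and inversions within the tail with shifted
    positions.\<close>
  have A: "?A = (\<lambda>j. (0, Suc j)) ` ?B \<union> map_prod Suc Suc ` ?C"
  proof (intro equalityI subsetI)
    fix ij assume "ij \<in> ?A"
    then obtain i j where "ij = (i, Suc j)" "i < Suc j" "j < length xs" "xs ! j < ?w ! i"
      by (auto simp: gr0_conv_Suc elim!: less_natE)
    then show "ij \<in> (\<lambda>j. (0, Suc j)) ` ?B \<union> map_prod Suc Suc ` ?C"
      by (cases i) (auto simp: image_iff)
  qed auto
  have fin: "finite ?C" by (rule finite_subset[of _ "{..<length xs} \<times> {..<length xs}"]) auto
  have "koszul_sign p ?w = prod ?g ?A" by (simp add: koszul_sign_def)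
  also have "\<dots> = prod ?g ((\<lambda>j. (0, Suc j)) ` ?B) * prod ?g (map_prod Suc Suc ` ?C)"
    unfolding A using fin by (intro prod.union_disjoint) auto
  also have "prod ?g ((\<lambda>j. (0, Suc j)) ` ?B) = (\<Prod>j\<in>?B. swap_sign p x (xs ! j))"
    by (subst prod.reindex) (auto simp: inj_on_def swap_sign_def)
  also have "\<dots> = (\<Prod>j<length xs. swap_sign p x (xs ! j))"
    by (intro prod.mono_neutral_left) (auto simp: swap_sign_def)
  also have "\<dots> = (\<Prod>y\<leftarrow>xs. swap_sign p x y)" by (simp add: prod_list_eq_prod_nth)
  also have "prod ?g (map_prod Suc Suc ` ?C) = koszul_sign p xs"
    unfolding koszul_sign_def
    by (subst prod.reindex) (auto simp: inj_on_def intro!: prod.cong)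
  finally show ?thesis .
qed

lemma parity_sign_square [simp]: "parity_sign i j * parity_sign i j = (1 :: 'a::field)"
  by (simp add: parity_sign_def)

lemma parity_sign_commute: "parity_sign i j = parity_sign j i"
  by (simp add: parity_sign_def)

lemma koszul_sign_swap:
  assumes "x \<noteq> y"
  shows "koszul_sign p (xs @ x # y # ys) = parity_sign (p x) (p y) * koszul_sign p (xs @ y # x # ys)"
proof (induction xs)
  case Nil
  show ?case
  proof (cases "x < y")
    case True
    then have "parity_sign (p x) (p y) * swap_sign p y x = (1 :: 'a)" "swap_sign p x y = (1 :: 'a)"
      by (auto simp: swap_sign_def parity_sign_commute[of "p x"])
    then show ?thesis by (simp add: koszul_sign_Cons mult_ac)
  next
    case False
    with assms have "swap_sign p x y = (parity_sign (p x) (p y) :: 'a)" "swap_sign p y x = (1 :: 'a)"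
      by (auto simp: swap_sign_def)
    then show ?thesis by (simp add: koszul_sign_Cons mult_ac)
  qed
next
  case (Cons z zs)
  then show ?case by (simp add: koszul_sign_Cons mult_ac)
qed

lemma koszul_sign_square [simp]: "koszul_sign p w * koszul_sign p w = (1 :: 'a::field)"
proof (induction w)
  case (Cons x xs)
  have "(\<Prod>y\<leftarrow>xs. swap_sign p x y) * (\<Prod>y\<leftarrow>xs. swap_sign p x y) = (1 :: 'a)"
  proof (induction xs)
    case (Cons y ys)
    have "swap_sign p x y * swap_sign p x y = (1 :: 'a)" by (simp add: swap_sign_def)
    then show ?case using Cons by (simp add: mult_ac)
  qed simp
  then show ?case using Cons by (simp add: koszul_sign_Cons mult_ac)
qed simp

text \<open>Even letters pass without sign. If \<open>i\<close> is the only even letter, what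
  remains is the permutation sign of the other letters, which also governs the skew words in
  them.\<close>

lemma koszul_sign_remove1:
  assumes "distinct w"
  shows "koszul_sign (\<lambda>x. if x = i then 0 else 1) w = (koszul_sign (\<lambda>_. 1) (remove1 i w) :: 'a::field)"
  using assms
proof (induction w)
  case (Cons x xs)
  show ?case
  proof (cases "x = i")
    case True
    have "(\<Prod>y\<leftarrow>ys. swap_sign (\<lambda>x. if x = i then 0 else 1) i y) = (1 :: 'a)" for ys
      by (induction ys) (auto simp: swap_sign_def parity_sign_def)
    moreover have "remove1 i xs = xs" using Cons.prems True by (simp add: remove1_idem)
    ultimately show ?thesis using Cons True by (simp add: koszul_sign_Cons)
  next
    case False
    have "(\<Prod>y\<leftarrow>ys. swap_sign (\<lambda>x. if x = i then 0 else 1) x y)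
        = (\<Prod>y\<leftarrow>remove1 i ys. swap_sign (\<lambda>_. 1) x y :: 'a)" if "distinct ys" for ys
      using that
    proof (induction ys)
      case (Cons y ys)
      then show ?case using False
        by (cases "y = i") (auto simp: swap_sign_def parity_sign_def remove1_idem)
    qed simp
    then show ?thesis using Cons False by (simp add: koszul_sign_Cons)
  qed
qed simp

text \<open>Words with the same distinct letters are linked by adjacent transpositions, so a
  reflexive transitive relation needs checking only on those. It serves once with congruence modulo
  \<open>I\<close> and once with equality.\<close>

lemma adjacent_swaps:
  assumes refl: "\<And>a. R a a" and trans: "\<And>a b c. R a b \<Longrightarrow> R b c \<Longrightarrow> R a c"
    and swap: "\<And>xs x y ys. distinct (xs @ x # y # ys) \<Longrightarrow> set (xs @ x # y # ys) = S \<Longrightarrow>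
      R (G (xs @ x # y # ys)) (G (xs @ y # x # ys))"
    and "distinct ws" "distinct ws'" "set ws = S" "set ws' = S"
  shows "R (G ws) (G ws')"
proof -
  have move: "R (G (pre @ x # as @ bs)) (G (pre @ as @ x # bs))"
    if "distinct (pre @ x # as @ bs)" "set (pre @ x # as @ bs) = S" for pre x as bs
    using that
  proof (induction as arbitrary: pre)
    case Nil
    then show ?case by (simp add: refl)
  next
    case (Cons a as)
    have "R (G (pre @ x # a # as @ bs)) (G (pre @ a # x # as @ bs))"
      using Cons.prems by (intro swap) auto
    moreover have "R (G ((pre @ [a]) @ x # as @ bs)) (G ((pre @ [a]) @ as @ x # bs))"
      using Cons.prems by (intro Cons.IH) auto
    ultimately show ?case using trans by simp
  qed
  have "R (G (pre @ us)) (G (pre @ us'))"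
    if "distinct (pre @ us)" "distinct (pre @ us')" "set us = set us'" "set (pre @ us) = S"
    for pre us us'
    using that
  proof (induction us arbitrary: pre us')
    case Nil
    then show ?case by (simp add: refl)
  next
    case (Cons x us)
    then obtain as bs where us': "us' = as @ x # bs" by (metis list.set_intros(1) split_list)
    have set_us: "set us = set (as @ bs)" using Cons.prems us' by auto
    have "R (G ((pre @ [x]) @ us)) (G ((pre @ [x]) @ as @ bs))"
      using Cons.prems set_us us' by (intro Cons.IH) auto
    moreover have "R (G (pre @ x # as @ bs)) (G (pre @ as @ x # bs))"
      using Cons.prems set_us us' by (intro move) auto
    ultimately show ?case using trans us' by simp
  qed
  from this[of "[]" ws ws'] show ?thesis using assms by simp
qed

section \<open>Vanishing criteria\<close>

context nalt_ideal
begin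

lemma skew_word_perm:
  assumes F: "F = pform \<or> F = qform" and ys: "distinct ys" "distinct ys'" "set ys = set ys'"
  shows "nsmult (koszul_sign (\<lambda>_. 1) ys) (skew_word F i ys)
       - nsmult (koszul_sign (\<lambda>_. 1) ys') (skew_word F i ys') \<in> I"
proof (rule adjacent_swaps[where R = "\<lambda>f g. f - g \<in> I" and S = "set ys"
      and G = "\<lambda>ys. nsmult (koszul_sign (\<lambda>_. 1) ys) (skew_word F i ys)"])
  fix f g h :: "'a npoly" assume "f - g \<in> I" "g - h \<in> I"
  then show "f - h \<in> I" using add[of "f - g" "g - h"] by simp
next
  fix xs zs and x y :: nat
  assume "distinct (xs @ x # y # zs)"
  then have "koszul_sign (\<lambda>_. 1) (xs @ x # y # zs) = - (koszul_sign (\<lambda>_. 1) (xs @ y # x # zs) :: 'a)"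
    by (subst koszul_sign_swap) (auto simp: parity_sign_def)
  then have "nsmult (koszul_sign (\<lambda>_. 1) (xs @ x # y # zs)) (skew_word F i (xs @ x # y # zs))
      - nsmult (koszul_sign (\<lambda>_. 1) (xs @ y # x # zs)) (skew_word F i (xs @ y # x # zs))
    = nsmult (koszul_sign (\<lambda>_. 1) (xs @ x # y # zs))
        (skew_word F i (xs @ x # y # zs) + skew_word F i (xs @ y # x # zs))"
    by (intro poly_mapping_eqI) (simp add: lookup_add lookup_minus algebra_simps)
  then show "nsmult (koszul_sign (\<lambda>_. 1) (xs @ x # y # zs)) (skew_word F i (xs @ x # y # zs))
      - nsmult (koszul_sign (\<lambda>_. 1) (xs @ y # x # zs)) (skew_word F i (xs @ y # x # zs)) \<in> I"
    using F by (simp add: smult skew_word_swap)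
qed (use ys zero in auto)

lemma wterm_perm:
  assumes w: "distinct w" "distinct w'" "set w = set w'" "i \<in> set w"
  defines "k \<equiv> koszul_sign (\<lambda>x. if x = i then 0 else 1)"
  shows "wterm pq i (remove1 i w) - nsmult (k w * k w') (wterm pq i (remove1 i w')) \<in> I"
proof -
  let ?ys = "remove1 i w" and ?ys' = "remove1 i w'"
  define e e' where "e = (koszul_sign (\<lambda>_. 1) ?ys :: 'a)" "e' = (koszul_sign (\<lambda>_. 1) ?ys' :: 'a)"
  have k: "k w = e" "k w' = e'" using w by (simp_all add: k_def e_e'_def koszul_sign_remove1)
  have e: "e * e = 1" by (simp add: e_e'_def)
  have *: "skew_word F i ?ys - nsmult (e * e') (skew_word F i ?ys') \<in> I"
    if F: "F = pform \<or> F = qform" for F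
  proof -
    have "nsmult e (nsmult e (skew_word F i ?ys) - nsmult e' (skew_word F i ?ys')) \<in> I"
      unfolding e_e'_def using w by (intro smult skew_word_perm F) auto
    then show ?thesis by (simp add: nsmult_diff_right e)
  qed
  have "wterm pq i ?ys - nsmult (e * e') (wterm pq i ?ys')
      = nsmult (fst pq) (skew_word pform i ?ys - nsmult (e * e') (skew_word pform i ?ys'))
        + nsmult (snd pq) (skew_word qform i ?ys - nsmult (e * e') (skew_word qform i ?ys'))"
    by (intro poly_mapping_eqI) (simp add: wterm_def lookup_add lookup_minus algebra_simps)
  also have "\<dots> \<in> I" by (intro add smult *) auto
  finally show ?thesis by (simp add: k)
qed

text \<open>Modulo \<open>I\<close>, \<open>3 f\<close> is a sum of words over \<open>i\<close> and
  over the monomials. Sorting all words for one \<open>i\<close> into a common order turns their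
  coefficients into the sums of the last two hypotheses, which are those that
  \<open>odd_gen_superidentity_sums\<close> provides.\<close>

lemma multilinear_mem:
  assumes f: "\<And>m. m \<in> Poly_Mapping.keys f \<Longrightarrow> distinct (letters m) \<and> set (letters m) = X"
    and X: "finite X" "3 \<le> card X"
    and c: "\<And>i. i \<in> X \<Longrightarrow> (\<Sum>m\<in>Poly_Mapping.keys f. Poly_Mapping.lookup f m
      * koszul_sign (\<lambda>x. if x = i then 0 else 1) (letters m) * fst (wcoef i m)) = 0"
    and d: "\<And>i. i \<in> X \<Longrightarrow> (\<Sum>m\<in>Poly_Mapping.keys f. Poly_Mapping.lookup f m
      * koszul_sign (\<lambda>x. if x = i then 0 else 1) (letters m) * snd (wcoef i m)) = 0"
  shows "f \<in> I"
proof -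
  let ?K = "Poly_Mapping.keys f" and ?c = "Poly_Mapping.lookup f"
  let ?k = "\<lambda>i. koszul_sign (\<lambda>x. if x = i then 0 else 1) :: nat list \<Rightarrow> 'a"
  define w where "w = sorted_list_of_set X"
  have w: "distinct w" "set w = X" using X by (simp_all add: w_def)
  let ?t = "\<lambda>i m. wterm (wcoef i m) i (remove1 i (letters m))"
  let ?s = "\<lambda>i m. nsmult (?k i (letters m) * ?k i w) (wterm (wcoef i m) i (remove1 i w))"
  have nf: "nsmult 3 (nmon m) - (\<Sum>i\<in>X. ?t i m) \<in> I" if "m \<in> ?K" for m
  proof -
    have m: "distinct (letters m)" "set (letters m) = X" using f that by auto
    then have "3 \<le> length (letters m)" using X distinct_card by metis
    then show ?thesis using monomial_normal_form[OF m(1)] m by (simp add: normal_form_def)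
  qed
  have ts: "?t i m - ?s i m \<in> I" if "m \<in> ?K" "i \<in> X" for m i
    using f[OF that(1)] w that(2) by (intro wterm_perm) auto
  have z: "(\<Sum>m\<in>?K. nsmult (?c m) (?s i m)) = 0" if "i \<in> X" for i
  proof -
    have "(\<Sum>m\<in>?K. nsmult (?c m) (?s i m)) = (\<Sum>m\<in>?K.
          nsmult (?c m * ?k i (letters m) * fst (wcoef i m)) (nsmult (?k i w) (skew_word pform i (remove1 i w)))
        + nsmult (?c m * ?k i (letters m) * snd (wcoef i m)) (nsmult (?k i w) (skew_word qform i (remove1 i w))))"
      by (intro sum.cong refl) (simp add: wterm_def nsmult_add_right mult_ac)
    also have "\<dots> = nsmult (\<Sum>m\<in>?K. ?c m * ?k i (letters m) * fst (wcoef i m))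
          (nsmult (?k i w) (skew_word pform i (remove1 i w)))
        + nsmult (\<Sum>m\<in>?K. ?c m * ?k i (letters m) * snd (wcoef i m))
          (nsmult (?k i w) (skew_word qform i (remove1 i w)))"
      by (intro poly_mapping_eqI) (simp add: lookup_add lookup_sum sum.distrib sum_distrib_right)
    also have "\<dots> = 0" using c[OF that] d[OF that] by simp
    finally show ?thesis .
  qed
  have "nsmult 3 f = (\<Sum>m\<in>?K. nsmult (?c m) (nsmult 3 (nmon m)))"
    by (subst npoly_eq_sum_nmon) (simp add: nsmult_sum mult.commute)
  also have "\<dots> = (\<Sum>m\<in>?K. nsmult (?c m) (nsmult 3 (nmon m) - (\<Sum>i\<in>X. ?t i m)))
      + (\<Sum>m\<in>?K. \<Sum>i\<in>X. nsmult (?c m) (?t i m - ?s i m))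
      + (\<Sum>m\<in>?K. \<Sum>i\<in>X. nsmult (?c m) (?s i m))"
    by (simp add: nsmult_diff_right nsmult_sum sum_subtractf sum.distrib)
  also have "(\<Sum>m\<in>?K. \<Sum>i\<in>X. nsmult (?c m) (?s i m)) = 0"
    using z by (subst sum.swap) simp
  finally have "nsmult 3 f \<in> I"
    by (simp only: add_0_right) (intro add sum smult nf ts, auto)
  then have "nsmult (1 / 3) (nsmult 3 f) \<in> I" by (rule smult)
  then show ?thesis by simp
qed

text \<open>The two congruent letters are brought into the last two arguments of the form; there
  they may be taken equal, and skew symmetry with halving puts the form into
  \<open>I\<close>.\<close>

lemma skew_word_repeated:
  assumes F: "F = pform \<or> F = qform" and ys: "distinct ys" "x \<in> set ys" "y \<in> set ys" "x \<noteq> y"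
    and xy: "nvar x - nvar y \<in> I"
  shows "skew_word F i ys \<in> I"
proof -
  define zs where "zs = sorted_list_of_set (set ys - {x, y})"
  have zs: "set ys = set (x # y # zs)" "distinct (x # y # zs)" using ys by (auto simp: zs_def)
  have diag: "F a b b \<in> I" for a b using F pform_skew[of a b b] qform_skew[of a b b] by (auto intro: half)
  have "F a b c - F a c c \<in> I" if "b - c \<in> I" for a b c
  proof -
    have "F a b c - F a c c = F a (b - c) c"
      using F by (auto simp: pform_def qform_def nassociator_def nmult_distribs algebra_simps)
    also have "F a d c \<in> I" if "d \<in> I" for d
      using F that
      by (auto simp: pform_def qform_def nassociator_def add diff uminus mult_left mult_right)
    from this[OF that] have "F a (b - c) c \<in> I" .
    finally show ?thesis .
  qed
  from add[OF this[OF xy, of "nvar i"] diag[of "nvar i" "nvar y"]] have "F (nvar i) (nvar x) (nvar y) \<in> I" by simp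
  then have "foldl (\<lambda>w z. w \<cdot> nvar z) (F (nvar i) (nvar x) (nvar y)) zs \<in> I"
    by (induction zs rule: rev_induct) (auto intro: mult_right)
  then have 1: "skew_word F i (x # y # zs) \<in> I" by simp
  let ?e = "koszul_sign (\<lambda>_. 1) ys :: 'a" and ?e' = "koszul_sign (\<lambda>_. 1) (x # y # zs) :: 'a"
  from add[OF skew_word_perm[OF F ys(1) zs(2,1), of i] smult[OF 1, of ?e']]
  have "nsmult ?e (skew_word F i ys) \<in> I" by simp
  from smult[OF this, of ?e] show ?thesis by simp
qed

text \<open>One letter is spent on the place of the square, and among the others two share a class
  by the pigeonhole principle; hence the excess of 2 of the length over the number of
  classes.\<close>

lemma monomial_repeated_mem:
  assumes m: "distinct (letters m)" "3 \<le> length (letters m)"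
    and c: "card (c ` set (letters m)) + 2 \<le> length (letters m)"
    and I: "\<And>x y. c x = c y \<Longrightarrow> nvar x - nvar y \<in> I"
  shows "nmon m \<in> I"
proof -
  have "wterm pq i (remove1 i (letters m)) \<in> I" if i: "i \<in> set (letters m)" for pq i
  proof -
    let ?ys = "remove1 i (letters m)"
    have "card (c ` set ?ys) \<le> card (c ` set (letters m))"
      by (intro card_mono image_mono set_remove1_subset) auto
    also have "\<dots> < length ?ys" using c i by (simp add: length_remove1)
    also have "\<dots> = card (set ?ys)" using m(1) by (intro distinct_card[symmetric]) simp
    finally have "\<not> inj_on c (set ?ys)" by (rule pigeonhole)
    then obtain x y where xy: "x \<in> set ?ys" "y \<in> set ?ys" "x \<noteq> y" "c x = c y"
      unfolding inj_on_def by blast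
    then have "skew_word F i ?ys \<in> I" if "F = pform \<or> F = qform" for F
      using that m I by (intro skew_word_repeated[of F ?ys x y]) auto
    then show ?thesis unfolding wterm_def by (intro add smult) auto
  qed
  then have "normal_form m \<in> I" unfolding normal_form_def by (intro sum)
  from add[OF monomial_normal_form[OF m] this] have "nsmult 3 (nmon m) \<in> I" by simp
  from smult[OF this, of "1 / 3"] show ?thesis by simp
qed

end

section \<open>Kernels of evaluations\<close>

text \<open>Each instance of an identity at polynomials is written as a value in
  \<open>free_alg UNIV\<close>; evaluating it amounts to evaluating the identity in \<open>A\<close>
  at the values of these polynomials.\<close>

lemma nalt_ideal_kernel:
  fixes A :: "('a::field_char_0, 'v, 'm) module_scheme"
  assumes A: "models A nalt2_identities" and b: "\<And>x. b x \<in> carrier A"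
  shows "nalt_ideal {f. eval_poly A b f = \<zero>\<^bsub>A\<^esub>}"
proof -
  have na: "nonassoc_algebra A" using A by (simp add: models_def)
  interpret A: nonassoc_algebra A by fact
  interpret F: nonassoc_algebra "free_alg UNIV :: ('a, 'a npoly) module"
    by (rule nonassoc_algebra_free_alg)
  have eval: "eval_poly A b (eval_poly (free_alg UNIV) c f) = \<zero>\<^bsub>A\<^esub>" if "f \<in> nalt2_identities" for f c
    using A that b
    by (subst eval_poly_substitute[OF na]) (auto simp: models_def satisfies_def free_alg_def)
  have [simp]: "f \<in> carrier (free_alg UNIV)" for f :: "'a npoly"
    by (simp add: free_alg_def)
  have minus: "f \<ominus>\<^bsub>free_alg UNIV\<^esub> g = f - g" for f g :: "'a npoly"
    using F.eval_poly_diff[of "\<lambda>x. if x = 0 then f else g" "nvar 0" "nvar 1"]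
      F.smult_minus_one[of g]
    by (simp add: a_minus_def) (simp add: free_alg_def)
  have free: "mult (free_alg UNIV) = (nmult :: 'a npoly \<Rightarrow> _)" by (simp add: free_alg_def)
  note eval_simps = F.eval_poly_diff F.eval_poly_nmult F.eval_poly_nvar minus free
  show ?thesis
  proof
    fix f g h k :: "'a npoly"
    show "nassociator f f g \<in> {f. eval_poly A b f = \<zero>\<^bsub>A\<^esub>}"
      using eval[of "nassociator (nvar 0) (nvar 0) (nvar 1)" "\<lambda>x. if x = 0 then f else g"]
      by (simp add: nalt2_identities_def Let_def nassociator_def eval_simps)
    show "nassociator f g g \<in> {f. eval_poly A b f = \<zero>\<^bsub>A\<^esub>}"
      using eval[of "nassociator (nvar 0) (nvar 1) (nvar 1)" "\<lambda>x. if x = 0 then f else g"]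
      by (simp add: nalt2_identities_def Let_def nassociator_def eval_simps)
    show "f \<cdot> f \<cdot> f \<in> {f. eval_poly A b f = \<zero>\<^bsub>A\<^esub>}"
      using eval[of "nvar 0 \<cdot> nvar 0 \<cdot> nvar 0" "\<lambda>x. f"]
      by (simp add: nalt2_identities_def Let_def eval_simps)
    show "f \<cdot> g \<cdot> (h \<cdot> k) \<in> {f. eval_poly A b f = \<zero>\<^bsub>A\<^esub>}"
      using eval[of "nvar 0 \<cdot> nvar 1 \<cdot> (nvar 2 \<cdot> nvar 3)"
          "\<lambda>x. if x = 0 then f else if x = 1 then g else if x = 2 then h else k"]
      by (simp add: nalt2_identities_def Let_def eval_simps)
  qed (use b in \<open>auto simp: A.eval_poly_add A.eval_poly_nsmult A.eval_poly_nmult\<close>)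
qed

text \<open>Makes a monomial with repeated variables multilinear, so that the normal form applies;
  the repetitions move into the assignment.\<close>

fun renumber :: "nat \<Rightarrow> nmonom \<Rightarrow> nmonom" where
  "renumber k (Var x) = Var k"
| "renumber k (Mul u v) = Mul (renumber k u) (renumber (k + length (letters u)) v)"

lemma letters_renumber: "letters (renumber k m) = [k..<k + length (letters m)]"
proof (induction m arbitrary: k)
  case (Mul u v)
  have "[k..<k + length (letters u) + length (letters v)]
      = [k..<k + length (letters u)] @ [k + length (letters u)..<k + length (letters u) + length (letters v)]"
    by (rule upt_add_eq_append) simp
  then show ?case using Mul by (simp add: add.assoc)
qed simp

lemma eval_monom_renumber:
  assumes "\<And>j. j < length (letters m) \<Longrightarrow> c (k + j) = a (letters m ! j)"
  shows "eval_monom A c (renumber k m) = eval_monom A a m"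
  using assms
proof (induction m arbitrary: k)
  case (Var x)
  from Var[of 0] show ?case by simp
next
  case (Mul u v)
  have "eval_monom A c (renumber k u) = eval_monom A a u"
    using Mul.prems by (intro Mul.IH(1)) (auto simp: nth_append)
  moreover have "eval_monom A c (renumber (k + length (letters u)) v) = eval_monom A a v"
  proof (rule Mul.IH(2))
    fix j assume "j < length (letters v)"
    then show "c (k + length (letters u) + j) = a (letters v ! j)"
      using Mul.prems[of "length (letters u) + j"] by (simp add: nth_append add.assoc)
  qed
  ultimately show ?case by simp
qed

text \<open>After renumbering, the class of a position is its original letter. Positions of one
  class have equal values, so the difference of their variables lies in the kernel, and there are at
  most \<open>n\<close> classes.\<close>

lemma finitely_generated_nilpotent:
  fixes A :: "('a::field_char_0, 'v, 'm) module_scheme"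
  assumes A: "models A nalt2_identities" and a: "\<And>x. a x \<in> carrier A"
    and m: "set (letters m) \<subseteq> {..<n}" "n + 2 \<le> length (letters m)"
  shows "eval_monom A a m = \<zero>\<^bsub>A\<^esub>"
proof -
  interpret A: nonassoc_algebra A using A by (simp add: models_def)
  obtain x where "x \<in> set (letters m)" using letters_nonempty[of m] by (cases "letters m") auto
  \<comment> \<open>With \<open>n \<ge> 1\<close> the length is at least 3, the least degree that
    has a normal form.\<close>
  then have n: "1 \<le> n" using m(1) by auto
  let ?l = "length (letters m)"
  define c where "c j = (if j < ?l then letters m ! j else 0)" for j
  let ?b = "\<lambda>j. a (c j)"
  interpret nalt_ideal "{f. eval_poly A ?b f = \<zero>\<^bsub>A\<^esub>}" using a by (intro nalt_ideal_kernel A)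
  have letters: "letters (renumber 0 m) = [0..<?l]" by (simp add: letters_renumber)
  have "c ` {0..<?l} \<subseteq> {..<n}" using m(1) nth_mem by (fastforce simp: c_def)
  then have "card (c ` {0..<?l}) \<le> n" using card_mono[of "{..<n}"] by simp
  then have "nmon (renumber 0 m) \<in> {f. eval_poly A ?b f = \<zero>\<^bsub>A\<^esub>}"
    using m(2) n a
    by (intro monomial_repeated_mem[where c = c])
       (simp_all add: letters A.eval_poly_diff a_minus_def A.r_neg)
  then have "eval_monom A ?b (renumber 0 m) = \<zero>\<^bsub>A\<^esub>" using a by simp
  then show ?thesis by (subst (asm) eval_monom_renumber[of m]) (auto simp: c_def)
qed

section \<open>Multilinear polynomials and spanning sets\<close>

text \<open>Generated by rules, so that vanishing extends from \<open>B\<close> to its span by rule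
  induction, without choosing finite combinations.\<close>

inductive_set lin_span :: "('a::field, 'v, 'm) module_scheme \<Rightarrow> 'v set \<Rightarrow> 'v set"
  for A :: "('a::field, 'v, 'm) module_scheme" and B :: "'v set" where
  zero: "\<zero>\<^bsub>A\<^esub> \<in> lin_span A B"
| base: "x \<in> B \<Longrightarrow> x \<in> lin_span A B"
| add: "x \<in> lin_span A B \<Longrightarrow> y \<in> lin_span A B \<Longrightarrow> x \<oplus>\<^bsub>A\<^esub> y \<in> lin_span A B"
| smult: "x \<in> lin_span A B \<Longrightarrow> c \<odot>\<^bsub>A\<^esub> x \<in> lin_span A B"

context nonassoc_algebra
begin

lemma lin_span_closed:
  assumes "B \<subseteq> carrier A" "x \<in> lin_span A B"
  shows "x \<in> carrier A"
  using assms(2) by induction (use assms(1) in auto)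

lemma eval_monom_upd_notin: "x \<notin> set (letters m) \<Longrightarrow> eval_monom A (a(x := b)) m = eval_monom A a m"
  by (induction m) auto

lemma eval_monom_upd_add:
  assumes "distinct (letters m)" "x \<in> set (letters m)"
    and [simp]: "\<And>y. a y \<in> carrier A" "b \<in> carrier A" "c \<in> carrier A"
  shows "eval_monom A (a(x := b \<oplus> c)) m = eval_monom A (a(x := b)) m \<oplus> eval_monom A (a(x := c)) m"
  using assms(1,2)
proof (induction m)
  case (Mul u v)
  have cl: "eval_monom A (a(x := d)) w \<in> carrier A" if "d \<in> carrier A" for d w
    using that by (intro eval_monom_closed) auto
  show ?case
  proof (cases "x \<in> set (letters u)")
    case True
    then have "x \<notin> set (letters v)" using Mul.prems by auto
    then show ?thesis using Mul True by (simp add: eval_monom_upd_notin mult_add_left cl del: fun_upd_apply)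
  next
    case False
    then show ?thesis using Mul by (simp add: eval_monom_upd_notin mult_add_right cl del: fun_upd_apply)
  qed
qed simp

lemma eval_monom_upd_smult:
  assumes "distinct (letters m)" "x \<in> set (letters m)"
    and [simp]: "\<And>y. a y \<in> carrier A" "b \<in> carrier A"
  shows "eval_monom A (a(x := k \<odot> b)) m = k \<odot> eval_monom A (a(x := b)) m"
  using assms(1,2)
proof (induction m)
  case (Mul u v)
  have cl: "eval_monom A (a(x := d)) w \<in> carrier A" if "d \<in> carrier A" for d w
    using that by (intro eval_monom_closed) auto
  show ?case
  proof (cases "x \<in> set (letters u)")
    case True
    then have "x \<notin> set (letters v)" using Mul.prems by auto
    then show ?thesis using Mul True by (simp add: eval_monom_upd_notin mult_smult_left cl del: fun_upd_apply)
  next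
    case False
    then show ?thesis using Mul by (simp add: eval_monom_upd_notin mult_smult_right cl del: fun_upd_apply)
  qed
qed simp

lemma eval_poly_upd_add:
  assumes f: "\<And>m. m \<in> Poly_Mapping.keys f \<Longrightarrow> distinct (letters m) \<and> x \<in> set (letters m)"
    and [simp]: "\<And>y. a y \<in> carrier A" "b \<in> carrier A" "c \<in> carrier A"
  shows "eval_poly A (a(x := b \<oplus> c)) f = eval_poly A (a(x := b)) f \<oplus> eval_poly A (a(x := c)) f"
proof -
  let ?c = "Poly_Mapping.lookup f" and ?e = "\<lambda>d. eval_monom A (a(x := d))"
  have cl: "?e d m \<in> carrier A" if "d \<in> carrier A" for d m
    using that by (intro eval_monom_closed) auto
  have "eval_poly A (a(x := b \<oplus> c)) f = (\<Oplus>m\<in>Poly_Mapping.keys f. ?c m \<odot> ?e b m \<oplus> ?c m \<odot> ?e c m)"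
    unfolding eval_poly_def using f
    by (intro finsum_cong') (simp_all add: cl eval_monom_upd_add smult_add_right del: fun_upd_apply)
  also have "\<dots> = eval_poly A (a(x := b)) f \<oplus> eval_poly A (a(x := c)) f"
    unfolding eval_poly_def by (intro finsum_addf) (simp_all add: cl del: fun_upd_apply)
  finally show ?thesis .
qed

lemma eval_poly_upd_smult:
  assumes f: "\<And>m. m \<in> Poly_Mapping.keys f \<Longrightarrow> distinct (letters m) \<and> x \<in> set (letters m)"
    and [simp]: "\<And>y. a y \<in> carrier A" "b \<in> carrier A"
  shows "eval_poly A (a(x := k \<odot> b)) f = k \<odot> eval_poly A (a(x := b)) f"
proof -
  let ?c = "Poly_Mapping.lookup f" and ?e = "\<lambda>d. eval_monom A (a(x := d))"
  have cl: "?e d m \<in> carrier A" if "d \<in> carrier A" for d m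
    using that by (intro eval_monom_closed) auto
  have "eval_poly A (a(x := k \<odot> b)) f = (\<Oplus>m\<in>Poly_Mapping.keys f. k \<odot> (?c m \<odot> ?e b m))"
    unfolding eval_poly_def using f
    by (intro finsum_cong')
       (simp_all add: cl eval_monom_upd_smult smult_smult mult.commute del: fun_upd_apply)
  also have "\<dots> = k \<odot> eval_poly A (a(x := b)) f"
    unfolding eval_poly_def
    by (intro finsum_smult_ldistr[symmetric]) (simp_all add: cl del: fun_upd_apply)
  finally show ?thesis .
qed

lemma eval_poly_zero_on_span:
  assumes f: "\<And>m. m \<in> Poly_Mapping.keys f \<Longrightarrow> distinct (letters m) \<and> set (letters m) = X"
    and X: "finite X" and B: "B \<subseteq> carrier A" "carrier A \<subseteq> lin_span A B"
    and zero: "\<And>a. (\<And>x. a x \<in> carrier A) \<Longrightarrow> (\<And>x. x \<in> X \<Longrightarrow> a x \<in> B) \<Longrightarrow> eval_poly A a f = \<zero>"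
    and a: "\<And>x. a x \<in> carrier A"
  shows "eval_poly A a f = \<zero>"
proof -
  \<comment> \<open>\<open>Y\<close> collects the variables whose values may be arbitrary; one
    variable at a time is released by linearity.\<close>
  have "eval_poly A a f = \<zero>" if "finite Y" "Y \<subseteq> X" "\<And>x. a x \<in> carrier A" "\<And>x. x \<in> X - Y \<Longrightarrow> a x \<in> B"
    for Y a
    using that
  proof (induction Y arbitrary: a)
    case empty
    then show ?case using zero by auto
  next
    case (insert y Y)
    have fy: "\<And>m. m \<in> Poly_Mapping.keys f \<Longrightarrow> distinct (letters m) \<and> y \<in> set (letters m)"
      using f insert.prems(1) by auto
    have cl: "eval_poly A (a(y := b)) f \<in> carrier A" if "b \<in> carrier A" for b
      using that insert.prems(2) by (intro eval_poly_closed) auto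
    have "eval_poly A (a(y := b)) f = \<zero>" if "b \<in> lin_span A B" for b
      using that
    proof induction
      case zero
      show ?case using eval_poly_upd_smult[OF fy, where f = f and a = a and b = \<zero> and k = 0] insert.prems(2)
        by (simp add: cl del: fun_upd_apply)
    next
      case (base b)
      then show ?case using insert.prems B by (intro insert.IH) auto
    next
      case (add b c)
      then show ?case
        using eval_poly_upd_add[OF fy, where f = f and a = a and b = b and c = c] insert.prems(2) lin_span_closed[OF B(1)]
        by (simp del: fun_upd_apply)
    next
      case (smult b k)
      then show ?case
        using eval_poly_upd_smult[OF fy, where f = f and a = a and b = b and k = k] insert.prems(2) lin_span_closed[OF B(1)]
        by (simp del: fun_upd_apply)
    qed
    from this[of "a y"] show ?case using insert.prems(2) B by auto
  qed
  from this[of X a] show ?thesis using X a by auto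
qed

end

section \<open>Superalgebras and their quotients\<close>

lemma super_satisfiesD:
  "super_satisfies A f \<Longrightarrow> (\<And>x. a x \<in> part A (p x)) \<Longrightarrow> eval_poly A a (superization p f) = \<zero>\<^bsub>A\<^esub>"
  by (simp add: super_satisfies_def)

context superalgebra
begin

lemma part_subset: "part A i \<subseteq> carrier A"
  using submoduleE(1)[OF part_submodule] .

lemma part_carrier [simp]: "x \<in> part A i \<Longrightarrow> x \<in> carrier A"
  using part_subset by auto

lemma part_add [simp]: "x \<in> part A i \<Longrightarrow> y \<in> part A i \<Longrightarrow> x \<oplus> y \<in> part A i"
  using submoduleE(5)[OF part_submodule] .

lemma part_smult [simp]: "x \<in> part A i \<Longrightarrow> c \<odot> x \<in> part A i"
  using submoduleE(4)[OF part_submodule] by simp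

lemma part_zero [simp]: "\<zero> \<in> part A i"
proof -
  obtain x where "x \<in> part A i" using submoduleE(2)[OF part_submodule] by blast
  then show ?thesis using part_smult[of x i 0] by simp
qed

lemma part_uminus [simp]: "x \<in> part A i \<Longrightarrow> \<ominus> x \<in> part A i"
  using submoduleE(3)[OF part_submodule] .

lemma part_finsum:
  assumes "finite S" "\<And>x. x \<in> S \<Longrightarrow> f x \<in> part A i"
  shows "finsum A f S \<in> part A i"
  using assms
proof (induction S)
  case (insert x S)
  then show ?case by (subst finsum_insert) (auto intro: part_carrier)
qed simp

lemma part_unique:
  assumes "y \<in> part A 0" "z \<in> part A 1" "y' \<in> part A 0" "z' \<in> part A 1" "y \<oplus> z = y' \<oplus> z'"
  shows "y = y'" "z = z'"
proof -
  have c: "y \<in> carrier A" "z \<in> carrier A" "y' \<in> carrier A" "z' \<in> carrier A"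
    using assms part_carrier by blast+
  have "y \<oplus> \<ominus> y' = z' \<oplus> \<ominus> z"
  proof -
    have "y \<oplus> \<ominus> y' = (y \<oplus> z) \<oplus> (\<ominus> y' \<oplus> \<ominus> z)" using c by (simp add: a_ac r_neg r_neg1 r_neg2)
    also have "\<dots> = y' \<oplus> (\<ominus> y' \<oplus> (z' \<oplus> \<ominus> z))"
      unfolding assms(5) using c by (simp add: a_ac)
    also have "\<dots> = z' \<oplus> \<ominus> z" using c by (intro r_neg2) auto
    finally show ?thesis .
  qed
  moreover have "y \<oplus> \<ominus> y' \<in> part A 0" "z' \<oplus> \<ominus> z \<in> part A 1"
    using assms by simp_all
  ultimately have "y \<oplus> \<ominus> y' \<in> part A 0 \<inter> part A 1" by simp
  then have "y \<oplus> \<ominus> y' = \<zero>" using part_direct by simp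
  then show "y = y'" using c minus_equality[of y "\<ominus> y'"] by simp
  then show "z = z'" using assms(5) c by simp
qed

lemma graded_ideal_parts:
  assumes "graded_ideal I A" "y \<in> part A 0" "z \<in> part A 1" "y \<oplus> z \<in> I"
  shows "y \<in> I" "z \<in> I"
proof -
  obtain y' z' where "y' \<in> I \<inter> part A 0" "z' \<in> I \<inter> part A 1" "y \<oplus> z = y' \<oplus> z'"
    using assms by (auto simp: graded_ideal_def)
  with part_unique[OF assms(2,3), of y' z'] show "y \<in> I" "z \<in> I" by auto
qed

lemma eval_monom_part:
  "(\<And>x. a x \<in> part A (p x)) \<Longrightarrow> eval_monom A a m \<in> part A (monom_parity p m)"
  by (induction m) (simp_all only: eval_monom.simps monom_parity.simps part_mult)

end

text \<open>Only the directness of the grading can be lost in a homomorphic image, hence the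
  separate hypothesis on the two parts.\<close>

lemma superalgebra_image:
  assumes "superalgebra A" "alg_hom A B h" "carrier B = h ` carrier A" "\<zero>\<^bsub>B\<^esub> = h \<zero>\<^bsub>A\<^esub>"
    and part: "\<And>i. part B i = h ` part A i" "part B 0 \<inter> part B 1 \<subseteq> {\<zero>\<^bsub>B\<^esub>}"
  shows "superalgebra B"
proof -
  interpret A: superalgebra A by fact
  interpret B: nonassoc_algebra B
    by (rule nonassoc_algebra_image) (use assms A.nonassoc_algebra_axioms in auto)
  have hom: "\<And>x y. x \<in> carrier A \<Longrightarrow> y \<in> carrier A \<Longrightarrow> h x \<oplus>\<^bsub>B\<^esub> h y = h (x \<oplus>\<^bsub>A\<^esub> y)"
    "\<And>x y. x \<in> carrier A \<Longrightarrow> y \<in> carrier A \<Longrightarrow> h x \<otimes>\<^bsub>B\<^esub> h y = h (x \<otimes>\<^bsub>A\<^esub> y)"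
    "\<And>c x. x \<in> carrier A \<Longrightarrow> c \<odot>\<^bsub>B\<^esub> h x = h (c \<odot>\<^bsub>A\<^esub> x)"
    using assms(2) by (auto simp: alg_hom_def)
  have cl: "\<And>x. x \<in> carrier A \<Longrightarrow> h x \<in> carrier B" using assms(3) by auto
  have neg: "\<ominus>\<^bsub>B\<^esub> h x = h (\<ominus>\<^bsub>A\<^esub> x)" if "x \<in> carrier A" for x
    using hom(3)[OF that, of "- 1"] that cl by (simp add: A.smult_minus_one B.smult_minus_one)
  show ?thesis
  proof (intro superalgebra.intro superalgebra_axioms.intro B.nonassoc_algebra_axioms)
    fix i show "submodule (part B i) base_ring B"
    proof (rule B.submoduleI)
      show "part B i \<subseteq> carrier B" unfolding part assms(3) using A.part_subset by blast
      show "\<zero>\<^bsub>B\<^esub> \<in> part B i" unfolding part assms(4) by simp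
    qed (use A.part_carrier in \<open>auto simp: part neg hom\<close>)
  next
    fix x assume "x \<in> carrier B"
    then obtain a where a: "a \<in> carrier A" "x = h a" unfolding assms(3) by auto
    then obtain y z where yz: "y \<in> part A 0" "z \<in> part A 1" "a = y \<oplus>\<^bsub>A\<^esub> z"
      using A.part_decomp by blast
    then have "x = h y \<oplus>\<^bsub>B\<^esub> h z" using a hom(1)[of y z] by auto
    then show "\<exists>y\<in>part B 0. \<exists>z\<in>part B 1. x = y \<oplus>\<^bsub>B\<^esub> z" unfolding part using yz by blast
  next
    show "part B 0 \<inter> part B 1 = {\<zero>\<^bsub>B\<^esub>}"
      using part assms(4) A.part_zero by blast
  next
    fix x y i j assume "x \<in> part B i" "y \<in> part B j"
    then obtain a b where "a \<in> part A i" "b \<in> part A j" "x = h a" "y = h b" unfolding part by auto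
    then show "x \<otimes>\<^bsub>B\<^esub> y \<in> part B (i + j)"
      unfolding part using hom(2)[of a b] A.part_mult[of a i b j] by auto
  qed
qed

lemma super_satisfies_image_iff:
  assumes A: "superalgebra A" and B: "superalgebra B" and h: "alg_hom A B h"
    and part: "\<And>i. part B i = h ` part A i"
  shows "super_satisfies B f \<longleftrightarrow> (\<forall>p a. (\<forall>x. a x \<in> part A (p x)) \<longrightarrow>
    h (eval_poly A a (superization p f)) = \<zero>\<^bsub>B\<^esub>)"
proof -
  interpret A: superalgebra A by fact
  interpret B: superalgebra B by fact
  have *: "h (eval_poly A a g) = eval_poly B (\<lambda>x. h (a x)) g" if "\<And>x. a x \<in> part A (p x)" for a p g
    using alg_hom_eval_poly[OF A.nonassoc_algebra_axioms B.nonassoc_algebra_axioms h, of a g]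
      A.part_carrier[OF that] by simp
  show ?thesis
  proof (intro iffI allI impI)
    fix p and a :: "nat \<Rightarrow> _" assume L: "super_satisfies B f" and a: "\<forall>x. a x \<in> part A (p x)"
    have "eval_poly B (\<lambda>x. h (a x)) (superization p f) = \<zero>\<^bsub>B\<^esub>"
      using a by (intro super_satisfiesD[OF L]) (auto simp: part)
    then show "h (eval_poly A a (superization p f)) = \<zero>\<^bsub>B\<^esub>" using *[of a p] a by simp
  next
    assume R: "\<forall>p a. (\<forall>x. a x \<in> part A (p x)) \<longrightarrow> h (eval_poly A a (superization p f)) = \<zero>\<^bsub>B\<^esub>"
    show "super_satisfies B f" unfolding super_satisfies_def
    proof (intro allI impI)
      fix p and b :: "nat \<Rightarrow> _" assume "\<forall>x. b x \<in> part B (p x)"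
      then have "\<forall>x. \<exists>y. y \<in> part A (p x) \<and> b x = h y" by (auto simp: part)
      then obtain a where a: "\<And>x. a x \<in> part A (p x)" "b = (\<lambda>x. h (a x))" by metis
      then show "eval_poly B b (superization p f) = \<zero>\<^bsub>B\<^esub>" using *[of a p "superization p f"] R by simp
    qed
  qed
qed

context superalgebra
begin

lemma alg_hom_quot_superalg: "alg_ideal I A \<Longrightarrow> alg_hom A (quot_superalg A I) (\<lambda>x. I +> x)"
  by (auto simp: alg_hom_def quot_superalg_def rcoset_mult_coset quot_smult_coset set_add_coset
      A_RCOSETS_def')

lemma carrier_quot_superalg: "carrier (quot_superalg A I) = (\<lambda>x. I +> x) ` carrier A"
  by (auto simp: quot_superalg_def A_RCOSETS_def')

lemma superalgebra_quot_superalg: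
  assumes "graded_ideal I A"
  shows "superalgebra (quot_superalg A I)"
proof -
  have I: "alg_ideal I A" using assms by (simp add: graded_ideal_def)
  show ?thesis
  proof (rule superalgebra_image)
    show "alg_hom A (quot_superalg A I) (\<lambda>x. I +> x)" using I by (rule alg_hom_quot_superalg)
    show "carrier (quot_superalg A I) = (\<lambda>x. I +> x) ` carrier A" by (rule carrier_quot_superalg)
    show "\<zero>\<^bsub>quot_superalg A I\<^esub> = I +> \<zero>"
      using I by (simp add: quot_superalg_def alg_ideal_subset)
    show "part (quot_superalg A I) i = (\<lambda>x. I +> x) ` part A i" for i
      by (simp add: quot_superalg_def)
    \<comment> \<open>Gradedness of the ideal enters here: a common coset of \<open>y\<close> and
      \<open>z\<close> puts \<open>y - z\<close> into \<open>I\<close>, and hence its even part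
      \<open>y\<close>.\<close>
    show "part (quot_superalg A I) 0 \<inter> part (quot_superalg A I) 1 \<subseteq> {\<zero>\<^bsub>quot_superalg A I\<^esub>}"
    proof
      fix X assume "X \<in> part (quot_superalg A I) 0 \<inter> part (quot_superalg A I) 1"
      then obtain y z where yz: "y \<in> part A 0" "z \<in> part A 1" "X = I +> y" "X = I +> z"
        by (auto simp: quot_superalg_def)
      have c: "y \<in> carrier A" "z \<in> carrier A" using yz part_carrier by blast+
      have "y \<oplus> \<ominus> z \<in> I" using yz coset_eq_iff[OF I c] by (simp add: a_minus_def)
      then have "y \<in> I" using graded_ideal_parts(1)[OF assms, of y "\<ominus> z"] yz by simp
      then show "X \<in> {\<zero>\<^bsub>quot_superalg A I\<^esub>}"
        using coset_eq_ideal_iff[OF I c(1)] yz by (simp add: quot_superalg_def)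
    qed
  qed (rule superalgebra_axioms)
qed

lemma super_satisfies_quot_iff:
  assumes "graded_ideal I A"
  shows "super_satisfies (quot_superalg A I) f \<longleftrightarrow>
    (\<forall>p a. (\<forall>x. a x \<in> part A (p x)) \<longrightarrow> eval_poly A a (superization p f) \<in> I)"
proof -
  have I: "alg_ideal I A" using assms by (simp add: graded_ideal_def)
  have "eval_poly A a g \<in> carrier A" if "\<And>x. a x \<in> part A (p x)" for a p g
    using part_carrier[OF that] by simp
  then have "I +> eval_poly A a g = I \<longleftrightarrow> eval_poly A a g \<in> I" if "\<forall>x. a x \<in> part A (p x)" for a p g
    using that by (intro coset_eq_ideal_iff[OF I]) blast
  moreover have "part (quot_superalg A I) i = (\<lambda>x. I +> x) ` part A i" for i
    by (simp add: quot_superalg_def)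
  note image = super_satisfies_image_iff[OF superalgebra_axioms superalgebra_quot_superalg[OF assms]
      alg_hom_quot_superalg[OF I] this, of f]
  moreover have "\<zero>\<^bsub>quot_superalg A I\<^esub> = I" by (simp add: quot_superalg_def)
  ultimately show ?thesis by (simp add: image cong: all_cong1)
qed

end

definition superalg_transfer ::
  "('v \<Rightarrow> 'w) \<Rightarrow> ('a::field, 'v, 'm) superalg_scheme \<Rightarrow> ('a, 'w) superalg" where
  "superalg_transfer j A = (let g = inv_into (carrier A) j in
     \<lparr>carrier = j ` carrier A, mult = \<lambda>x y. j (g x \<otimes>\<^bsub>A\<^esub> g y), one = j \<one>\<^bsub>A\<^esub>, zero = j \<zero>\<^bsub>A\<^esub>,
      add = \<lambda>x y. j (g x \<oplus>\<^bsub>A\<^esub> g y), smult = \<lambda>c x. j (c \<odot>\<^bsub>A\<^esub> g x), part = \<lambda>i. j ` part A i\<rparr>)"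

lemma superalg_transfer:
  assumes "superalgebra A" "inj_on j (carrier A)"
  shows "superalgebra (superalg_transfer j A)"
    and "super_satisfies (superalg_transfer j A) f \<longleftrightarrow> super_satisfies A f"
proof -
  let ?B = "superalg_transfer j A"
  interpret A: superalgebra A by fact
  have hom: "alg_hom A ?B j"
    using assms(2) by (auto simp: alg_hom_def superalg_transfer_def Let_def)
  have part: "part ?B i = j ` part A i" for i by (simp add: superalg_transfer_def Let_def)
  show B: "superalgebra ?B"
    using assms(1) hom
  proof (rule superalgebra_image)
    show "part ?B 0 \<inter> part ?B 1 \<subseteq> {\<zero>\<^bsub>?B\<^esub>}"
    proof
      fix x assume "x \<in> part ?B 0 \<inter> part ?B 1"
      then obtain y z where "y \<in> part A 0" "z \<in> part A 1" "x = j y" "x = j z"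
        by (auto simp: part)
      moreover from this have "y = z" using inj_onD[OF assms(2), of y z] by simp
      ultimately have "y \<in> part A 0 \<inter> part A 1" by simp
      then show "x \<in> {\<zero>\<^bsub>?B\<^esub>}"
        using A.part_direct \<open>x = j y\<close> by (simp add: superalg_transfer_def Let_def)
    qed
  qed (auto simp: superalg_transfer_def Let_def)
  have closed: "eval_poly A a g \<in> carrier A" if "\<forall>x. a x \<in> part A (p x)" for a p g
    using that A.part_carrier by (intro A.eval_poly_closed) blast
  have "j (eval_poly A a g) = \<zero>\<^bsub>?B\<^esub> \<longleftrightarrow> eval_poly A a g = \<zero>\<^bsub>A\<^esub>"
    if "\<forall>x. a x \<in> part A (p x)" for a p g
    using inj_on_eq_iff[OF assms(2) closed[OF that] A.zero_closed]
    by (simp add: superalg_transfer_def Let_def)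
  then show "super_satisfies ?B f \<longleftrightarrow> super_satisfies A f"
    unfolding super_satisfies_image_iff[OF assms(1) B hom part]
    unfolding super_satisfies_def by simp
qed

section \<open>Grassmann envelopes\<close>

lemma grassmann_sign_Un_left:
  assumes "finite S" "finite S'" "finite T" "S \<inter> S' = {}"
  shows "grass_sign (S \<union> S') T = grass_sign S T * (grass_sign S' T :: 'a::field)"
proof -
  let ?N = "\<lambda>S. {(s, t). s \<in> S \<and> t \<in> T \<and> t < s}"
  have "?N (S \<union> S') = ?N S \<union> ?N S'" "?N S \<inter> ?N S' = {}" using assms(4) by auto
  moreover have "finite (?N S)" "finite (?N S')"
    using assms by (auto intro: finite_subset[of _ "S \<times> T"] finite_subset[of _ "S' \<times> T"])
  ultimately show ?thesis by (simp add: grass_sign_def card_Un_disjoint power_add)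
qed

lemma grassmann_sign_Un_right:
  assumes "finite S" "finite T" "finite T'" "T \<inter> T' = {}"
  shows "grass_sign S (T \<union> T') = grass_sign S T * (grass_sign S T' :: 'a::field)"
proof -
  let ?N = "\<lambda>T. {(s, t). s \<in> S \<and> t \<in> T \<and> t < s}"
  have "?N (T \<union> T') = ?N T \<union> ?N T'" "?N T \<inter> ?N T' = {}" using assms(4) by auto
  moreover have "finite (?N T)" "finite (?N T')"
    using assms by (auto intro: finite_subset[of _ "S \<times> T"] finite_subset[of _ "S \<times> T'"])
  ultimately show ?thesis by (simp add: grass_sign_def card_Un_disjoint power_add)
qed

lemma grassmann_sign_empty [simp]: "grass_sign {} T = 1" "grass_sign S {} = 1"
  by (simp_all add: grass_sign_def)

lemma of_nat_bit: "(of_nat n :: bit) = of_bool (odd n)"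
  by (induction n) auto

text \<open>Every pair in \<open>S \<times> T\<close> is an inversion for exactly one of the two
  orders, so the numbers of inversions add up to \<open>card S * card T\<close>.\<close>

lemma grassmann_sign_commute:
  assumes "finite S" "finite T" "S \<inter> T = {}"
  shows "grass_sign S T
    = parity_sign (of_nat (card S)) (of_nat (card T)) * (grass_sign T S :: 'a::field)"
proof -
  let ?N = "\<lambda>S T. {(s, t). s \<in> S \<and> t \<in> T \<and> t < s}"
  have fin: "finite (?N S T)" "finite (?N T S)"
    using assms by (auto intro: finite_subset[of _ "S \<times> T"] finite_subset[of _ "T \<times> S"])
  have "S \<times> T = ?N S T \<union> prod.swap ` ?N T S" "?N S T \<inter> prod.swap ` ?N T S = {}"
    using assms(3) by (auto simp: image_iff)
  then have "card S * card T = card (?N S T) + card (?N T S)"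
    using fin card_Un_disjoint[of "?N S T" "prod.swap ` ?N T S"]
    by (simp add: card_cartesian_product[symmetric] card_image)
  then have "(-1) ^ (card S * card T) = grass_sign S T * (grass_sign T S :: 'a)"
    by (simp add: grass_sign_def power_add)
  moreover have "(-1) ^ (card S * card T)
      = (parity_sign (of_nat (card S)) (of_nat (card T)) :: 'a)"
    by (cases "even (card S)"; cases "even (card T)")
       (auto simp: parity_sign_def minus_one_power_iff of_nat_bit)
  moreover have "grass_sign T S * grass_sign T S = (1 :: 'a)"
    by (simp add: grass_sign_def flip: power_add)
  ultimately show ?thesis by (metis mult.assoc mult.right_neutral)
qed

context superalgebra
begin

abbreviation "G \<equiv> grassmann_envelope A"

lemma envelope_simps:
  "\<zero>\<^bsub>G\<^esub> = (\<lambda>S. \<zero>)" "h \<oplus>\<^bsub>G\<^esub> k = (\<lambda>S. h S \<oplus> k S)" "c \<odot>\<^bsub>G\<^esub> h = (\<lambda>S. c \<odot> h S)"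
  "h \<otimes>\<^bsub>G\<^esub> k = (\<lambda>U. if finite U
     then \<Oplus>S\<in>Pow U. grass_sign S (U - S) \<odot> (h S \<otimes> k (U - S)) else \<zero>)"
  by (simp_all add: grassmann_envelope_def)

lemma envelopeD:
  assumes "h \<in> carrier G"
  shows "h S \<in> part A (of_nat (card S))" "infinite S \<Longrightarrow> h S = \<zero>" "finite {S. h S \<noteq> \<zero>}"
    "h S \<in> carrier A"
proof -
  show "h S \<in> part A (of_nat (card S))" using assms by (simp add: grassmann_envelope_def)
  then show "h S \<in> carrier A" by (rule part_carrier)
qed (use assms in \<open>simp_all add: grassmann_envelope_def\<close>)

lemma envelopeI:
  assumes "\<And>S. h S \<in> part A (of_nat (card S))" "\<And>S. infinite S \<Longrightarrow> h S = \<zero>"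
    "finite {S. h S \<noteq> \<zero>}"
  shows "h \<in> carrier G"
  using assms by (simp add: grassmann_envelope_def)

lemma envelope_mult_term:
  assumes "h \<in> carrier G" "k \<in> carrier G" "finite U" "S \<subseteq> U"
  shows "grass_sign S (U - S) \<odot> (h S \<otimes> k (U - S)) \<in> part A (of_nat (card U))"
proof -
  have "card U = card S + card (U - S)"
    using assms(3,4) by (metis card_Diff_subset card_mono finite_subset le_add_diff_inverse)
  moreover have "h S \<otimes> k (U - S) \<in> part A (of_nat (card S) + of_nat (card (U - S)))"
    using assms by (intro part_mult envelopeD)
  ultimately show ?thesis by (metis of_nat_add part_smult)
qed

lemma envelope_mult_closed:
  assumes h: "h \<in> carrier G" and k: "k \<in> carrier G"
  shows "h \<otimes>\<^bsub>G\<^esub> k \<in> carrier G"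
proof (rule envelopeI)
  fix S :: "nat set"
  show "(h \<otimes>\<^bsub>G\<^esub> k) S \<in> part A (of_nat (card S))"
  proof (cases "finite S")
    case True
    then show ?thesis
      unfolding envelope_simps using envelope_mult_term[OF h k True]
      by (simp, intro part_finsum) simp_all
  qed (simp add: envelope_simps)
  show "infinite S \<Longrightarrow> (h \<otimes>\<^bsub>G\<^esub> k) S = \<zero>" by (simp add: envelope_simps)
next
  \<comment> \<open>Supporting sets of a product are unions of supporting sets of the
    factors.\<close>
  let ?D = "(\<lambda>(S, T). S \<union> T) ` ({S. h S \<noteq> \<zero>} \<times> {S. k S \<noteq> \<zero>})"
  have "{S. (h \<otimes>\<^bsub>G\<^esub> k) S \<noteq> \<zero>} \<subseteq> ?D"
  proof
    fix U assume U: "U \<in> {S. (h \<otimes>\<^bsub>G\<^esub> k) S \<noteq> \<zero>}"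
    show "U \<in> ?D"
    proof (rule ccontr)
      assume nD: "U \<notin> ?D"
      have "h S \<otimes> k (U - S) = \<zero>" if "S \<subseteq> U" for S
      proof (cases "h S = \<zero> \<or> k (U - S) = \<zero>")
        case True
        then show ?thesis using envelopeD(4)[OF h] envelopeD(4)[OF k] by auto
      next
        case False
        then have "(\<lambda>(S, T). S \<union> T) (S, U - S) \<in> ?D" by (intro imageI) simp
        moreover have "S \<union> (U - S) = U" using that by auto
        ultimately show ?thesis using nD by simp
      qed
      then have "(h \<otimes>\<^bsub>G\<^esub> k) U = \<zero>"
        by (auto simp: envelope_simps intro!: add.finprod_one_eqI)
      with U show False by simp
    qed
  qed
  moreover have "finite ?D" using envelopeD(3)[OF h] envelopeD(3)[OF k] by simp
  ultimately show "finite {S. (h \<otimes>\<^bsub>G\<^esub> k) S \<noteq> \<zero>}" by (rule finite_subset)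
qed

lemma nonassoc_algebra_envelope: "nonassoc_algebra G"
proof (rule nonassoc_algebraI)
  fix h k assume h: "h \<in> carrier G" and k: "k \<in> carrier G"
  show "h \<otimes>\<^bsub>G\<^esub> k \<in> carrier G" using h k by (rule envelope_mult_closed)
  show "h \<oplus>\<^bsub>G\<^esub> k \<in> carrier G"
  proof (rule envelopeI)
    have "{S. (h \<oplus>\<^bsub>G\<^esub> k) S \<noteq> \<zero>} \<subseteq> {S. h S \<noteq> \<zero>} \<union> {S. k S \<noteq> \<zero>}" by (auto simp: envelope_simps)
    then show "finite {S. (h \<oplus>\<^bsub>G\<^esub> k) S \<noteq> \<zero>}"
      using envelopeD(3)[OF h] envelopeD(3)[OF k] finite_subset by blast
  qed (use envelopeD[OF h] envelopeD[OF k] in \<open>auto simp: envelope_simps\<close>)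
  show "h \<oplus>\<^bsub>G\<^esub> k = k \<oplus>\<^bsub>G\<^esub> h"
    using envelopeD(4)[OF h] envelopeD(4)[OF k] by (auto simp: envelope_simps a_comm)
next
  fix c h assume h: "h \<in> carrier G"
  show "c \<odot>\<^bsub>G\<^esub> h \<in> carrier G"
  proof (rule envelopeI)
    have "{S. (c \<odot>\<^bsub>G\<^esub> h) S \<noteq> \<zero>} \<subseteq> {S. h S \<noteq> \<zero>}" by (auto simp: envelope_simps)
    then show "finite {S. (c \<odot>\<^bsub>G\<^esub> h) S \<noteq> \<zero>}"
      using envelopeD(3)[OF h] finite_subset by blast
  qed (use envelopeD[OF h] in \<open>auto simp: envelope_simps\<close>)
next
  show "\<zero>\<^bsub>G\<^esub> \<in> carrier G" by (rule envelopeI) (auto simp: envelope_simps)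
next
  fix h k l assume h: "h \<in> carrier G" and k: "k \<in> carrier G" and l: "l \<in> carrier G"
  note cl = envelopeD(4)[OF h] envelopeD(4)[OF k] envelopeD(4)[OF l]
  show "(h \<oplus>\<^bsub>G\<^esub> k) \<oplus>\<^bsub>G\<^esub> l = h \<oplus>\<^bsub>G\<^esub> (k \<oplus>\<^bsub>G\<^esub> l)"
    using cl by (auto simp: envelope_simps a_assoc)
  show "(h \<oplus>\<^bsub>G\<^esub> k) \<otimes>\<^bsub>G\<^esub> l = h \<otimes>\<^bsub>G\<^esub> l \<oplus>\<^bsub>G\<^esub> k \<otimes>\<^bsub>G\<^esub> l"
    using cl by (auto simp: envelope_simps fun_eq_iff mult_add_left smult_add_right mult_closed
        intro!: finsum_addf)
  show "h \<otimes>\<^bsub>G\<^esub> (k \<oplus>\<^bsub>G\<^esub> l) = h \<otimes>\<^bsub>G\<^esub> k \<oplus>\<^bsub>G\<^esub> h \<otimes>\<^bsub>G\<^esub> l"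
    using cl by (auto simp: envelope_simps fun_eq_iff mult_add_right smult_add_right mult_closed
        intro!: finsum_addf)
next
  fix c h k assume h: "h \<in> carrier G" and k: "k \<in> carrier G"
  note cl = envelopeD(4)[OF h] envelopeD(4)[OF k]
  have *: "c \<odot> (\<Oplus>S\<in>Pow U. grass_sign S (U - S) \<odot> (h S \<otimes> k (U - S)))
      = (\<Oplus>S\<in>Pow U. c \<odot> (grass_sign S (U - S) \<odot> (h S \<otimes> k (U - S))))" if "finite U" for U
    using that cl by (intro finsum_smult_ldistr) (auto simp: mult_closed)
  show "(c \<odot>\<^bsub>G\<^esub> h) \<otimes>\<^bsub>G\<^esub> k = c \<odot>\<^bsub>G\<^esub> (h \<otimes>\<^bsub>G\<^esub> k)"
    using cl by (auto simp: envelope_simps fun_eq_iff * mult_closed mult_smult_left smult_smult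
        mult.commute intro!: finsum_cong')
  show "h \<otimes>\<^bsub>G\<^esub> (c \<odot>\<^bsub>G\<^esub> k) = c \<odot>\<^bsub>G\<^esub> (h \<otimes>\<^bsub>G\<^esub> k)"
    using cl by (auto simp: envelope_simps fun_eq_iff * mult_closed mult_smult_right smult_smult
        mult.commute intro!: finsum_cong')
qed (auto simp: envelope_simps fun_eq_iff smult_add_left smult_add_right smult_smult
    envelopeD(4))

text \<open>Represents the elementary tensor \<open>e_S \<otimes> b\<close>.\<close>

definition homog :: "nat set \<Rightarrow> 'v \<Rightarrow> nat set \<Rightarrow> 'v" where
  "homog S b = (\<lambda>U. if U = S then b else \<zero>)"

lemma homog_closed [simp]:
  "finite S \<Longrightarrow> b \<in> part A (of_nat (card S)) \<Longrightarrow> homog S b \<in> carrier G"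
  by (rule envelopeI) (auto simp: homog_def)

lemma homog_mult:
  assumes S: "finite S" "b \<in> carrier A" and T: "finite T" "c \<in> carrier A"
  shows "homog S b \<otimes>\<^bsub>G\<^esub> homog T c
    = (if S \<inter> T = {} then homog (S \<union> T) (grass_sign S T \<odot> (b \<otimes> c)) else \<zero>\<^bsub>G\<^esub>)"
proof
  fix U
  show "(homog S b \<otimes>\<^bsub>G\<^esub> homog T c) U
    = (if S \<inter> T = {} then homog (S \<union> T) (grass_sign S T \<odot> (b \<otimes> c)) else \<zero>\<^bsub>G\<^esub>) U"
  proof (cases "finite U \<and> S \<subseteq> U")
    case True
    have "(homog S b \<otimes>\<^bsub>G\<^esub> homog T c) U
        = (\<Oplus>R\<in>Pow U. if S = R then grass_sign R (U - R) \<odot> (b \<otimes> homog T c (U - R)) else \<zero>)"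
      using True assms unfolding envelope_simps
      by (simp, intro finsum_cong') (auto simp: homog_def mult_closed)
    also have "\<dots> = grass_sign S (U - S) \<odot> (b \<otimes> homog T c (U - S))"
      using True assms by (intro finsum_singleton) (auto simp: homog_def mult_closed)
    finally show ?thesis
      using True assms by (auto simp: homog_def envelope_simps)
  next
    case False
    have "homog S b R \<otimes> homog T c (U - R) = \<zero>" if "finite U" "R \<subseteq> U" for R
      using that False assms by (auto simp: homog_def)
    then have "(homog S b \<otimes>\<^bsub>G\<^esub> homog T c) U = \<zero>"
      unfolding envelope_simps by (auto intro!: add.finprod_one_eqI)
    then show ?thesis using False assms by (auto simp: homog_def envelope_simps)
  qed
qed

lemma envelope_span: "carrier G \<subseteq> lin_span G {homog S b | S b. finite S \<and> b \<in> part A (of_nat (card S))}"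
proof
  fix h assume "h \<in> carrier G"
  then show "h \<in> lin_span G {homog S b | S b. finite S \<and> b \<in> part A (of_nat (card S))}"
  proof (induction "card {S. h S \<noteq> \<zero>}" arbitrary: h)
    case 0
    then have "h = \<zero>\<^bsub>G\<^esub>" using envelopeD(3)[OF 0(2)] by (auto simp: envelope_simps)
    then show ?case by (simp add: lin_span.zero)
  next
    case (Suc n)
    note h = envelopeD[OF Suc.prems]
    obtain S where S: "h S \<noteq> \<zero>" using Suc.hyps(2)
      by (cases "{S. h S \<noteq> \<zero>} = {}") auto
    let ?k = "h(S := \<zero>)"
    have eq: "{T. ?k T \<noteq> \<zero>} = {T. h T \<noteq> \<zero>} - {S}" by auto
    have k: "?k \<in> carrier G"
    proof (rule envelopeI)
      show "finite {T. ?k T \<noteq> \<zero>}" unfolding eq using h(3) by simp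
    qed (use h in auto)
    have "n = card {T. ?k T \<noteq> \<zero>}" unfolding eq using Suc.hyps(2) S h(3) by simp
    then have "?k \<in> lin_span G {homog S b | S b. finite S \<and> b \<in> part A (of_nat (card S))}"
      using k by (rule Suc.hyps(1))
    moreover have "homog S (h S) \<in> lin_span G {homog S b | S b. finite S \<and> b \<in> part A (of_nat (card S))}"
      using S h by (intro lin_span.base) blast
    ultimately have "homog S (h S) \<oplus>\<^bsub>G\<^esub> ?k
        \<in> lin_span G {homog S b | S b. finite S \<and> b \<in> part A (of_nat (card S))}"
      by (intro lin_span.add)
    moreover have "homog S (h S) \<oplus>\<^bsub>G\<^esub> ?k = h"
      using h(4) by (auto simp: homog_def envelope_simps)
    ultimately show ?case by (simp only:)
  qed
qed

text \<open>For pairwise disjoint sets, this is the sign by which the product of the Grassmann words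
  \<open>e_(S x)\<close>, taken along the list, differs from the basis word of the union.\<close>

fun word_sign :: "(nat \<Rightarrow> nat set) \<Rightarrow> nat list \<Rightarrow> 'a" where
  "word_sign S [] = 1"
| "word_sign S (x # xs) = grass_sign (S x) (\<Union>y\<in>set xs. S y) * word_sign S xs"

lemma word_sign_append:
  assumes "\<And>x. finite (S x)" "distinct (xs @ ys)"
    "\<And>x y. x \<in> set (xs @ ys) \<Longrightarrow> y \<in> set (xs @ ys) \<Longrightarrow> x \<noteq> y \<Longrightarrow> S x \<inter> S y = {}"
  shows "word_sign S (xs @ ys)
    = grass_sign (\<Union>x\<in>set xs. S x) (\<Union>y\<in>set ys. S y) * (word_sign S xs * word_sign S ys)"
  using assms(2,3)
proof (induction xs)
  case (Cons x xs)
  have IH: "word_sign S (xs @ ys)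
    = grass_sign (\<Union>x\<in>set xs. S x) (\<Union>y\<in>set ys. S y) * (word_sign S xs * word_sign S ys)"
    using Cons.prems by (intro Cons.IH) auto
  have "grass_sign (S x) ((\<Union>y\<in>set xs. S y) \<union> (\<Union>y\<in>set ys. S y))
      = grass_sign (S x) (\<Union>y\<in>set xs. S y) * (grass_sign (S x) (\<Union>y\<in>set ys. S y) :: 'a)"
    using assms(1) Cons.prems by (intro grassmann_sign_Un_right) (auto simp: disjoint_iff)
  moreover have "grass_sign (S x \<union> (\<Union>y\<in>set xs. S y)) (\<Union>y\<in>set ys. S y)
      = grass_sign (S x) (\<Union>y\<in>set ys. S y) * (grass_sign (\<Union>y\<in>set xs. S y) (\<Union>y\<in>set ys. S y) :: 'a)"
    using assms(1) Cons.prems by (intro grassmann_sign_Un_left) (auto simp: disjoint_iff)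
  ultimately show ?case by (simp add: IH UN_Un mult_ac)
qed simp

lemma word_sign_square:
  "word_sign S w * word_sign S w = 1"
proof (induction w)
  case (Cons x xs)
  have "grass_sign (S x) T * grass_sign (S x) T = (1 :: 'a)" for T
    by (simp add: grass_sign_def flip: power_add)
  then show ?case using Cons by (simp add: mult_ac)
qed simp

text \<open>Disjoint Grassmann words multiply to a signed basis word, while a shared generator makes
  the product zero.\<close>

lemma eval_monom_homog:
  assumes S: "\<And>x. finite (S x)" and b: "\<And>x. b x \<in> part A (of_nat (card (S x)))"
    and "distinct (letters m)"
  shows "eval_monom G (\<lambda>x. homog (S x) (b x)) m =
    (if \<forall>x\<in>set (letters m). \<forall>y\<in>set (letters m). x \<noteq> y \<longrightarrow> S x \<inter> S y = {}
     then homog (\<Union>x\<in>set (letters m). S x) (word_sign S (letters m) \<odot> eval_monom A b m)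
     else \<zero>\<^bsub>G\<^esub>)"
  using assms(3)
proof (induction m)
  case (Var x)
  then show ?case using part_carrier[OF b] by simp
next
  case (Mul u v)
  interpret G: nonassoc_algebra G by (rule nonassoc_algebra_envelope)
  let ?a = "\<lambda>x. homog (S x) (b x)"
  let ?dj = "\<lambda>X. \<forall>x\<in>X. \<forall>y\<in>X. x \<noteq> y \<longrightarrow> S x \<inter> S y = {}"
  let ?X = "set (letters u)" and ?Y = "set (letters v)"
  have cl: "eval_monom A b w \<in> carrier A" "eval_monom G ?a w \<in> carrier G" for w
    using part_carrier[OF b] b S by auto
  have dist: "distinct (letters u)" "distinct (letters v)" "?X \<inter> ?Y = {}" using Mul.prems by auto
  show ?case
  proof (cases "?dj ?X \<and> ?dj ?Y")
    case True
    then have "eval_monom G ?a (Mul u v)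
      = homog (\<Union>x\<in>?X. S x) (word_sign S (letters u) \<odot> eval_monom A b u)
        \<otimes>\<^bsub>G\<^esub> homog (\<Union>x\<in>?Y. S x) (word_sign S (letters v) \<odot> eval_monom A b v)"
      using Mul.IH dist by simp
    also have "\<dots> = (if (\<Union>x\<in>?X. S x) \<inter> (\<Union>x\<in>?Y. S x) = {}
        then homog ((\<Union>x\<in>?X. S x) \<union> (\<Union>x\<in>?Y. S x)) (grass_sign (\<Union>x\<in>?X. S x) (\<Union>x\<in>?Y. S x) \<odot>
          ((word_sign S (letters u) \<odot> eval_monom A b u) \<otimes> (word_sign S (letters v) \<odot> eval_monom A b v)))
        else \<zero>\<^bsub>G\<^esub>)"
      using S cl by (intro homog_mult) auto
    finally have *: "eval_monom G ?a (Mul u v) = \<dots>" .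
    have iff: "(\<Union>x\<in>?X. S x) \<inter> (\<Union>x\<in>?Y. S x) = {} \<longleftrightarrow> ?dj (set (letters (Mul u v)))"
    proof
      assume L: "(\<Union>x\<in>?X. S x) \<inter> (\<Union>x\<in>?Y. S x) = {}"
      show "?dj (set (letters (Mul u v)))"
      proof (intro ballI impI)
        fix x y assume xy: "x \<in> set (letters (Mul u v))" "y \<in> set (letters (Mul u v))" "x \<noteq> y"
        then consider "x \<in> ?X" "y \<in> ?X" | "x \<in> ?Y" "y \<in> ?Y" | "x \<in> ?X" "y \<in> ?Y"
          | "y \<in> ?X" "x \<in> ?Y" by auto
        then show "S x \<inter> S y = {}" using True xy(3) L by cases blast+
      qed
    next
      assume R: "?dj (set (letters (Mul u v)))"
      have "S x \<inter> S y = {}" if "x \<in> ?X" "y \<in> ?Y" for x y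
      proof -
        have "x \<noteq> y" using that dist(3) by blast
        then show ?thesis using R that by simp
      qed
      then show "(\<Union>x\<in>?X. S x) \<inter> (\<Union>x\<in>?Y. S x) = {}" by blast
    qed
    show ?thesis
    proof (cases "?dj (set (letters (Mul u v)))")
      case dj: True
      have "word_sign S (letters u @ letters v) = grass_sign (\<Union>x\<in>?X. S x) (\<Union>x\<in>?Y. S x)
          * (word_sign S (letters u) * word_sign S (letters v))"
        using Mul.prems dj S by (intro word_sign_append) auto
      then show ?thesis
        unfolding * if_P[OF dj] if_P[OF iff[THEN iffD2, OF dj]]
        using cl by (simp add: mult_smult_left mult_smult_right smult_smult mult_closed UN_Un mult_ac)
    next
      case False
      then show ?thesis unfolding * if_not_P[OF False] using iff by (subst if_not_P) auto
    qed
  next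
    case False
    then have ndj: "\<not> ?dj (set (letters (Mul u v)))" by auto
    have "eval_monom G ?a u = \<zero>\<^bsub>G\<^esub> \<or> eval_monom G ?a v = \<zero>\<^bsub>G\<^esub>"
    proof (cases "?dj ?X")
      case True
      with False have "\<not> ?dj ?Y" by blast
      from Mul.IH(2)[OF dist(2), unfolded if_not_P[OF this]] show ?thesis ..
    next
      case False
      from Mul.IH(1)[OF dist(1), unfolded if_not_P[OF this]] show ?thesis ..
    qed
    then have "eval_monom G ?a (Mul u v) = \<zero>\<^bsub>G\<^esub>"
      using cl(2)[of u] cl(2)[of v] by auto
    then show ?thesis unfolding if_not_P[OF ndj] .
  qed
qed

text \<open>Exchanging two adjacent letters multiplies both signs by the same parity sign, so their
  product depends only on the set of letters. This turns Grassmann signs into those of the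
  superization.\<close>

lemma word_sign_koszul_sign:
  assumes S: "\<And>x. finite (S x)"
    and dj: "\<And>x y. x \<in> X \<Longrightarrow> y \<in> X \<Longrightarrow> x \<noteq> y \<Longrightarrow> S x \<inter> S y = {}"
    and w: "distinct w" "set w = X" "distinct w'" "set w' = X"
  defines "k \<equiv> koszul_sign (\<lambda>x. of_nat (card (S x)))"
  shows "word_sign S w * k w = word_sign S w' * k w'"
proof (rule adjacent_swaps[where R = "(=)" and S = X and G = "\<lambda>w. word_sign S w * k w"])
  fix xs x y ys assume d: "distinct (xs @ x # y # ys)" and X: "set (xs @ x # y # ys) = X"
  let ?U = "\<Union>z\<in>set ys. S z" and ?e = "parity_sign (of_nat (card (S x))) (of_nat (card (S y))) :: 'a"
  have sgn: "grass_sign (S x) (S y) = ?e * grass_sign (S y) (S x)"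
    using S dj[of x y] d X by (intro grassmann_sign_commute) auto
  have djU: "S x \<inter> S y = {}" "S x \<inter> ?U = {}" "S y \<inter> ?U = {}"
    using dj d X by (auto simp: disjoint_iff)
  have "word_sign S (x # y # ys) = ?e * word_sign S (y # x # ys)"
    using S djU sgn by (simp add: grassmann_sign_Un_right Int_commute mult_ac)
  then have "word_sign S (xs @ x # y # ys) = ?e * word_sign S (xs @ y # x # ys)"
    by (induction xs) (simp_all add: insert_commute mult_ac Un_left_commute)
  moreover have "k (xs @ x # y # ys) = ?e * k (xs @ y # x # ys)"
    unfolding k_def using d by (intro koszul_sign_swap) auto
  ultimately show "word_sign S (xs @ x # y # ys) * k (xs @ x # y # ys)
      = word_sign S (xs @ y # x # ys) * k (xs @ y # x # ys)"
    by (simp add: mult_ac)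
qed (use w in auto)

end

lemma lookup_superization: "Poly_Mapping.lookup (superization p f) m
    = koszul_sign p (letters m) * Poly_Mapping.lookup f m"
  by (simp add: superization_def lookup_mapp when_def in_keys_iff)

context superalgebra
begin

lemma finsum_envelope:
  assumes "finite K" "\<And>m. m \<in> K \<Longrightarrow> F m \<in> carrier G"
  shows "finsum G F K = (\<lambda>U. \<Oplus>m\<in>K. F m U)"
  using assms
proof (induction K)
  interpret G: nonassoc_algebra G by (rule nonassoc_algebra_envelope)
  case empty
  show ?case by (simp add: envelope_simps)
next
  interpret G: nonassoc_algebra G by (rule nonassoc_algebra_envelope)
  case (insert m K)
  then have "F m' U \<in> carrier A" if "m' \<in> insert m K" for m' U using that envelopeD(4) by blast
  then show ?case using insert
    by (subst G.finsum_insert) (auto simp: envelope_simps finsum_insert)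
qed

lemma eval_poly_superization:
  assumes "\<And>x. a x \<in> carrier A"
  shows "eval_poly A a (superization p f) = (\<Oplus>m\<in>Poly_Mapping.keys f.
    (koszul_sign p (letters m) * Poly_Mapping.lookup f m) \<odot> eval_monom A a m)"
proof -
  have "eval_poly A a (superization p f) = (\<Oplus>m\<in>Poly_Mapping.keys f.
      Poly_Mapping.lookup (superization p f) m \<odot> eval_monom A a m)"
    using assms by (intro eval_poly_eq_finsum) (auto simp: in_keys_iff lookup_superization)
  then show ?thesis by (simp add: lookup_superization)
qed

text \<open>By the invariance just shown, one sign \<open>c\<close> relates \<open>word_sign\<close>
  and the Koszul sign for all monomials at once and can be taken out of the sum.\<close>

lemma eval_poly_homog:
  assumes S: "\<And>x. finite (S x)" and b: "\<And>x. b x \<in> part A (of_nat (card (S x)))"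
    and f: "\<And>m. m \<in> Poly_Mapping.keys f \<Longrightarrow> distinct (letters m) \<and> set (letters m) = X"
    and X: "finite X" and dj: "\<And>x y. x \<in> X \<Longrightarrow> y \<in> X \<Longrightarrow> x \<noteq> y \<Longrightarrow> S x \<inter> S y = {}"
  shows "\<exists>c. c * c = 1 \<and> eval_poly G (\<lambda>x. homog (S x) (b x)) f
    = homog (\<Union>x\<in>X. S x) (c \<odot> eval_poly A b (superization (\<lambda>x. of_nat (card (S x))) f))"
proof -
  interpret G: nonassoc_algebra G by (rule nonassoc_algebra_envelope)
  let ?a = "\<lambda>x. homog (S x) (b x)" and ?k = "koszul_sign (\<lambda>x. of_nat (card (S x))) :: _ \<Rightarrow> 'a"
  let ?K = "Poly_Mapping.keys f" and ?c = "Poly_Mapping.lookup f"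
  define w where "w = sorted_list_of_set X"
  have w: "distinct w" "set w = X" using X by (simp_all add: w_def)
  define c where "c = word_sign S w * ?k w"
  have bc: "\<And>x. b x \<in> carrier A" using part_carrier[OF b] .
  have c: "c * c = 1"
  proof -
    have "c * c = (word_sign S w * word_sign S w) * (?k w * ?k w)" by (simp add: c_def mult_ac)
    then show ?thesis by (simp add: word_sign_square)
  qed
  have sgn: "word_sign S (letters m) = c * ?k (letters m)" if "m \<in> ?K" for m
  proof -
    have "word_sign S (letters m) * ?k (letters m) = c"
      unfolding c_def using f[OF that] w dj S by (intro word_sign_koszul_sign) auto
    then have "c * ?k (letters m) = (word_sign S (letters m) * ?k (letters m)) * ?k (letters m)"
      by simp
    also have "\<dots> = word_sign S (letters m) * (?k (letters m) * ?k (letters m))"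
      by (rule mult.assoc)
    finally show ?thesis by simp
  qed
  have m: "eval_monom G ?a m = homog (\<Union>x\<in>X. S x) ((c * ?k (letters m)) \<odot> eval_monom A b m)"
    if "m \<in> ?K" for m
  proof -
    have "eval_monom G ?a m = homog (\<Union>x\<in>X. S x) (word_sign S (letters m) \<odot> eval_monom A b m)"
      using f[OF that] dj by (subst eval_monom_homog[OF S b]) auto
    then show ?thesis by (simp add: sgn[OF that])
  qed
  have mU: "(?c m \<odot>\<^bsub>G\<^esub> eval_monom G ?a m) U = (if U = (\<Union>x\<in>X. S x)
      then c \<odot> ((?k (letters m) * ?c m) \<odot> eval_monom A b m) else \<zero>)" if "m \<in> ?K" for m U
    unfolding m[OF that] envelope_simps unfolding homog_def using bc by (simp add: smult_smult mult_ac)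
  have "eval_poly G ?a f = (\<lambda>U. \<Oplus>m\<in>?K. (?c m \<odot>\<^bsub>G\<^esub> eval_monom G ?a m) U)"
    unfolding eval_poly_def using S b by (intro finsum_envelope) auto
  also have "\<dots> = homog (\<Union>x\<in>X. S x) (\<Oplus>m\<in>?K. c \<odot> ((?k (letters m) * ?c m) \<odot> eval_monom A b m))"
  proof
    fix U
    show "(\<Oplus>m\<in>?K. (?c m \<odot>\<^bsub>G\<^esub> eval_monom G ?a m) U)
      = homog (\<Union>x\<in>X. S x) (\<Oplus>m\<in>?K. c \<odot> ((?k (letters m) * ?c m) \<odot> eval_monom A b m)) U"
    proof (cases "U = (\<Union>x\<in>X. S x)")
      case True
      have "(\<Oplus>m\<in>?K. (?c m \<odot>\<^bsub>G\<^esub> eval_monom G ?a m) U)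
          = (\<Oplus>m\<in>?K. c \<odot> ((?k (letters m) * ?c m) \<odot> eval_monom A b m))"
        unfolding True using bc mU by (intro finsum_cong') auto
      then show ?thesis by (simp add: homog_def True)
    next
      case False
      have "(\<Oplus>m\<in>?K. (?c m \<odot>\<^bsub>G\<^esub> eval_monom G ?a m) U) = \<zero>"
        using mU False by (intro add.finprod_one_eqI) simp
      then show ?thesis by (simp add: homog_def False)
    qed
  qed
  also have "(\<Oplus>m\<in>?K. c \<odot> ((?k (letters m) * ?c m) \<odot> eval_monom A b m))
      = c \<odot> eval_poly A b (superization (\<lambda>x. of_nat (card (S x))) f)"
    unfolding eval_poly_superization[OF bc]
    using bc by (intro finsum_smult_ldistr[symmetric]) auto
  finally show ?thesis using c by blast
qed

text \<open>By multilinearity only elementary tensors matter. If their Grassmann words are disjoint,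
  the value is a signed value of the superization, otherwise it is zero.\<close>

lemma satisfies_envelope_iff:
  assumes "multilinear f"
  shows "satisfies G f \<longleftrightarrow> super_satisfies A f"
proof -
  interpret G: nonassoc_algebra G by (rule nonassoc_algebra_envelope)
  obtain X where f: "\<And>m. m \<in> Poly_Mapping.keys f \<Longrightarrow> distinct (letters m) \<and> set (letters m) = X"
    and X: "finite X"
  \<comment> \<open>The zero polynomial is multilinear with respect to every set of variables, even
    an infinite one, so a finite set is chosen for it.\<close>
  proof (cases "Poly_Mapping.keys f = {}")
    case True
    then show ?thesis using that[of "{}"] by simp
  next
    case False
    then obtain m where m: "m \<in> Poly_Mapping.keys f" by blast
    obtain X where "\<forall>m\<in>Poly_Mapping.keys f. distinct (letters m) \<and> set (letters m) = X"
      using assms by (auto simp: multilinear_def)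
    then show ?thesis using that[of X] m by (metis List.finite_set)
  qed
  have cancel: "y = \<zero>" if "c * c = 1" "c \<odot> y = \<zero>" "y \<in> carrier A" for c y
    using smult_smult[OF that(3), of c c] that by simp
  show ?thesis
  proof
    assume L: "satisfies G f"
    show "super_satisfies A f" unfolding super_satisfies_def
    proof (intro allI impI)
      fix p and a :: "nat \<Rightarrow> _" assume a: "\<forall>x. a x \<in> part A (p x)"
      \<comment> \<open>A separate Grassmann generator for each odd variable and the empty word for
        each even one: the sets are disjoint and have the prescribed parities.\<close>
      define S where "S x = (if p x = 1 then {x} else {})" for x
      have p: "of_nat (card (S x)) = p x" for x
        by (cases "p x = 1") (auto simp: S_def)
      have "\<exists>c. c * c = 1 \<and> eval_poly G (\<lambda>x. homog (S x) (a x)) f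
          = homog (\<Union>x\<in>X. S x) (c \<odot> eval_poly A a (superization (\<lambda>x. of_nat (card (S x))) f))"
        using a f X by (intro eval_poly_homog) (auto simp: p, auto simp: S_def split: if_splits)
      then obtain c where c: "c * c = 1" "eval_poly G (\<lambda>x. homog (S x) (a x)) f
          = homog (\<Union>x\<in>X. S x) (c \<odot> eval_poly A a (superization p f))" by (auto simp: p)
      have "homog (S x) (a x) \<in> carrier G" for x
        using a by (intro homog_closed) (simp_all add: p, simp add: S_def)
      then have "eval_poly G (\<lambda>x. homog (S x) (a x)) f = \<zero>\<^bsub>G\<^esub>"
        using L by (simp add: satisfies_def)
      then have "homog (\<Union>x\<in>X. S x) (c \<odot> eval_poly A a (superization p f)) (\<Union>x\<in>X. S x) = \<zero>"
        unfolding c(2)[symmetric] by (simp add: envelope_simps)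
      then have cz: "c \<odot> eval_poly A a (superization p f) = \<zero>" by (simp add: homog_def)
      have "\<And>x. a x \<in> carrier A" using a part_carrier by blast
      then have "eval_poly A a (superization p f) \<in> carrier A" by (rule eval_poly_closed)
      then show "eval_poly A a (superization p f) = \<zero>" by (rule cancel[OF c(1) cz])
    qed
  next
    assume R: "super_satisfies A f"
    let ?B = "{homog S b | S b. finite S \<and> b \<in> part A (of_nat (card S))}"
    have on_B: "eval_poly G a f = \<zero>\<^bsub>G\<^esub>"
      if a: "\<And>x. a x \<in> carrier G" and aB: "\<And>x. x \<in> X \<Longrightarrow> a x \<in> ?B" for a
    proof -
      have "\<forall>x. \<exists>Sb. finite (fst Sb) \<and> snd Sb \<in> part A (of_nat (card (fst Sb))) \<and>
          (x \<in> X \<longrightarrow> a x = homog (fst Sb) (snd Sb))"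
      proof
        fix x
        show "\<exists>Sb. finite (fst Sb) \<and> snd Sb \<in> part A (of_nat (card (fst Sb))) \<and>
          (x \<in> X \<longrightarrow> a x = homog (fst Sb) (snd Sb))"
        proof (cases "x \<in> X")
          case True
          then obtain S b where "a x = homog S b" "finite S" "b \<in> part A (of_nat (card S))"
            using aB by blast
          then show ?thesis by (intro exI[of _ "(S, b)"]) simp
        next
          case False
          then show ?thesis by (intro exI[of _ "({}, \<zero>)"]) simp
        qed
      qed
      then obtain Sb where Sb: "\<And>x. finite (fst (Sb x))"
        "\<And>x. snd (Sb x) \<in> part A (of_nat (card (fst (Sb x))))"
        "\<And>x. x \<in> X \<Longrightarrow> a x = homog (fst (Sb x)) (snd (Sb x))" by metis
      define S b where "S x = fst (Sb x)" "b x = snd (Sb x)" for x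
      have S: "\<And>x. finite (S x)" and b: "\<And>x. b x \<in> part A (of_nat (card (S x)))"
        and ab: "\<And>x. x \<in> X \<Longrightarrow> a x = homog (S x) (b x)"
        using Sb by (simp_all add: S_b_def)
      have eq: "eval_poly G a f = eval_poly G (\<lambda>x. homog (S x) (b x)) f"
        using f ab a S b by (intro G.eval_poly_cong) auto
      show ?thesis
      proof (cases "\<forall>x\<in>X. \<forall>y\<in>X. x \<noteq> y \<longrightarrow> S x \<inter> S y = {}")
        case True
        have "\<exists>c. c * c = 1 \<and> eval_poly G (\<lambda>x. homog (S x) (b x)) f
            = homog (\<Union>x\<in>X. S x) (c \<odot> eval_poly A b (superization (\<lambda>x. of_nat (card (S x))) f))"
        proof (rule eval_poly_homog[OF S b f X])
          fix x y assume "x \<in> X" "y \<in> X" "x \<noteq> y"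
          with True show "S x \<inter> S y = {}" by blast
        qed
        then obtain c where "eval_poly G (\<lambda>x. homog (S x) (b x)) f
            = homog (\<Union>x\<in>X. S x) (c \<odot> eval_poly A b (superization (\<lambda>x. of_nat (card (S x))) f))"
          by (elim exE conjE)
        moreover have "eval_poly A b (superization (\<lambda>x. of_nat (card (S x))) f) = \<zero>"
          using b by (intro super_satisfiesD[OF R])
        ultimately show ?thesis by (simp add: eq homog_def envelope_simps)
      next
        case False
        have "eval_monom G (\<lambda>x. homog (S x) (b x)) m = \<zero>\<^bsub>G\<^esub>" if "m \<in> Poly_Mapping.keys f" for m
        proof -
          have m: "distinct (letters m)" "set (letters m) = X" using f[OF that] by auto
          show ?thesis
            using eval_monom_homog[where S = S and b = b, OF S b m(1)]
            unfolding m(2) if_not_P[OF False] .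
        qed
        then have "eval_poly G (\<lambda>x. homog (S x) (b x)) f = \<zero>\<^bsub>G\<^esub>"
          unfolding eval_poly_def by (intro G.add.finprod_one_eqI) simp
        with eq show ?thesis by (rule trans)
      qed
    qed
    have sub: "?B \<subseteq> carrier G" using homog_closed by blast
    show "satisfies G f"
      unfolding satisfies_def
    proof (intro allI impI)
      fix a :: "nat \<Rightarrow> _" assume "\<forall>x. a x \<in> carrier G"
      then show "eval_poly G a f = \<zero>\<^bsub>G\<^esub>"
        by (intro G.eval_poly_zero_on_span[OF f X sub envelope_span on_B]) auto
    qed
  qed
qed

end

section \<open>Linearized identities\<close>

text \<open>The linearized defining identities. Superidentities are tied to the envelope for
  multilinear polynomials only, so the variety has to be presented by such.\<close>

definition nalt2_linear :: "'a::field npoly set" where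
  "nalt2_linear =
     {nassociator (nvar 0) (nvar 1) (nvar 2) + nassociator (nvar 1) (nvar 0) (nvar 2),
      nassociator (nvar 0) (nvar 1) (nvar 2) + nassociator (nvar 0) (nvar 2) (nvar 1),
      nvar 0 \<cdot> nvar 1 \<cdot> (nvar 2 \<cdot> nvar 3), nil_form (nvar 0) (nvar 1) (nvar 2)}"

definition multilinear_in :: "nat set \<Rightarrow> 'a::field npoly \<Rightarrow> bool" where
  "multilinear_in X f \<longleftrightarrow> (\<forall>m\<in>Poly_Mapping.keys f. distinct (letters m) \<and> set (letters m) = X)"

lemma multilinear_in_single:
  "distinct (letters m) \<Longrightarrow> set (letters m) = X \<Longrightarrow> multilinear_in X (Poly_Mapping.single m c)"
  by (simp add: multilinear_in_def)

lemma multilinear_in_add: "multilinear_in X f \<Longrightarrow> multilinear_in X g \<Longrightarrow> multilinear_in X (f + g)"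
  using Poly_Mapping.keys_add[of f g] unfolding multilinear_in_def by blast

lemma multilinear_in_diff: "multilinear_in X f \<Longrightarrow> multilinear_in X g \<Longrightarrow> multilinear_in X (f - g)"
  using keys_diff[of f g] unfolding multilinear_in_def by blast

lemma multilinear_nalt2_linear:
  fixes f :: "'a::field npoly"
  assumes "f \<in> nalt2_linear"
  shows "multilinear f"
proof -
  note defs = nassociator_def nil_form_def nvar_def nmult_single
  note intros = multilinear_in_add multilinear_in_diff multilinear_in_single
  have "multilinear_in {0, 1, 2} (nassociator (nvar 0) (nvar 1) (nvar 2)
        + nassociator (nvar 1) (nvar 0) (nvar 2) :: 'a npoly)"
    "multilinear_in {0, 1, 2} (nassociator (nvar 0) (nvar 1) (nvar 2)
        + nassociator (nvar 0) (nvar 2) (nvar 1) :: 'a npoly)"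
    "multilinear_in {0, 1, 2, 3} (nvar 0 \<cdot> nvar 1 \<cdot> (nvar 2 \<cdot> nvar 3) :: 'a npoly)"
    "multilinear_in {0, 1, 2} (nil_form (nvar 0) (nvar 1) (nvar 2) :: 'a npoly)"
    unfolding defs by (intro intros; auto)+
  then have "\<exists>X. multilinear_in X f" using assms unfolding nalt2_linear_def by blast
  then show ?thesis unfolding multilinear_def multilinear_in_def .
qed

lemma models_nalt2_iff:
  fixes A :: "('a::field_char_0, 'v, 'm) module_scheme"
  shows "models A nalt2_identities \<longleftrightarrow> nonassoc_algebra A \<and> (\<forall>f\<in>nalt2_linear. satisfies A f)"
proof (intro iffI conjI ballI)
  assume A: "models A nalt2_identities"
  then show "nonassoc_algebra A" by (simp add: models_def)
  fix f :: "'a npoly" assume "f \<in> nalt2_linear"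
  then show "satisfies A f" unfolding satisfies_def
  proof (intro allI impI)
    fix a :: "nat \<Rightarrow> _" assume "\<forall>x. a x \<in> carrier A"
    then interpret nalt_ideal "{f. eval_poly A a f = \<zero>\<^bsub>A\<^esub>}" by (intro nalt_ideal_kernel A) auto
    have "f \<in> {f. eval_poly A a f = \<zero>\<^bsub>A\<^esub>}"
      using \<open>f \<in> nalt2_linear\<close> al ar metab nil3 unfolding nalt2_linear_def by blast
    then show "eval_poly A a f = \<zero>\<^bsub>A\<^esub>" by simp
  qed
next
  assume R: "nonassoc_algebra A \<and> (\<forall>f\<in>nalt2_linear. satisfies A f)"
  interpret nonassoc_algebra A using R by simp
  have lin: "eval_poly A a f = \<zero>\<^bsub>A\<^esub>" if "f \<in> nalt2_linear" "\<And>x. a x \<in> carrier A" for a f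
    using R that by (auto simp: satisfies_def)
  \<comment> \<open>Setting variables equal in the linearizations returns twice an alternative law
    and six times the cube; characteristic 0 permits the division.\<close>
  have div: "y = \<zero>\<^bsub>A\<^esub>" if "of_nat (Suc n) \<odot>\<^bsub>A\<^esub> y = \<zero>\<^bsub>A\<^esub>" "y \<in> carrier A" for n y
    using smult_smult[OF that(2), of "inverse (of_nat (Suc n))" "of_nat (Suc n)"] that
    by (simp del: of_nat_Suc)
  have "satisfies A f" if "f \<in> nalt2_identities" for f unfolding satisfies_def
  proof (intro allI impI)
    fix a :: "nat \<Rightarrow> _" assume "\<forall>x. a x \<in> carrier A"
    then have a: "\<And>x. a x \<in> carrier A" by simp
    note ev = eval_poly_add eval_poly_diff eval_poly_nmult
    from that consider "f = nassociator (nvar 0) (nvar 0) (nvar 1)"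
      | "f = nassociator (nvar 0) (nvar 1) (nvar 1)" | "f = nvar 0 \<cdot> nvar 1 \<cdot> (nvar 2 \<cdot> nvar 3)"
      | "f = nvar 0 \<cdot> nvar 0 \<cdot> nvar 0"
      by (auto simp: nalt2_identities_def Let_def)
    then show "eval_poly A a f = \<zero>\<^bsub>A\<^esub>"
    proof cases
      case 1
      let ?b = "\<lambda>x::nat. if x = 2 then a 1 else a 0"
      have bc: "?b x \<in> carrier A" for x using a by simp
      have "eval_poly A ?b (nassociator (nvar 0) (nvar 1) (nvar 2) + nassociator (nvar 1) (nvar 0) (nvar 2))
          = eval_poly A a f \<oplus>\<^bsub>A\<^esub> eval_poly A a f"
        using a bc by (simp add: 1 nassociator_def ev)
      also have "\<dots> = of_nat (Suc 1) \<odot>\<^bsub>A\<^esub> eval_poly A a f"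
        using a smult_add_left[of "eval_poly A a f" 1 1] by simp
      finally have e: "eval_poly A ?b (nassociator (nvar 0) (nvar 1) (nvar 2) + nassociator (nvar 1) (nvar 0) (nvar 2)) = of_nat (Suc 1) \<odot>\<^bsub>A\<^esub> eval_poly A a f" .
      have "eval_poly A ?b (nassociator (nvar 0) (nvar 1) (nvar 2) + nassociator (nvar 1) (nvar 0) (nvar 2)) = \<zero>\<^bsub>A\<^esub>"
        by (rule lin[OF _ bc]) (simp add: nalt2_linear_def)
      from trans[OF e[symmetric] this] show ?thesis by (rule div) (rule eval_poly_closed[OF a])
    next
      case 2
      let ?b = "\<lambda>x::nat. if x = 0 then a 0 else a 1"
      have bc: "?b x \<in> carrier A" for x using a by simp
      have "eval_poly A ?b (nassociator (nvar 0) (nvar 1) (nvar 2) + nassociator (nvar 0) (nvar 2) (nvar 1))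
          = eval_poly A a f \<oplus>\<^bsub>A\<^esub> eval_poly A a f"
        using a bc by (simp add: 2 nassociator_def ev)
      also have "\<dots> = of_nat (Suc 1) \<odot>\<^bsub>A\<^esub> eval_poly A a f"
        using a smult_add_left[of "eval_poly A a f" 1 1] by simp
      finally have e: "eval_poly A ?b (nassociator (nvar 0) (nvar 1) (nvar 2) + nassociator (nvar 0) (nvar 2) (nvar 1)) = of_nat (Suc 1) \<odot>\<^bsub>A\<^esub> eval_poly A a f" .
      have "eval_poly A ?b (nassociator (nvar 0) (nvar 1) (nvar 2) + nassociator (nvar 0) (nvar 2) (nvar 1)) = \<zero>\<^bsub>A\<^esub>"
        by (rule lin[OF _ bc]) (simp add: nalt2_linear_def)
      from trans[OF e[symmetric] this] show ?thesis by (rule div) (rule eval_poly_closed[OF a])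
    next
      case 3
      then show ?thesis using lin a by (simp add: nalt2_linear_def)
    next
      case 4
      have "nil_form (nvar 0) (nvar 0) (nvar 0) = nsmult 6 (f :: 'a npoly)"
        by (intro poly_mapping_eqI) (simp add: 4 nil_form_def lookup_add)
      moreover have "eval_poly A (\<lambda>_. a 0) (nil_form (nvar 0) (nvar 1) (nvar 2))
          = eval_poly A a (nil_form (nvar 0) (nvar 0) (nvar 0))"
        using a by (simp add: nil_form_def ev)
      ultimately have "of_nat (Suc 5) \<odot>\<^bsub>A\<^esub> eval_poly A a f = \<zero>\<^bsub>A\<^esub>"
        using lin[of "nil_form (nvar 0) (nvar 1) (nvar 2)" "\<lambda>_. a 0"] a
        by (simp add: nalt2_linear_def eval_poly_nsmult)
      then show ?thesis by (rule div) (rule eval_poly_closed[OF a])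
    qed
  qed
  then show "models A nalt2_identities" using R by (simp add: models_def)
qed

text \<open>Membership in \<open>var_superalgs nalt2_identities\<close>, restated without the
  envelope and for any record extension.\<close>

definition super_models :: "('a::field, 'v, 'm) superalg_scheme \<Rightarrow> bool" where
  "super_models A \<longleftrightarrow> superalgebra A \<and> (\<forall>f\<in>nalt2_linear. super_satisfies A f)"

lemma models_envelope_iff:
  fixes A :: "('a::field_char_0, 'v, 'm) superalg_scheme"
  assumes "superalgebra A"
  shows "models (grassmann_envelope A) nalt2_identities \<longleftrightarrow> super_models A"
  using assms superalgebra.satisfies_envelope_iff[OF assms multilinear_nalt2_linear]
    superalgebra.nonassoc_algebra_envelope[OF assms]
  by (simp add: models_nalt2_iff super_models_def)

lemma var_superalgs_eq:
  "(var_superalgs nalt2_identities :: ('a::field_char_0, 'v) superalg set) = {A. super_models A}"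
proof -
  have "superalgebra A" if "super_models A" for A :: "('a, 'v) superalg"
    using that by (simp add: super_models_def)
  then show ?thesis
    by (auto simp: var_superalgs_def variety_eq_models models_envelope_iff)
qed

section \<open>Relatively free superalgebras\<close>

lemma free_superalg_simps [simp]:
  "carrier (free_superalg X p) = carrier (free_alg X)" "mult (free_superalg X p) = nmult"
  "add (free_superalg X p) = (+)" "zero (free_superalg X p) = 0" "smult (free_superalg X p) = nsmult"
  "part (free_superalg X p) i =
    {f. \<forall>m\<in>Poly_Mapping.keys f. set (letters m) \<subseteq> X \<and> monom_parity p m = i}"
  by (simp_all add: free_superalg_def free_alg_def)

lemma alg_hom_free_superalg: "alg_hom (free_alg X) (free_superalg X p) (\<lambda>f. f)"
  "alg_hom (free_superalg X p) (free_alg X) (\<lambda>f. f)"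
  unfolding alg_hom_def free_superalg_simps by (auto simp: free_alg_def)

lemma superalgebra_free_superalg: "superalgebra (free_superalg X p :: ('a::field, 'a npoly) superalg)"
proof -
  let ?F = "free_superalg X p :: ('a, 'a npoly) superalg"
  interpret nonassoc_algebra ?F
    using nonassoc_algebra_free_alg alg_hom_free_superalg(1)
    by (rule nonassoc_algebra_image) (simp_all add: free_alg_def)
  have neg: "\<ominus>\<^bsub>?F\<^esub> f = - f" if "f \<in> carrier (free_alg X)" for f
    using smult_minus_one[of f] that by simp
  show ?thesis
  proof (intro superalgebra.intro superalgebra_axioms.intro nonassoc_algebra_axioms)
    fix i show "submodule (part ?F i) base_ring ?F"
    proof (rule submoduleI)
      show sub: "part ?F i \<subseteq> carrier ?F" by (auto simp: free_alg_def)
      fix f g assume "f \<in> part ?F i" "g \<in> part ?F i"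
      then show "f \<oplus>\<^bsub>?F\<^esub> g \<in> part ?F i" using Poly_Mapping.keys_add[of f g] by fastforce
    next
      fix f assume f: "f \<in> part ?F i"
      then have "f \<in> carrier (free_alg X)" by (auto simp: free_alg_def)
      then show "\<ominus>\<^bsub>?F\<^esub> f \<in> part ?F i" using f by (simp add: neg)
      fix c show "c \<odot>\<^bsub>?F\<^esub> f \<in> part ?F i" using f keys_nsmult_subset[of c f] by auto
    qed simp
  next
    fix f assume f: "f \<in> carrier ?F"
    define h where "h i = Poly_Mapping.mapp (\<lambda>m c. if monom_parity p m = i then c else 0) f" for i
    have h: "Poly_Mapping.lookup (h i) m = (if monom_parity p m = i then Poly_Mapping.lookup f m else 0)"
      for i m by (simp add: h_def lookup_mapp when_def in_keys_iff)
    have "h i \<in> part ?F i" for i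
      using f by (auto simp: in_keys_iff h free_alg_def split: if_splits)
    moreover have "f = h 0 + h 1"
    proof (rule poly_mapping_eqI)
      fix m show "Poly_Mapping.lookup f m = Poly_Mapping.lookup (h 0 + h 1) m"
        by (cases "monom_parity p m = 0") (auto simp: lookup_add h)
    qed
    ultimately show "\<exists>y\<in>part ?F 0. \<exists>z\<in>part ?F 1. f = y \<oplus>\<^bsub>?F\<^esub> z"
      unfolding free_superalg_simps(3) by blast
  next
    have "f = 0" if "f \<in> part ?F 0 \<inter> part ?F 1" for f
    proof -
      have "Poly_Mapping.keys f = {}" using that by auto
      then show ?thesis by simp
    qed
    then show "part ?F 0 \<inter> part ?F 1 = {\<zero>\<^bsub>?F\<^esub>}" by auto
  next
    fix f g i j assume "f \<in> part ?F i" "g \<in> part ?F j"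
    then show "f \<otimes>\<^bsub>?F\<^esub> g \<in> part ?F (i + j)" using keys_nmult_subset[of f g] by fastforce
  qed
qed

lemma eval_poly_free_superalg:
  fixes f :: "'a::field npoly"
  assumes "\<And>x. a x \<in> carrier (free_alg X)"
  shows "eval_poly (free_superalg X p) a f = eval_poly (free_alg X) a f"
  using alg_hom_eval_poly[OF nonassoc_algebra_free_alg
      superalgebra.axioms(1)[OF superalgebra_free_superalg] alg_hom_free_superalg(1) assms]
  by simp

text \<open>The graded analogue of \<open>kernel_in_rel_family\<close>. As \<open>b\<close> respects
  parities, evaluation maps homogeneous parts into homogeneous parts, and uniqueness of the
  decomposition in \<open>A\<close> makes the kernel graded.\<close>

lemma super_kernel:
  fixes A :: "('a::field, 'v, 'm) superalg_scheme" and X :: "nat set"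
  assumes A: "super_models A" and b: "\<And>x. b x \<in> part A (p x)"
  defines "K \<equiv> {f \<in> carrier (free_alg X). eval_poly A b f = \<zero>\<^bsub>A\<^esub>}"
  shows "graded_ideal K (free_superalg X p)" "super_models (quot_superalg (free_superalg X p) K)"
proof -
  let ?F = "free_superalg X p :: ('a, 'a npoly) superalg"
  interpret F: superalgebra ?F by (rule superalgebra_free_superalg)
  interpret A: superalgebra A using A by (simp add: super_models_def)
  have bc: "\<And>x. b x \<in> carrier A" using b A.part_carrier by blast
  have ev: "eval_poly A b f \<in> part A i" if "f \<in> part ?F i" for f i
  proof -
    have "eval_monom A b m \<in> part A i" if "m \<in> Poly_Mapping.keys f" for m
      using A.eval_monom_part[where a = b and p = p, OF b, of m] \<open>f \<in> part ?F i\<close> that by auto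
    then show ?thesis unfolding eval_poly_def by (intro A.part_finsum) auto
  qed
  have hom: "alg_hom ?F A (eval_poly A b)"
    using A.alg_hom_eval[OF bc, of X] by (simp add: alg_hom_def) (simp add: free_alg_def)
  have "alg_ideal {x \<in> carrier ?F. eval_poly A b x = \<zero>\<^bsub>A\<^esub>} ?F"
    using F.nonassoc_algebra_axioms A.nonassoc_algebra_axioms hom by (rule alg_ideal_kernel)
  then have ideal: "alg_ideal K ?F" by (simp add: K_def)
  show gr: "graded_ideal K ?F"
    unfolding graded_ideal_def
  proof (intro conjI ideal ballI)
    fix f assume f: "f \<in> K"
    then have "f \<in> carrier ?F" by (simp add: K_def)
    then obtain g h where gh: "g \<in> part ?F 0" "h \<in> part ?F 1" "f = g \<oplus>\<^bsub>?F\<^esub> h"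
      using F.part_decomp by blast
    have "eval_poly A b g \<oplus>\<^bsub>A\<^esub> eval_poly A b h = \<zero>\<^bsub>A\<^esub> \<oplus>\<^bsub>A\<^esub> \<zero>\<^bsub>A\<^esub>"
      using f gh(3) A.eval_poly_add[where a = b and f = g and g = h, OF bc] by (simp add: K_def)
    then have "eval_poly A b g = \<zero>\<^bsub>A\<^esub>" "eval_poly A b h = \<zero>\<^bsub>A\<^esub>"
      using A.part_unique[OF ev[OF gh(1)] ev[OF gh(2)], of "\<zero>\<^bsub>A\<^esub>" "\<zero>\<^bsub>A\<^esub>"] by auto
    then have "g \<in> K" "h \<in> K" using gh F.part_carrier by (auto simp: K_def simp del: free_superalg_simps(6))
    then show "\<exists>y\<in>K \<inter> part ?F 0. \<exists>z\<in>K \<inter> part ?F 1. f = y \<oplus>\<^bsub>?F\<^esub> z" using gh by blast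
  qed
  have "super_satisfies (quot_superalg ?F K) f" if "f \<in> nalt2_linear" for f
    unfolding F.super_satisfies_quot_iff[OF gr]
  proof (intro allI impI)
    fix q and a :: "nat \<Rightarrow> _" assume a: "\<forall>x. a x \<in> part ?F (q x)"
    then have ac: "\<And>x. a x \<in> carrier (free_alg X)" by (auto simp: free_alg_def)
    have "super_satisfies A f" using A that by (simp add: super_models_def)
    then have "eval_poly A (\<lambda>x. eval_poly A b (a x)) (superization q f) = \<zero>\<^bsub>A\<^esub>"
      using a ev by (intro super_satisfiesD) auto
    then have "eval_poly A b (eval_poly (free_alg X) a (superization q f)) = \<zero>\<^bsub>A\<^esub>"
      using ac bc by (subst eval_poly_substitute[OF A.nonassoc_algebra_axioms]) auto
    then show "eval_poly ?F a (superization q f) \<in> K"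
      using ac nonassoc_algebra.eval_poly_closed[OF nonassoc_algebra_free_alg, of a X]
      by (simp add: K_def eval_poly_free_superalg)
  qed
  then show "super_models (quot_superalg ?F K)"
    using F.superalgebra_quot_superalg[OF gr] by (simp add: super_models_def)
qed

definition rs_parity :: "nat \<Rightarrow> nat \<Rightarrow> bit" where
  "rs_parity r x = (if x < r then 0 else 1)"

lemma free_superalg_rs: "free_superalg_rs r s = free_superalg {..<r + s} (rs_parity r)"
  by (simp add: free_superalg_rs_def rs_parity_def [abs_def])

context
  fixes I :: "'a::field_char_0 npoly set" and r s :: nat
  defines "I \<equiv> super_rel_ideal nalt2_identities r s"
begin

lemma super_rel_ideal_alt:
  "I = \<Inter>{I. graded_ideal I (free_superalg_rs r s) \<and> super_models (quot_superalg (free_superalg_rs r s) I)}"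
  by (simp add: I_def super_rel_ideal_def var_superalgs_eq)

lemma super_rel_ideal_evalD:
  fixes A :: "('a, 'v, 'm) superalg_scheme"
  assumes "super_models A" "\<And>x. b x \<in> part A (rs_parity r x)" "f \<in> I"
  shows "eval_poly A b f = \<zero>\<^bsub>A\<^esub>"
proof -
  have "I \<subseteq> {f \<in> carrier (free_alg {..<r + s}). eval_poly A b f = \<zero>\<^bsub>A\<^esub>}"
    unfolding super_rel_ideal_alt free_superalg_rs
    by (intro Inter_lower CollectI conjI super_kernel[where A = A] assms)
  with assms(3) show ?thesis by auto
qed

lemma super_models_trivial: "\<exists>A :: ('a, unit) superalg. super_models A"
proof
  let ?A = "\<lparr>carrier = UNIV, mult = \<lambda>_ _. (), one = (), zero = (), add = \<lambda>_ _. (),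
    smult = \<lambda>_ _. (), part = \<lambda>_. UNIV\<rparr> :: ('a, unit) superalg"
  interpret nonassoc_algebra ?A by (rule nonassoc_algebraI) auto
  have "superalgebra ?A"
    by (intro superalgebra.intro superalgebra_axioms.intro nonassoc_algebra_axioms submoduleI) auto
  then show "super_models ?A" by (auto simp: super_models_def super_satisfies_def)
qed

lemma graded_ideal_super_rel_ideal: "graded_ideal I (free_superalg_rs r s)"
proof -
  let ?F = "free_superalg_rs r s :: ('a, 'a npoly) superalg"
  interpret F: superalgebra ?F unfolding free_superalg_rs by (rule superalgebra_free_superalg)
  obtain A :: "('a, unit) superalg" where A: "super_models A" using super_models_trivial by blast
  interpret A: superalgebra A using A by (simp add: super_models_def)
  have "I \<subseteq> {f \<in> carrier (free_alg {..<r + s}). eval_poly A (\<lambda>_. \<zero>\<^bsub>A\<^esub>) f = \<zero>\<^bsub>A\<^esub>}"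
    unfolding super_rel_ideal_alt free_superalg_rs
    by (intro Inter_lower CollectI conjI super_kernel[where A = A] A A.part_zero)
  then have sub: "I \<subseteq> carrier ?F" by (auto simp: free_superalg_rs)
  have J: "alg_ideal J ?F" if "graded_ideal J ?F" for J using that by (simp add: graded_ideal_def)
  have ideal: "alg_ideal I ?F"
    using sub by (rule F.alg_idealI) (auto simp: super_rel_ideal_alt dest: J intro: F.alg_idealD)
  show ?thesis unfolding graded_ideal_def
  proof (intro conjI ideal ballI)
    fix f assume f: "f \<in> I"
    then obtain g h where gh: "g \<in> part ?F 0" "h \<in> part ?F 1" "f = g \<oplus>\<^bsub>?F\<^esub> h"
      using sub F.part_decomp by blast
    have "g \<in> J \<and> h \<in> J" if "graded_ideal J ?F" "super_models (quot_superalg ?F J)" for J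
    proof -
      have "g \<oplus>\<^bsub>?F\<^esub> h \<in> J" using f gh(3) that by (auto simp: super_rel_ideal_alt)
      then show ?thesis using F.graded_ideal_parts[OF that(1) gh(1,2)] by simp
    qed
    then have "g \<in> I" "h \<in> I" by (auto simp: super_rel_ideal_alt)
    then show "\<exists>y\<in>I \<inter> part ?F 0. \<exists>z\<in>I \<inter> part ?F 1. f = y \<oplus>\<^bsub>?F\<^esub> z" using gh by blast
  qed
qed

lemma super_models_var_free_superalg:
  "super_models (var_free_superalg nalt2_identities r s :: ('a, 'a npoly set) superalg)"
proof -
  let ?F = "free_superalg_rs r s :: ('a, 'a npoly) superalg"
  interpret F: superalgebra ?F unfolding free_superalg_rs by (rule superalgebra_free_superalg)
  have "super_satisfies (quot_superalg ?F I) f" if "f \<in> nalt2_linear" for f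
    unfolding F.super_satisfies_quot_iff[OF graded_ideal_super_rel_ideal]
  proof (intro allI impI)
    fix p and a :: "nat \<Rightarrow> _" assume "\<forall>x. a x \<in> part ?F (p x)"
    then have "eval_poly ?F a (superization p f) \<in> J"
      if "graded_ideal J ?F" "super_models (quot_superalg ?F J)" for J
      using that \<open>f \<in> nalt2_linear\<close> F.super_satisfies_quot_iff[OF that(1), of f]
      by (auto simp: super_models_def)
    then show "eval_poly ?F a (superization p f) \<in> I" by (auto simp: super_rel_ideal_alt)
  qed
  then show ?thesis
    using F.superalgebra_quot_superalg[OF graded_ideal_super_rel_ideal]
    by (simp add: super_models_def var_free_superalg_def I_def)
qed

text \<open>The universal property for superalgebras: the generators go to elements of
  \<open>A\<close> of the same parity, and homogeneous polynomials in them are the admissible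
  arguments.\<close>

lemma super_satisfies_var_free_superalgD:
  fixes A :: "('a, 'v, 'm) superalg_scheme"
  assumes f: "super_satisfies (var_free_superalg nalt2_identities r s) f" and A: "super_models A"
    and b: "\<And>x. b x \<in> part A (rs_parity r x)"
    and a: "\<And>x. a x \<in> part (free_superalg {..<r + s} (rs_parity r)) (q x)"
  shows "eval_poly A (\<lambda>x. eval_poly A b (a x)) (superization q f) = \<zero>\<^bsub>A\<^esub>"
proof -
  let ?F = "free_superalg_rs r s :: ('a, 'a npoly) superalg"
  interpret F: superalgebra ?F unfolding free_superalg_rs by (rule superalgebra_free_superalg)
  interpret A: superalgebra A using A by (simp add: super_models_def)
  have bc: "\<And>x. b x \<in> carrier A" using b A.part_carrier by blast
  have ac: "\<And>x. a x \<in> carrier (free_alg {..<r + s})" using a by (auto simp: free_alg_def)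
  have "eval_poly ?F a (superization q f) \<in> I"
    using f a F.super_satisfies_quot_iff[OF graded_ideal_super_rel_ideal, of f]
    by (auto simp: var_free_superalg_def I_def free_superalg_rs)
  then have "eval_poly (free_alg {..<r + s}) a (superization q f) \<in> I"
    using ac by (simp add: free_superalg_rs eval_poly_free_superalg)
  from super_rel_ideal_evalD[OF A b this] show ?thesis
    using ac bc by (subst (asm) eval_poly_substitute[OF A.nonassoc_algebra_axioms]) auto
qed

end

section \<open>The model superalgebra\<close>

text \<open>
  The triple \<open>(c, p, q)\<close> stands for \<open>c x\<close> plus an element of the square whose component of degree
  \<open>d\<close> is \<open>p d u\<^sub>d + q d v\<^sub>d\<close>.  Right multiplication by the odd generator \<open>x\<close> shifts the degree,
  left multiplication by \<open>x\<close> on degree \<open>d\<close> is in addition the matrix \<^const>\<open>left_coef\<close>.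
\<close>

definition nalt_model :: "('a::field, 'a \<times> (nat \<Rightarrow> 'a) \<times> (nat \<Rightarrow> 'a)) superalg" where
  "nalt_model = \<lparr>carrier = UNIV,
     mult = \<lambda>(c, p, q) (c', p', q'). (0,
       (\<lambda>d. case d of 0 \<Rightarrow> c * c' | Suc e \<Rightarrow> c' * p e + c * fst (left_coef e (p' e, q' e))),
       (\<lambda>d. case d of 0 \<Rightarrow> 0 | Suc e \<Rightarrow> c' * q e + c * snd (left_coef e (p' e, q' e)))),
     one = (0, \<lambda>_. 0, \<lambda>_. 0), zero = (0, \<lambda>_. 0, \<lambda>_. 0),
     add = \<lambda>(c, p, q) (c', p', q'). (c + c', \<lambda>d. p d + p' d, \<lambda>d. q d + q' d),
     smult = \<lambda>k (c, p, q). (k * c, \<lambda>d. k * p d, \<lambda>d. k * q d),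
     part = \<lambda>i. {(c, p, q). (i = 0 \<longrightarrow> c = 0) \<and> (\<forall>d. of_nat d \<noteq> i \<longrightarrow> p d = 0 \<and> q d = 0)}\<rparr>"

lemma nalt_model_simps [simp]:
  "carrier nalt_model = UNIV" "\<zero>\<^bsub>nalt_model\<^esub> = (0, \<lambda>_. 0, \<lambda>_. 0)"
  "(c, p, q) \<oplus>\<^bsub>nalt_model\<^esub> (c', p', q') = (c + c', \<lambda>d. p d + p' d, \<lambda>d. q d + q' d)"
  "k \<odot>\<^bsub>nalt_model\<^esub> (c, p, q) = (k * c, \<lambda>d. k * p d, \<lambda>d. k * q d)"
  "(c, p, q) \<otimes>\<^bsub>nalt_model\<^esub> (c', p', q') = (0,
       (\<lambda>d. case d of 0 \<Rightarrow> c * c' | Suc e \<Rightarrow> c' * p e + c * fst (left_coef e (p' e, q' e))),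
       (\<lambda>d. case d of 0 \<Rightarrow> 0 | Suc e \<Rightarrow> c' * q e + c * snd (left_coef e (p' e, q' e))))"
  "(c, p, q) \<in> part nalt_model i \<longleftrightarrow> (i = 0 \<longrightarrow> c = 0) \<and> (\<forall>d. of_nat d \<noteq> i \<longrightarrow> p d = 0 \<and> q d = 0)"
  by (simp_all add: nalt_model_def)

lemma superalgebra_nalt_model: "superalgebra (nalt_model :: ('a::field, _) superalg)"
proof -
  interpret nonassoc_algebra "nalt_model :: ('a, _) superalg"
    by (rule nonassoc_algebraI)
       (auto simp: fun_eq_iff left_coef_def algebra_simps split: nat.split)
  let ?M = "nalt_model :: ('a, _) superalg"
  have neg: "\<ominus>\<^bsub>?M\<^esub> (c, p, q) = (- c, \<lambda>d. - p d, \<lambda>d. - q d)" for c p q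
    using smult_minus_one[of "(c, p, q)"] by simp
  show ?thesis
  proof (intro superalgebra.intro superalgebra_axioms.intro nonassoc_algebra_axioms)
    fix i show "submodule (part ?M i) base_ring ?M"
      by (rule submoduleI) (auto simp: neg)
  next
    fix x :: "'a \<times> (nat \<Rightarrow> 'a) \<times> (nat \<Rightarrow> 'a)"
    obtain c p q where x: "x = (c, p, q)" by (cases x)
    let ?y = "(0, \<lambda>d. if even d then p d else 0, \<lambda>d. if even d then q d else 0)"
      and ?z = "(c, \<lambda>d. if even d then 0 else p d, \<lambda>d. if even d then 0 else q d)"
    have "?y \<in> part ?M 0" "?z \<in> part ?M 1" "x = ?y \<oplus>\<^bsub>?M\<^esub> ?z"
      by (auto simp: x of_nat_bit fun_eq_iff)
    then show "\<exists>y\<in>part ?M 0. \<exists>z\<in>part ?M 1. x = y \<oplus>\<^bsub>?M\<^esub> z" by blast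
  next
    show "part ?M 0 \<inter> part ?M 1 = {\<zero>\<^bsub>?M\<^esub>}"
    proof (intro equalityI subsetI)
      fix x assume x: "x \<in> part ?M 0 \<inter> part ?M 1"
      obtain c p q where cpq: "x = (c, p, q)" by (cases x)
      have "p d = 0 \<and> q d = 0" for d using x by (cases "even d") (auto simp: cpq of_nat_bit)
      then show "x \<in> {\<zero>\<^bsub>?M\<^esub>}" using x by (auto simp: cpq)
    qed simp
  next
    fix x y :: "'a \<times> (nat \<Rightarrow> 'a) \<times> (nat \<Rightarrow> 'a)" and i j
    assume xy: "x \<in> part ?M i" "y \<in> part ?M j"
    obtain c p q c' p' q' where x: "x = (c, p, q)" "y = (c', p', q')" by (cases x, cases y)
    show "x \<otimes>\<^bsub>?M\<^esub> y \<in> part ?M (i + j)"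
      using xy unfolding x
      by (cases i; cases j) (auto simp: left_coef_def of_nat_bit split: nat.splits if_splits)
  qed
qed

lemma superization_add: "superization p (f + g) = superization p f + superization p g"
  by (intro poly_mapping_eqI) (simp add: lookup_superization lookup_add distrib_left)

lemma superization_diff: "superization p (f - g) = superization p f - superization p g"
  by (intro poly_mapping_eqI) (simp add: lookup_superization lookup_minus right_diff_distrib)

lemma superization_single:
  "superization p (Poly_Mapping.single m c) = Poly_Mapping.single m (koszul_sign p (letters m) * c)"
  by (intro poly_mapping_eqI) (simp add: lookup_superization lookup_single when_def)

text \<open>A finite check: in each of the eight parity patterns of three variables the Koszul signs
  become explicit and the trilinear identities are compared degree by degree. The metabelian law
  holds because products have no component along \<open>x\<close>.\<close>

lemma super_models_nalt_model: "super_models (nalt_model :: ('a::field, _) superalg)"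
proof -
  let ?M = "nalt_model :: ('a, 'a \<times> (nat \<Rightarrow> 'a) \<times> (nat \<Rightarrow> 'a)) superalg"
  interpret M: superalgebra ?M by (rule superalgebra_nalt_model)
  have minus: "x \<ominus>\<^bsub>?M\<^esub> y = x \<oplus>\<^bsub>?M\<^esub> ((- 1) \<odot>\<^bsub>?M\<^esub> y)" for x y
    by (simp add: a_minus_def M.smult_minus_one)
  have "super_satisfies ?M f" if "f \<in> nalt2_linear" for f
    unfolding super_satisfies_def
  proof (intro allI impI)
    fix r :: "nat \<Rightarrow> bit" and a assume a: "\<forall>x. a x \<in> part ?M (r x)"
    define c p q where "c x = fst (a x)" "p x = fst (snd (a x))" "q x = snd (snd (a x))" for x
    then have apq: "a x = (c x, p x, q x)" for x by simp
    have c: "r x = 0 \<Longrightarrow> c x = 0" and pq: "of_nat d \<noteq> r x \<Longrightarrow> p x d = 0 \<and> q x d = 0" for x d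
      using a[rule_format, of x] by (auto simp: apq)
    \<comment> \<open>Homogeneity removes the coefficients in degrees of the wrong parity, and it is
      this parity on which \<open>left_coef\<close> branches.\<close>
    have par [simp]: "r x = 0 \<Longrightarrow> c x = 0" "r x = 0 \<Longrightarrow> odd d \<Longrightarrow> p x d = 0"
        "r x = 0 \<Longrightarrow> odd d \<Longrightarrow> q x d = 0" "r x = 1 \<Longrightarrow> even d \<Longrightarrow> p x d = 0"
        "r x = 1 \<Longrightarrow> even d \<Longrightarrow> q x d = 0" for x d
      using c[of x] pq[of d x] by (auto simp: of_nat_bit)
    note defs = nassociator_def nil_form_def nvar_def nmult_single superization_add superization_diff
      superization_single
    note ev = M.eval_poly_add M.eval_poly_diff
    from that consider "f = nassociator (nvar 0) (nvar 1) (nvar 2) + nassociator (nvar 1) (nvar 0) (nvar 2)"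
      | "f = nassociator (nvar 0) (nvar 1) (nvar 2) + nassociator (nvar 0) (nvar 2) (nvar 1)"
      | "f = nvar 0 \<cdot> nvar 1 \<cdot> (nvar 2 \<cdot> nvar 3)" | "f = nil_form (nvar 0) (nvar 1) (nvar 2)"
      by (auto simp: nalt2_linear_def)
    then show "eval_poly ?M a (superization r f) = \<zero>\<^bsub>?M\<^esub>"
    proof cases
      case 1
      show ?thesis unfolding 1 defs
        by (cases "r 0"; cases "r 1"; cases "r 2";
            simp add: ev minus apq koszul_sign_Cons swap_sign_def parity_sign_def;
            simp add: fun_eq_iff left_coef_def algebra_simps split: nat.split)
    next
      case 2
      show ?thesis unfolding 2 defs
        by (cases "r 0"; cases "r 1"; cases "r 2";
            simp add: ev minus apq koszul_sign_Cons swap_sign_def parity_sign_def;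
            simp add: fun_eq_iff left_coef_def algebra_simps split: nat.split)
    next
      case 3
      show ?thesis unfolding 3 defs
        by (simp add: ev apq) (auto simp: fun_eq_iff left_coef_def split: nat.split)
    next
      case 4
      show ?thesis unfolding 4 defs
        by (cases "r 0"; cases "r 1"; cases "r 2";
            simp add: ev minus apq koszul_sign_Cons swap_sign_def parity_sign_def;
            simp add: fun_eq_iff left_coef_def algebra_simps split: nat.split)
    qed
  qed
  then show ?thesis using M.superalgebra_axioms by (simp add: super_models_def)
qed

definition model_gen :: "'a::field \<times> (nat \<Rightarrow> 'a) \<times> (nat \<Rightarrow> 'a)" where
  "model_gen = (1, \<lambda>_. 0, \<lambda>_. 0)"

definition model_square :: "'a::field \<times> (nat \<Rightarrow> 'a) \<times> (nat \<Rightarrow> 'a)" where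
  "model_square = (0, \<lambda>d. if d = 0 then 1 else 0, \<lambda>_. 0)"

lemma model_square_eq: "model_gen \<otimes>\<^bsub>nalt_model\<^esub> model_gen = model_square"
  by (auto simp: model_gen_def model_square_def fun_eq_iff left_coef_def split: nat.split)

lemma model_parts: "model_gen \<in> part nalt_model 1" "model_square \<in> part nalt_model 0"
  by (auto simp: model_gen_def model_square_def of_nat_bit)

text \<open>The multiplication table of the model follows the recursion of \<open>wcoef\<close>:
  \<open>x\<close> on the right keeps the coefficients, \<open>x\<close> on the left applies
  \<open>left_coef\<close>, and a factor from the square contributes nothing.\<close>

lemma eval_monom_nalt_model:
  fixes i :: nat
  defines "b \<equiv> \<lambda>x. if x = i then model_square else model_gen :: 'a::field \<times> _"
  assumes "distinct (letters m)"
    and "i \<in> set (letters m)"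
  shows "eval_monom nalt_model b m =
      (0, \<lambda>d. if d = length (letters m) - 1 then fst (wcoef i m) else 0,
          \<lambda>d. if d = length (letters m) - 1 then snd (wcoef i m) else 0)"
proof -
  have fst0: "fst (x \<otimes>\<^bsub>nalt_model\<^esub> y) = 0" for x y :: "'a \<times> (nat \<Rightarrow> 'a) \<times> (nat \<Rightarrow> 'a)"
    by (cases x, cases y) simp
  \<comment> \<open>For submonomials without \<open>i\<close> the component along \<open>x\<close>
    decides: it is 1 for a variable and 0 otherwise, and the remaining components annihilate the
    square.\<close>
  have *: "(i \<notin> set (letters m) \<and> is_Var m \<longrightarrow> eval_monom nalt_model b m = model_gen) \<and>
    (i \<notin> set (letters m) \<and> \<not> is_Var m \<longrightarrow> fst (eval_monom nalt_model b m) = 0) \<and>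
    (i \<in> set (letters m) \<longrightarrow> eval_monom nalt_model b m =
      (0, \<lambda>d. if d = length (letters m) - 1 then fst (wcoef i m) else 0,
          \<lambda>d. if d = length (letters m) - 1 then snd (wcoef i m) else 0))"
    using assms(2)
  proof (induction m)
    case (Var x)
    then show ?case by (auto simp: b_def is_Var_def model_square_def fun_eq_iff)
  next
    case (Mul u v)
    have dist: "distinct (letters u)" "distinct (letters v)" "set (letters u) \<inter> set (letters v) = {}"
      using Mul.prems by auto
    obtain lu lv where len: "length (letters u) = Suc lu" "length (letters v) = Suc lv"
      by (metis letters_nonempty length_0_conv not0_implies_Suc)
    have nv: "\<not> is_Var (Mul u v)" by (simp add: is_Var_def)
    note IHu = Mul.IH(1)[OF dist(1)] and IHv = Mul.IH(2)[OF dist(2)]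
    consider "i \<notin> set (letters u)" "i \<notin> set (letters v)" | "i \<in> set (letters u)" "i \<notin> set (letters v)"
      | "i \<notin> set (letters u)" "i \<in> set (letters v)" using dist(3) by blast
    then show ?case
    proof cases
      case 1
      then show ?thesis using nv fst0 by simp
    next
      case 2
      let ?z = "eval_monom nalt_model b v"
      have z: "fst ?z = (if is_Var v then 1 else 0)" using IHv 2 by (simp add: model_gen_def)
      obtain c p q where zz: "?z = (c, p, q)" by (cases ?z)
      have lv0: "lv = 0" if "is_Var v" using that len by (simp add: is_Var_iff)
      have eu: "eval_monom nalt_model b u =
        (0, \<lambda>d. if d = lu then fst (wcoef i u) else 0, \<lambda>d. if d = lu then snd (wcoef i u) else 0)"
        using IHu 2 len by simp
      show ?thesis using 2 nv z zz lv0 len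
        by (auto simp: eu fun_eq_iff left_coef_def split: nat.split)
    next
      case 3
      let ?z = "eval_monom nalt_model b u"
      have z: "fst ?z = (if is_Var u then 1 else 0)" using IHu 3 by (simp add: model_gen_def)
      obtain c p q where zz: "?z = (c, p, q)" by (cases ?z)
      have lu0: "lu = 0" if "is_Var u" using that len by (simp add: is_Var_iff)
      have ev: "eval_monom nalt_model b v =
        (0, \<lambda>d. if d = lv then fst (wcoef i v) else 0, \<lambda>d. if d = lv then snd (wcoef i v) else 0)"
        using IHv 3 len by simp
      obtain s t :: 'a where st: "wcoef i v = (s, t)" by (cases "wcoef i v :: 'a \<times> 'a")
      show ?thesis using 3 nv z zz lu0 len
        by (auto simp: ev st fun_eq_iff left_coef_def split: nat.split)
    qed
  qed
  then show ?thesis using assms(3) by blast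
qed

lemma finsum_nalt_model:
  "finite K \<Longrightarrow> finsum nalt_model (\<lambda>m. (F m, P m, Q m)) K
    = (\<Sum>m\<in>K. F m, \<lambda>d. \<Sum>m\<in>K. P m d, \<lambda>d. \<Sum>m\<in>K. Q m d :: 'a::field)"
proof (induction K rule: finite_induct)
  interpret M: superalgebra "nalt_model :: ('a, _) superalg" by (rule superalgebra_nalt_model)
  case empty
  show ?case by simp
next
  interpret M: superalgebra "nalt_model :: ('a, _) superalg" by (rule superalgebra_nalt_model)
  case (insert m K)
  then show ?case by (subst M.finsum_insert) auto
qed

section \<open>Superidentities of the free superalgebra on one odd generator\<close>

text \<open>The superidentity is applied to \<open>x^2\<close> in place of \<open>i\<close> and to
  \<open>x\<close> elsewhere, and read off in the model. All monomials land in the single degree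
  \<open>card X - 1\<close>, the number of operators acting on \<open>x^2\<close>.\<close>

lemma odd_gen_superidentity_sums:
  fixes f :: "'a::field_char_0 npoly"
  assumes sat: "super_satisfies (var_free_superalg nalt2_identities 0 1) f"
    and f: "\<And>m. m \<in> Poly_Mapping.keys f \<Longrightarrow> distinct (letters m) \<and> set (letters m) = X"
    and X: "i \<in> X"
  defines "k \<equiv> \<lambda>m. Poly_Mapping.lookup f m * koszul_sign (\<lambda>x. if x = i then 0 else 1) (letters m)"
  shows "(\<Sum>m\<in>Poly_Mapping.keys f. k m * fst (wcoef i m)) = 0"
    and "(\<Sum>m\<in>Poly_Mapping.keys f. k m * snd (wcoef i m)) = 0"
proof -
  let ?M = "nalt_model :: ('a, 'a \<times> (nat \<Rightarrow> 'a) \<times> (nat \<Rightarrow> 'a)) superalg"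
  let ?q = "\<lambda>x. if x = i then 0 else 1 :: bit"
  let ?b = "\<lambda>x. if x = i then model_square else model_gen :: 'a \<times> (nat \<Rightarrow> 'a) \<times> (nat \<Rightarrow> 'a)"
  let ?K = "Poly_Mapping.keys f"
  interpret M: superalgebra ?M by (rule superalgebra_nalt_model)
  define a :: "nat \<Rightarrow> 'a npoly" where "a x = (if x = i then nvar 0 \<cdot> nvar 0 else nvar 0)" for x
  have "eval_poly ?M (\<lambda>x. eval_poly ?M (\<lambda>_. model_gen) (a x)) (superization ?q f) = \<zero>\<^bsub>?M\<^esub>"
  proof (rule super_satisfies_var_free_superalgD[OF sat super_models_nalt_model])
    fix x
    show "model_gen \<in> part ?M (rs_parity 0 x)" using model_parts by (simp add: rs_parity_def)
    show "a x \<in> part (free_superalg {..<0 + 1} (rs_parity 0)) (?q x)"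
      by (auto simp: a_def rs_parity_def nvar_def split: if_splits)
  qed
  moreover have "(\<lambda>x. eval_poly ?M (\<lambda>_. model_gen) (a x)) = ?b"
    by (auto simp: a_def M.eval_poly_nmult model_square_eq)
  ultimately have "(\<Oplus>\<^bsub>?M\<^esub>m\<in>?K. (koszul_sign ?q (letters m) * Poly_Mapping.lookup f m) \<odot>\<^bsub>?M\<^esub>
      eval_monom ?M ?b m) = \<zero>\<^bsub>?M\<^esub>"
    by (simp add: M.eval_poly_superization)
  moreover have len: "length (letters m) = card X" if "m \<in> ?K" for m
    using f[OF that] distinct_card by metis
  have "(\<Oplus>\<^bsub>?M\<^esub>m\<in>?K. (koszul_sign ?q (letters m) * Poly_Mapping.lookup f m) \<odot>\<^bsub>?M\<^esub> eval_monom ?M ?b m)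
    = (\<Oplus>\<^bsub>?M\<^esub>m\<in>?K. (0, \<lambda>d. if d = card X - 1 then k m * fst (wcoef i m) else 0,
        \<lambda>d. if d = card X - 1 then k m * snd (wcoef i m) else 0))"
  proof (rule M.finsum_cong')
    fix m assume m: "m \<in> ?K"
    have "eval_monom ?M ?b m = (0, \<lambda>d. if d = card X - 1 then fst (wcoef i m) else 0,
        \<lambda>d. if d = card X - 1 then snd (wcoef i m) else 0)"
      using eval_monom_nalt_model[of m i] f[OF m] X len[OF m] by simp
    then show "(koszul_sign ?q (letters m) * Poly_Mapping.lookup f m) \<odot>\<^bsub>?M\<^esub> eval_monom ?M ?b m
      = (0, \<lambda>d. if d = card X - 1 then k m * fst (wcoef i m) else 0,
        \<lambda>d. if d = card X - 1 then k m * snd (wcoef i m) else 0)"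
      by (auto simp: k_def mult_ac)
  qed auto
  ultimately have "(\<Oplus>\<^bsub>?M\<^esub>m\<in>?K. (0, \<lambda>d. if d = card X - 1 then k m * fst (wcoef i m) else 0,
        \<lambda>d. if d = card X - 1 then k m * snd (wcoef i m) else 0)) = \<zero>\<^bsub>?M\<^esub>"
    by simp
  then have z: "(\<Sum>m\<in>?K. 0 :: 'a, \<lambda>d. \<Sum>m\<in>?K. if d = card X - 1 then k m * fst (wcoef i m) else 0,
        \<lambda>d. \<Sum>m\<in>?K. if d = card X - 1 then k m * snd (wcoef i m) else 0) = (0, \<lambda>_. 0, \<lambda>_. 0)"
    by (subst (asm) finsum_nalt_model) auto
  show "(\<Sum>m\<in>?K. k m * fst (wcoef i m)) = 0"
    using fun_cong[of "\<lambda>d. \<Sum>m\<in>?K. if d = card X - 1 then k m * fst (wcoef i m) else 0" "\<lambda>_. 0" "card X - 1"] z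
    by simp
  show "(\<Sum>m\<in>?K. k m * snd (wcoef i m)) = 0"
    using fun_cong[of "\<lambda>d. \<Sum>m\<in>?K. if d = card X - 1 then k m * snd (wcoef i m) else 0" "\<lambda>_. 0" "card X - 1"] z
    by simp
qed

text \<open>From degree 3 on the coefficient criterion applies. In degrees 1 and 2 there is no
  normal form, but the coefficients already tell the monomials apart, so a nonzero \<open>f\<close>
  is impossible.\<close>

lemma odd_gen_superidentity_mem:
  fixes f :: "'a::field_char_0 npoly"
  assumes sat: "super_satisfies (var_free_superalg nalt2_identities 0 1) f" and "multilinear f"
    and I: "nalt_ideal I"
  shows "f \<in> I"
proof (cases "f = 0")
  case True
  then show ?thesis using nalt_ideal.zero[OF I] by simp
next
  case False
  then obtain m where m: "m \<in> Poly_Mapping.keys f" by (metis ex_in_conv keys_eq_empty)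
  obtain X where f: "\<And>m. m \<in> Poly_Mapping.keys f \<Longrightarrow> distinct (letters m) \<and> set (letters m) = X"
    using assms(2) by (auto simp: multilinear_def)
  have X: "finite X" using f[OF m] by auto
  have len: "length (letters m) = card X" if "m \<in> Poly_Mapping.keys f" for m
    using f[OF that] distinct_card by metis
  note sums = odd_gen_superidentity_sums[OF sat f]
  \<comment> \<open>An index \<open>i\<close> whose first coefficient is 1 on \<open>m\<close> and 0
    on the other monomials of \<open>f\<close> forces the coefficient of \<open>m\<close> in
    \<open>f\<close> to vanish.\<close>
  have lead: False
    if i: "i \<in> X" and uniq: "\<And>m'. m' \<in> Poly_Mapping.keys f \<Longrightarrow>
        fst (wcoef i m') = (if m' = m then 1 else 0 :: 'a)" for i
  proof -
    let ?k = "koszul_sign (\<lambda>x. if x = i then 0 else 1) (letters m) :: 'a"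
    have "(\<Sum>m'\<in>Poly_Mapping.keys f. Poly_Mapping.lookup f m' *
        koszul_sign (\<lambda>x. if x = i then 0 else 1) (letters m') * fst (wcoef i m'))
      = (\<Sum>m'\<in>Poly_Mapping.keys f. if m' = m then Poly_Mapping.lookup f m * ?k else 0)"
      using uniq by (intro sum.cong) auto
    also have "\<dots> = Poly_Mapping.lookup f m * ?k" using m by simp
    finally have "Poly_Mapping.lookup f m * ?k = 0" using sums(1)[OF _ i] by simp
    moreover have "?k \<noteq> 0" using koszul_sign_square[of _ "letters m"] by (metis mult_zero_left zero_neq_one)
    ultimately show False using m by (simp add: in_keys_iff)
  qed
  have "0 < card X" using len[OF m] by (metis letters_nonempty length_greater_0_conv)
  then consider "card X = 1" | "card X = 2" | "3 \<le> card X" by linarith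
  then show ?thesis
  proof cases
    case 1
    have "\<exists>x. m' = Var x \<and> X = {x}" if "m' \<in> Poly_Mapping.keys f" for m'
    proof -
      have "is_Var m'" using len[OF that] 1 by (simp add: is_Var_iff)
      then show ?thesis using f[OF that] by (auto simp: is_Var_def)
    qed
    then show ?thesis using lead m by (metis fst_conv insertI1 singleton_inject wcoef.simps(1))
  next
    case 2
    have two: "\<exists>a b. m' = Mul (Var a) (Var b) \<and> a \<noteq> b \<and> X = {a, b}" if "m' \<in> Poly_Mapping.keys f" for m'
      using length_letters_two[of m'] len[OF that] f[OF that] 2 by auto
    obtain a b where ab: "m = Mul (Var a) (Var b)" "a \<noteq> b" "X = {a, b}" using two[OF m] by blast
    \<comment> \<open>The only other candidate \<open>Mul (Var b) (Var a)\<close> has the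
      coefficients \<open>left_coef 0 (1, 0) = (0, 1)\<close>.\<close>
    have "fst (wcoef a m') = (if m' = m then 1 else 0 :: 'a)" if "m' \<in> Poly_Mapping.keys f" for m'
      using two[OF that] ab by (auto simp: is_Var_def left_coef_def doubleton_eq_iff)
    then show ?thesis using lead[of a] ab by auto
  next
    case 3
    show ?thesis
      by (rule nalt_ideal.multilinear_mem[OF I f X 3]) (use sums in auto)
  qed
qed

text \<open>For every assignment in the envelope the kernel of the evaluation is a
  \<open>nalt_ideal\<close> and so contains \<open>f\<close>; the resulting identity of the envelope
  is the superidentity of \<open>A\<close>.\<close>

lemma odd_gen_superidentity:
  fixes f :: "'a::field_char_0 npoly" and A :: "('a, 'v) superalg"
  assumes "super_satisfies (var_free_superalg nalt2_identities 0 1) f" "multilinear f" "super_models A"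
  shows "super_satisfies A f"
proof -
  interpret A: superalgebra A using assms(3) by (simp add: super_models_def)
  have "models (grassmann_envelope A) nalt2_identities"
    using assms(3) models_envelope_iff[OF A.superalgebra_axioms] by simp
  then have "satisfies (grassmann_envelope A) f"
    unfolding satisfies_def
    using odd_gen_superidentity_mem[OF assms(1,2) nalt_ideal_kernel] by blast
  then show ?thesis using A.satisfies_envelope_iff[OF assms(2)] by simp
qed

lemma rank_supervariety_0_1:
  "(rank_supervariety nalt2_identities 0 1 :: ('a::field_char_0, 'v) superalg set)
    = var_superalgs nalt2_identities"
proof (intro equalityI subsetI)
  fix A :: "('a, 'v) superalg"
  show "A \<in> var_superalgs nalt2_identities"
    if "A \<in> rank_supervariety nalt2_identities 0 1"
    using that super_models_var_free_superalg[of 0 1] multilinear_nalt2_linear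
    by (auto simp: rank_supervariety_def generated_supervariety_def var_superalgs_eq super_models_def)
  show "A \<in> rank_supervariety nalt2_identities 0 1" if "A \<in> var_superalgs nalt2_identities"
    using that odd_gen_superidentity
    by (auto simp: rank_supervariety_def generated_supervariety_def var_superalgs_eq super_models_def)
qed

section \<open>Left-normed words\<close>

text \<open>The index is one less than the degree.\<close>

fun left_word :: "nat \<Rightarrow> nmonom" where
  "left_word 0 = Var 0"
| "left_word (Suc n) = Mul (left_word n) (Var (Suc n))"

lemma letters_left_word [simp]: "letters (left_word n) = [0..<Suc n]"
  by (induction n) auto

lemma multilinear_left_word: "multilinear (nmon (left_word n))"
  by (auto simp: multilinear_def nmon_def)

lemma wcoef_left_word: "wcoef 0 (left_word n) = (1, 0)"
  by (induction n) (auto simp: is_Var_def)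

text \<open>A square in place of variable 0 is multiplied only from the right, so its first
  coefficient is 1 and the sum over the single monomial is a sign.\<close>

lemma odd_gen_not_left_word:
  "\<not> super_satisfies (var_free_superalg nalt2_identities 0 1)
    (nmon (left_word n) :: 'a::field_char_0 npoly)"
proof
  assume sat: "super_satisfies (var_free_superalg nalt2_identities 0 1) (nmon (left_word n) :: 'a npoly)"
  let ?k = "koszul_sign (\<lambda>x. if x = 0 then 0 else 1) (letters (left_word n)) :: 'a"
  have "?k = 0"
    using odd_gen_superidentity_sums(1)[OF sat, of "set (letters (left_word n))" 0]
    by (simp add: nmon_def wcoef_left_word del: upt_Suc)
  then show False using koszul_sign_square[of _ "letters (left_word n)"]
    by (metis mult_zero_left zero_neq_one)
qed

fun msubst :: "(nat \<Rightarrow> nmonom) \<Rightarrow> nmonom \<Rightarrow> nmonom" where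
  "msubst s (Var x) = s x"
| "msubst s (Mul u v) = Mul (msubst s u) (msubst s v)"

lemma eval_monom_msubst:
  "(\<And>x. x \<in> set (letters m) \<Longrightarrow> a x = eval_monom A b (s x)) \<Longrightarrow>
    eval_monom A b (msubst s m) = eval_monom A a m"
  by (induction m) auto

lemma set_letters_msubst: "set (letters (msubst s m)) = (\<Union>x\<in>set (letters m). set (letters (s x)))"
  by (induction m) auto

lemma length_letters_msubst: "length (letters m) \<le> length (letters (msubst s m))"
proof (induction m)
  case (Var x)
  show ?case using letters_nonempty[of "s x"] by (simp add: Suc_le_eq)
qed simp

text \<open>By linearity in each variable the arguments may be taken to be monomials in the
  generators; substituting them does not shorten \<open>m\<close> and leaves at most
  \<open>n\<close> distinct letters.\<close>

lemma generated_nilpotent: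
  fixes A :: "('a::field_char_0, 'v, 'm) module_scheme"
  assumes A: "models A nalt2_identities" and b: "\<And>x. b x \<in> carrier A"
    and gen: "\<And>y. y \<in> carrier A \<Longrightarrow> \<exists>g\<in>carrier (free_alg {..<n}). y = eval_poly A b g"
    and m: "distinct (letters m)" "n + 2 \<le> length (letters m)"
  shows "satisfies A (nmon m)"
  unfolding satisfies_def
proof (intro allI impI)
  interpret A: nonassoc_algebra A using A by (simp add: models_def)
  fix a :: "nat \<Rightarrow> _" assume a: "\<forall>x. a x \<in> carrier A"
  let ?B = "{eval_monom A b u | u. set (letters u) \<subseteq> {..<n}}"
  have span: "carrier A \<subseteq> lin_span A ?B"
  proof
    fix y assume "y \<in> carrier A"
    then obtain g where g: "g \<in> carrier (free_alg {..<n})" "y = eval_poly A b g" using gen by blast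
    have "(\<Oplus>\<^bsub>A\<^esub>u\<in>K. Poly_Mapping.lookup g u \<odot>\<^bsub>A\<^esub> eval_monom A b u) \<in> lin_span A ?B"
      if "finite K" "K \<subseteq> Poly_Mapping.keys g" for K
      using that
    proof (induction K)
      case (insert u K)
      have "set (letters u) \<subseteq> {..<n}" using insert.prems g(1) by (auto simp: free_alg_def)
      then have "eval_monom A b u \<in> lin_span A ?B" by (intro lin_span.base) blast
      then show ?case
        using insert b by (subst A.finsum_insert) (auto intro!: lin_span.add lin_span.smult)
    qed (simp add: lin_span.zero)
    then show "y \<in> lin_span A ?B" unfolding g(2) eval_poly_def by simp
  qed
  have sub: "?B \<subseteq> carrier A" using b by auto
  have on_B: "eval_poly A a' (nmon m) = \<zero>\<^bsub>A\<^esub>"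
    if a': "\<And>x. a' x \<in> carrier A" and aB: "\<And>x. x \<in> set (letters m) \<Longrightarrow> a' x \<in> ?B" for a'
  proof -
    have "\<forall>x\<in>set (letters m). \<exists>u. a' x = eval_monom A b u \<and> set (letters u) \<subseteq> {..<n}"
      using aB by blast
    then obtain s where s: "\<And>x. x \<in> set (letters m) \<Longrightarrow> a' x = eval_monom A b (s x)"
      "\<And>x. x \<in> set (letters m) \<Longrightarrow> set (letters (s x)) \<subseteq> {..<n}" by metis
    have "eval_monom A b (msubst s m) = \<zero>\<^bsub>A\<^esub>"
    proof (rule finitely_generated_nilpotent[OF A b])
      show "set (letters (msubst s m)) \<subseteq> {..<n}" using s(2) by (auto simp: set_letters_msubst)
      show "n + 2 \<le> length (letters (msubst s m))" using m(2) length_letters_msubst[of m s] by simp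
    qed
    then show ?thesis using eval_monom_msubst[of m a' A b s] s(1) a' by simp
  qed
  have keys: "\<And>m'. m' \<in> Poly_Mapping.keys (nmon m :: 'a npoly) \<Longrightarrow>
      distinct (letters m') \<and> set (letters m') = set (letters m)"
    using m(1) by (simp add: nmon_def)
  show "eval_poly A a (nmon m) = \<zero>\<^bsub>A\<^esub>"
    by (rule A.eval_poly_zero_on_span[OF keys _ sub span on_B]) (use a in simp_all)
qed

lemma var_free_alg_left_word:
  "satisfies (var_free_alg nalt2_identities n) (nmon (left_word (n + 1)) :: 'a::field_char_0 npoly)"
  using models_var_free_alg var_gen_closed var_free_alg_generated
  by (rule generated_nilpotent) auto

text \<open>Without odd elements all Koszul signs are 1, and superidentities become plain identities
  of the underlying algebra.\<close>

lemma super_models_even: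
  fixes A :: "('a::field_char_0, 'v) superalg"
  assumes A: "super_models A" and "carrier A = part A 0"
  shows "models A nalt2_identities"
proof -
  interpret superalgebra A using A by (simp add: super_models_def)
  have "koszul_sign (\<lambda>_. 0) w = (1 :: 'a)" for w
    by (simp add: koszul_sign_def parity_sign_def case_prod_unfold)
  then have "superization (\<lambda>_. 0) f = f" for f :: "'a npoly"
    by (intro poly_mapping_eqI) (simp add: lookup_superization)
  then have "satisfies A f" if "super_satisfies A f" for f
    unfolding satisfies_def assms(2) using super_satisfiesD[OF that, of _ "\<lambda>_. 0"] by auto
  then show ?thesis using A nonassoc_algebra_axioms by (simp add: models_nalt2_iff super_models_def)
qed

text \<open>Every monomial in even generators is even, so the free superalgebra is an ordinary
  algebra of the variety with \<open>r\<close> generators, and the nilpotency bound applies to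
  it.\<close>

lemma even_gens_left_word:
  "super_satisfies (var_free_superalg nalt2_identities r 0)
    (nmon (left_word (r + 1)) :: 'a::field_char_0 npoly)"
proof -
  let ?B = "var_free_superalg nalt2_identities r 0 :: ('a, 'a npoly set) superalg"
  let ?F = "free_superalg {..<r} (rs_parity r) :: ('a, 'a npoly) superalg"
  let ?I = "super_rel_ideal nalt2_identities r 0 :: 'a npoly set"
  interpret F: superalgebra ?F by (rule superalgebra_free_superalg)
  have B: "super_models ?B" by (rule super_models_var_free_superalg)
  interpret B: superalgebra ?B using B by (simp add: super_models_def)
  have B_def: "?B = quot_superalg ?F ?I"
    by (simp add: var_free_superalg_def free_superalg_rs)
  have "graded_ideal ?I (free_superalg_rs r 0)" by (rule graded_ideal_super_rel_ideal)
  then have "graded_ideal ?I ?F" by (simp add: free_superalg_rs)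
  then have I: "alg_ideal ?I ?F" by (simp add: graded_ideal_def)
  have "monom_parity (rs_parity r) m = 0" if "set (letters m) \<subseteq> {..<r}" for m
    using that by (induction m) (auto simp: rs_parity_def)
  then have "carrier ?F = part ?F 0" by (auto simp: free_alg_def)
  then have "carrier ?B = part ?B 0"
    unfolding B_def F.carrier_quot_superalg by (simp add: quot_superalg_def)
  then have M: "models ?B nalt2_identities" by (rule super_models_even[OF B])
  let ?h = "\<lambda>f. ?I +>\<^bsub>?F\<^esub> f"
  have hom: "alg_hom ?F ?B ?h" unfolding B_def by (rule F.alg_hom_quot_superalg[OF I])
  let ?a = "\<lambda>x. if x < r then nvar x else 0 :: 'a npoly"
  have a: "?a x \<in> carrier (free_alg {..<r})" for x by (auto simp: free_alg_def nvar_def)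
  have h: "?h f \<in> carrier ?B" if "f \<in> carrier (free_alg {..<r})" for f
    using hom that by (auto simp: alg_hom_def)
  have sat: "satisfies ?B (nmon (left_word (r + 1)))"
  proof (rule generated_nilpotent[OF M])
    show "?h (?a x) \<in> carrier ?B" for x using a by (rule h)
    fix y assume "y \<in> carrier ?B"
    then obtain g where g: "g \<in> carrier (free_alg {..<r})" "y = ?h g"
      unfolding B_def F.carrier_quot_superalg by auto
    have "?h (eval_poly ?F ?a g) = eval_poly ?B (\<lambda>x. ?h (?a x)) g"
      using a by (intro alg_hom_eval_poly[OF F.nonassoc_algebra_axioms B.nonassoc_algebra_axioms hom]) auto
    moreover have "eval_poly ?F ?a g = g"
      unfolding eval_poly_free_superalg[OF a] by (rule eval_poly_free_alg[OF g(1) a]) simp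
    ultimately show "\<exists>g\<in>carrier (free_alg {..<r}). y = eval_poly ?B (\<lambda>x. ?h (?a x)) g"
      using g by auto
  qed auto
  show ?thesis
    unfolding super_satisfies_def
  proof (intro allI impI)
    fix p and c :: "nat \<Rightarrow> _" assume "\<forall>x. c x \<in> part ?B (p x)"
    then have c: "\<And>x. c x \<in> carrier ?B" using B.part_carrier by blast
    have "eval_poly ?B c (nmon (left_word (r + 1))) = \<zero>\<^bsub>?B\<^esub>"
      using sat c by (auto simp: satisfies_def simp del: left_word.simps)
    then have "eval_monom ?B c (left_word (r + 1)) = \<zero>\<^bsub>?B\<^esub>"
      using c by (simp del: left_word.simps)
    then show "eval_poly ?B c (superization p (nmon (left_word (r + 1)))) = \<zero>\<^bsub>?B\<^esub>"
      using c by (simp add: nmon_def superization_single del: left_word.simps)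
  qed
qed

text \<open>Of all splittings of \<open>V\<close> only the one with right part \<open>T\<close>
  survives.\<close>

lemma (in superalgebra) mult_homog_right:
  assumes h: "h \<in> carrier G" and T: "finite V" "T \<subseteq> V" and c: "c \<in> carrier A"
  shows "(h \<otimes>\<^bsub>G\<^esub> homog T c) V = grass_sign (V - T) T \<odot> (h (V - T) \<otimes> c)"
proof -
  have VT: "V - (V - T) = T" using T by auto
  have "(h \<otimes>\<^bsub>G\<^esub> homog T c) V
      = (\<Oplus>S\<in>Pow V. if V - T = S then grass_sign S (V - S) \<odot> (h S \<otimes> homog T c (V - S)) else \<zero>)"
    using T c envelopeD(4)[OF h] unfolding envelope_simps
    by (simp, intro finsum_cong') (auto simp: homog_def mult_closed)
  also have "\<dots> = grass_sign (V - T) (V - (V - T)) \<odot> (h (V - T) \<otimes> homog T c (V - (V - T)))"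
    using T c envelopeD(4)[OF h] by (intro finsum_singleton) (auto simp: homog_def mult_closed)
  finally show ?thesis unfolding VT by (simp add: homog_def)
qed

text \<open>The first two letters both go to \<open>y_0\<close>, and each of the two factors in turn
  contributes the square while the other contributes the odd generator. This repetition lets
  \<open>n + 1\<close> generators produce a nonzero word of degree \<open>n + 2\<close>.\<close>

lemma var_free_alg_not_left_word:
  "\<not> satisfies (var_free_alg nalt2_identities (n + 1)) (nmon (left_word (n + 1)) :: 'a::field_char_0 npoly)"
proof
  assume sat: "satisfies (var_free_alg nalt2_identities (n + 1)) (nmon (left_word (n + 1)) :: 'a npoly)"
  let ?M = "nalt_model :: ('a, 'a \<times> (nat \<Rightarrow> 'a) \<times> (nat \<Rightarrow> 'a)) superalg"
  interpret M: superalgebra ?M by (rule superalgebra_nalt_model)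
  interpret G: nonassoc_algebra "grassmann_envelope ?M" by (rule M.nonassoc_algebra_envelope)
  let ?u = "M.homog {} model_square" and ?x = "\<lambda>j. M.homog {j} model_gen"
  define b where "b j = (if j = 0 then ?u \<oplus>\<^bsub>M.G\<^esub> ?x 0 else ?x j)" for j :: nat
  \<comment> \<open>The letters 0, 1, 2, ..., n + 1 become the generators 0, 0, 1, ..., n.\<close>
  define a :: "nat \<Rightarrow> 'a npoly" where
    "a j = (if j = 0 then nvar 0 else if j \<le> n + 1 then nvar (j - 1) else 0)" for j
  let ?z = "\<lambda>j. eval_poly M.G b (a j)"
  \<comment> \<open>\<open>w k\<close> is to be the coefficient of \<open>e_0 ... e_(k-1)\<close> in
    the word of \<open>k + 1\<close> letters; both components are 1 because the coefficient of
    \<open>e_0\<close> in \<open>y_0 y_0\<close> is \<open>x x^2 + x^2 x\<close>.\<close>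
  define w :: "nat \<Rightarrow> 'a \<times> (nat \<Rightarrow> 'a) \<times> (nat \<Rightarrow> 'a)" where
    "w k = (0, \<lambda>d. if d = k then 1 else 0, \<lambda>d. if d = k then 1 else 0)" for k
  have u: "?u \<in> carrier M.G"
    using model_parts(2) by (intro M.homog_closed) simp_all
  have x: "?x j \<in> carrier M.G" for j
    using model_parts(1) by (intro M.homog_closed) simp_all
  have ux: "?u \<oplus>\<^bsub>M.G\<^esub> ?x 0 \<in> carrier M.G" using u x by (rule G.a_closed)
  have "\<zero>\<^bsub>?M\<^esub> \<oplus>\<^bsub>?M\<^esub> model_gen = model_gen" "model_square \<oplus>\<^bsub>?M\<^esub> \<zero>\<^bsub>?M\<^esub> = model_square"
    by (rule M.l_zero M.r_zero; simp)+
  then have vals: "(?u \<oplus>\<^bsub>M.G\<^esub> ?x 0) {0} = model_gen" "(?u \<oplus>\<^bsub>M.G\<^esub> ?x 0) {} = model_square"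
    by (simp_all add: M.envelope_simps(2) M.homog_def del: nalt_model_simps(2))
  have b: "b j \<in> carrier M.G" for j using u x by (simp add: b_def)
  have z: "?z j \<in> carrier M.G" for j using b by simp
  have models: "models M.G nalt2_identities"
    using models_envelope_iff[OF superalgebra_nalt_model] super_models_nalt_model by blast
  have z0: "?z 0 = ?u \<oplus>\<^bsub>M.G\<^esub> ?x 0" and z1: "?z (Suc 0) = ?u \<oplus>\<^bsub>M.G\<^esub> ?x 0"
    using b by (simp_all add: a_def b_def)
  have zj: "?z (Suc j) = ?x j" if "1 \<le> j" "j \<le> n" for j
    using b that by (simp add: a_def b_def)
  have wgen: "w k \<otimes>\<^bsub>?M\<^esub> model_gen = w (Suc k)" for k
    by (auto simp: w_def model_gen_def fun_eq_iff split: nat.split)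
  have w1: "model_gen \<otimes>\<^bsub>?M\<^esub> model_square \<oplus>\<^bsub>?M\<^esub> model_square \<otimes>\<^bsub>?M\<^esub> model_gen = w 1"
    by (auto simp: w_def model_gen_def model_square_def left_coef_def fun_eq_iff split: nat.split)
  have sgn: "grass_sign {0..<k} {k} = (1 :: 'a)" for k :: nat
  proof -
    have "{(s, t). s \<in> {0..<k} \<and> t \<in> {k} \<and> t < s} = {}" by auto
    then show ?thesis unfolding grass_sign_def by (simp only: card.empty power_0)
  qed
  have word: "eval_monom M.G ?z (left_word k) {0..<k} = w k" if "1 \<le> k" "k \<le> n + 1" for k
    using that
  proof (induction k)
    case (Suc k)
    show ?case
    proof (cases "k = 0")
      case True
      have "eval_monom M.G ?z (left_word (Suc k)) = (?u \<oplus>\<^bsub>M.G\<^esub> ?x 0) \<otimes>\<^bsub>M.G\<^esub> (?u \<oplus>\<^bsub>M.G\<^esub> ?x 0)"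
        by (simp add: True z0 z1)
      also have "\<dots> = (?u \<oplus>\<^bsub>M.G\<^esub> ?x 0) \<otimes>\<^bsub>M.G\<^esub> ?u \<oplus>\<^bsub>M.G\<^esub> (?u \<oplus>\<^bsub>M.G\<^esub> ?x 0) \<otimes>\<^bsub>M.G\<^esub> ?x 0"
        using u x by (intro G.mult_add_right) auto
      finally have "eval_monom M.G ?z (left_word (Suc k)) {0..<Suc k}
          = ((?u \<oplus>\<^bsub>M.G\<^esub> ?x 0) \<otimes>\<^bsub>M.G\<^esub> ?u) {0} \<oplus>\<^bsub>?M\<^esub> ((?u \<oplus>\<^bsub>M.G\<^esub> ?x 0) \<otimes>\<^bsub>M.G\<^esub> ?x 0) {0}"
        by (simp only: M.envelope_simps(2) True) simp
      also have "((?u \<oplus>\<^bsub>M.G\<^esub> ?x 0) \<otimes>\<^bsub>M.G\<^esub> ?u) {0} = model_gen \<otimes>\<^bsub>?M\<^esub> model_square"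
      proof -
        have "((?u \<oplus>\<^bsub>M.G\<^esub> ?x 0) \<otimes>\<^bsub>M.G\<^esub> ?u) {0} = grass_sign ({0} - {}) {} \<odot>\<^bsub>?M\<^esub>
            ((?u \<oplus>\<^bsub>M.G\<^esub> ?x 0) ({0} - {}) \<otimes>\<^bsub>?M\<^esub> model_square)"
          by (rule M.mult_homog_right[OF ux]) auto
        then show ?thesis unfolding Diff_empty vals by (simp add: M.smult_one_left)
      qed
      also have "((?u \<oplus>\<^bsub>M.G\<^esub> ?x 0) \<otimes>\<^bsub>M.G\<^esub> ?x 0) {0} = model_square \<otimes>\<^bsub>?M\<^esub> model_gen"
      proof -
        have "((?u \<oplus>\<^bsub>M.G\<^esub> ?x 0) \<otimes>\<^bsub>M.G\<^esub> ?x 0) {0} = grass_sign ({0} - {0}) {0} \<odot>\<^bsub>?M\<^esub>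
            ((?u \<oplus>\<^bsub>M.G\<^esub> ?x 0) ({0} - {0}) \<otimes>\<^bsub>?M\<^esub> model_gen)"
          by (rule M.mult_homog_right[OF ux]) auto
        then show ?thesis unfolding Diff_cancel vals by (simp add: M.smult_one_left)
      qed
      finally show ?thesis using w1 True by simp
    next
      case False
      then have IH: "eval_monom M.G ?z (left_word k) {0..<k} = w k" using Suc by simp
      have "eval_monom M.G ?z (left_word (Suc k)) {0..<Suc k}
          = (eval_monom M.G ?z (left_word k) \<otimes>\<^bsub>M.G\<^esub> ?x k) {0..<Suc k}"
        using zj[of k] False Suc.prems by simp
      also have "\<dots> = grass_sign ({0..<Suc k} - {k}) {k} \<odot>\<^bsub>?M\<^esub>
          (eval_monom M.G ?z (left_word k) ({0..<Suc k} - {k}) \<otimes>\<^bsub>?M\<^esub> model_gen)"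
        using z by (intro M.mult_homog_right) auto
      also have "{0..<Suc k} - {k} = {0..<k}" by auto
      finally show ?thesis by (simp add: IH sgn wgen M.smult_one_left)
    qed
  qed simp
  have "eval_poly M.G ?z (nmon (left_word (n + 1))) = \<zero>\<^bsub>M.G\<^esub>"
  proof (rule satisfies_var_free_algD[OF sat models b])
    show "a j \<in> carrier (free_alg {..<n + 1})" for j
      by (auto simp: a_def free_alg_def nvar_def)
  qed
  then have "eval_monom M.G ?z (left_word (n + 1)) = \<zero>\<^bsub>M.G\<^esub>"
    using z by (simp del: left_word.simps)
  then have "w (n + 1) = \<zero>\<^bsub>?M\<^esub>" using word[of "n + 1"] by (simp add: M.envelope_simps(1) del: left_word.simps)
  then have "fst (snd (w (n + 1))) (n + 1) = 0" by simp
  then show False by (simp add: w_def)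
qed

section \<open>Basic spectrum and strict inclusions\<close>

theorem theorem1:
  fixes emb :: "'a::field_char_0 npoly \<Rightarrow> 'v"
  assumes "inj emb"
  shows "basic_spectrum TYPE('v) (nalt2_identities :: 'a npoly set) = {(0, 1)} \<and>
    (\<forall>n\<ge>1. (rank_variety nalt2_identities n :: ('a, 'v) module set)
              \<subset> rank_variety nalt2_identities (n + 1))"
proof (intro conjI allI impI)
  let ?E = "nalt2_identities :: 'a npoly set"
  \<comment> \<open>Cosets go to representatives and these into \<open>'v\<close>, which provides a
    copy of the free superalgebra on the given carrier type.\<close>
  let ?j = "\<lambda>X. emb (SOME x. x \<in> X)"
  let ?B = "var_free_superalg ?E 0 1"
  let ?F = "free_superalg_rs 0 1 :: ('a, 'a npoly) superalg"
  interpret F: superalgebra ?F unfolding free_superalg_rs by (rule superalgebra_free_superalg)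
  have B: "super_models ?B" by (rule super_models_var_free_superalg)
  have "graded_ideal (super_rel_ideal ?E 0 1) ?F" by (rule graded_ideal_super_rel_ideal)
  then have "alg_ideal (super_rel_ideal ?E 0 1) ?F" by (simp add: graded_ideal_def)
  from F.inj_on_coset_representative[OF this] have "inj_on ?j (carrier ?B)"
    unfolding var_free_superalg_def F.carrier_quot_superalg
    using assms by (auto simp: inj_on_def)
  \<comment> \<open>This copy of the free superalgebra on one odd generator satisfies no left-normed
    word and so separates \<open>var_superalgs\<close> from the class of every pair
    \<open>(r, 0)\<close>.\<close>
  define C where "C = superalg_transfer ?j ?B"
  have sC: "superalgebra C" and satC: "super_satisfies C f \<longleftrightarrow> super_satisfies ?B f" for f
    unfolding C_def using B \<open>inj_on ?j (carrier ?B)\<close> superalg_transfer[of ?B ?j]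
    by (auto simp: super_models_def)
  interpret C: superalgebra C by (rule sC)
  have C: "C \<in> var_superalgs ?E"
    using B sC satC by (simp add: var_superalgs_eq super_models_def)
  have notC: "\<not> super_satisfies C (nmon (left_word n))" for n
    unfolding satC by (rule odd_gen_not_left_word)
  have "C \<notin> rank_supervariety ?E 0 0"
  proof
    assume "C \<in> rank_supervariety ?E 0 0"
    then have "carrier C = {\<zero>\<^bsub>C\<^esub>}" by (simp add: rank_supervariety_def)
    then have "super_satisfies C (nmon (left_word 0))"
      unfolding super_satisfies_def using C.eval_poly_closed C.part_carrier by blast
    with notC show False by blast
  qed
  then have r0: "rank_supervariety ?E r 0 \<noteq> (var_superalgs ?E :: ('a, 'v) superalg set)" for r
  proof (cases "r = 0")
    case False
    then have "C \<notin> rank_supervariety ?E r 0"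
      using even_gens_left_word[of r] multilinear_left_word[of "r + 1"] notC[of "r + 1"]
      by (auto simp: rank_supervariety_def generated_supervariety_def simp del: left_word.simps)
    with C show ?thesis by blast
  qed (use C in blast)
  have 1: "basic_superrank TYPE('v) ?E 0 1"
    unfolding basic_superrank_def
  proof (intro conjI allI impI rank_supervariety_0_1)
    fix r' s' :: nat assume "(r', s') \<noteq> (0, 1) \<and> r' \<le> 0 \<and> s' \<le> 1"
    then have "s' = 0" by auto
    then show "(rank_supervariety ?E r' s' :: ('a, 'v) superalg set) \<noteq> var_superalgs ?E"
      using r0 by simp
  qed
  \<comment> \<open>A pair with \<open>s \<noteq> 0\<close> lies above \<open>(0, 1)\<close>, which
    already generates everything, so minimality forces equality; pairs with \<open>s = 0\<close> are
    excluded by \<open>r0\<close>.\<close>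
  have unique: "(r, s) = (0, 1)" if "basic_superrank TYPE('v) ?E r s" for r s
  proof (rule ccontr)
    assume "(r, s) \<noteq> (0, 1)"
    moreover have "s \<noteq> 0"
    proof
      assume "s = 0"
      with that r0[of r] show False by (simp add: basic_superrank_def)
    qed
    ultimately have "(0, 1) \<noteq> (r, s) \<and> 0 \<le> r \<and> 1 \<le> s" by auto
    then have "(rank_supervariety ?E 0 1 :: ('a, 'v) superalg set) \<noteq> var_superalgs ?E"
      using that unfolding basic_superrank_def by blast
    then show False using rank_supervariety_0_1 by blast
  qed
  show "basic_spectrum TYPE('v) ?E = {(0, 1)}"
  proof (intro equalityI subsetI)
    fix rs assume rs: "rs \<in> basic_spectrum TYPE('v) ?E"
    obtain r s where "rs = (r, s)" by (cases rs)
    with rs unique[of r s] show "rs \<in> {(0, 1)}" by (simp add: basic_spectrum_def)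
  qed (use 1 in \<open>simp add: basic_spectrum_def\<close>)
next
  let ?E = "nalt2_identities :: 'a npoly set"
  let ?j = "\<lambda>X. emb (SOME x. x \<in> X)"
  fix n :: nat
  let ?V = "var_free_alg ?E (n + 1)" and ?F = "free_alg {..<n + 1} :: ('a, 'a npoly) module"
  \<comment> \<open>The copied free algebra of rank \<open>n + 1\<close> witnesses strictness:
    \<open>left_word (n + 1)\<close> is an identity in rank \<open>n\<close> but not in rank
    \<open>n + 1\<close>.\<close>
  let ?A = "alg_transfer ?j ?V :: ('a, 'v) module"
  interpret F: nonassoc_algebra ?F by (rule nonassoc_algebra_free_alg)
  have V: "nonassoc_algebra ?V" using models_var_free_alg by (auto simp: models_def)
  have "inj_on ?j (carrier ?V)"
    using F.inj_on_coset_representative[OF alg_ideal_rel_ideal] assms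
    unfolding var_free_alg_def F.carrier_quot_alg by (auto simp: inj_on_def)
  then have A: "nonassoc_algebra ?A" and satA: "satisfies ?A f \<longleftrightarrow> satisfies ?V f" for f
    using alg_transfer[OF V] by auto
  have "?A \<in> rank_variety ?E (n + 1)"
    using A satA by (simp add: rank_variety_def generated_variety_def)
  moreover have "?A \<notin> rank_variety ?E n"
    using satA var_free_alg_left_word[of n] var_free_alg_not_left_word[of n]
    by (auto simp: rank_variety_def generated_variety_def simp del: left_word.simps)
  moreover have "(rank_variety ?E n :: ('a, 'v) module set) \<subseteq> rank_variety ?E (n + 1)"
    using satisfies_var_free_alg_mono[of ?E "n + 1" _ n]
    by (auto simp: rank_variety_def generated_variety_def)
  ultimately show "(rank_variety ?E n :: ('a, 'v) module set) \<subset> rank_variety ?E (n + 1)" by blast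
qed

end
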